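(* Let $D$ be the closed two-dimensional disk, let $\mathcal{G}$ be a subgroup of $\mathrm{Homeo}(D)$ and let $f$ be an element of the center of $\mathcal{G}$. Suppose that $K := \mathrm{Fix}(f)\cap \partial D$ is a finite set with more than two elements, each of which is either an attracting or a repelling fixed point for $f : D \to D$. Let $\mathcal{G}_0 \subset \mathcal{G}$ denote the finite index subgroup consisting of those elements of $\mathcal{G}$ that fix every point of $K$. Then $\mathrm{Fix}(\mathcal{G}_0)\cap \mathrm{int}(D)$ is non-empty.
   Context: $\mathrm{Homeo}(D)$ denotes the group of orientation preserving homeomorphisms of $D$. For a homeomorphism $f$, $\mathrm{Fix}(f)$ is its set of fixed points; for a group $\mathcal{G}$ of homeomorphisms, $\mathrm{Fix}(\mathcal{G})$ is the set of global fixed points, i.e. points fixed by every element of $\mathcal{G}$. $\mathrm{int}(D) = D\setminus \partial D$. Let $f : X \to X$ be a homeomorphism of a locally compact metric space and $x_0 \in \mathrm{Fix}(f)$. The point $x_0$ is an attracting fixed point for $f$ if there is a compact neighborhood $W$ of $x_0$ (in $X$) such that $f^n(W) \to \{x_0\}$ in the Hausdorff topology, i.e. for every neighborhood $N$ of $x_0$ we have $f^n(W)\subset N$ for all sufficiently large $n$. The point $x_0$ is a repelling fixed point for $f$ if it is an attracting fixed point for $f^{-1}$. Here these notions are applied with $X = D$ (not only to $f|_{\partial D}$). *)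

theory Defs
  imports
    "HOL-Analysis.Analysis"
    "HOL-Algebra.Bij"
    "HOL-Algebra.Coset"
    "HOL-Homology.Homology_Groups"
begin

abbreviation disk :: "complex set"
  where "disk \<equiv> cball 0 1"

abbreviation disk_boundary :: "complex set"
  where "disk_boundary \<equiv> sphere 0 1"

text \<open>
  A homeomorphism of the disk preserves orientation iff it preserves the fundamental class, that
  is, iff it acts as the identity on the infinite cyclic group \<open>H\<^sub>2(D, \<partial>D)\<close>. The library's
  \<^const>\<open>hom_induced\<close> is the induced map only for maps of pairs, so the definition is meaningful only
  if \<open>f\<close> maps \<open>\<partial>D\<close> into \<open>\<partial>D\<close>; homeomorphisms of \<open>D\<close> do, by invariance of domain (see
  \<open>homeomorphism_disk_boundary\<close> below).
\<close>

definition orientation_preserving :: "(complex \<Rightarrow> complex) \<Rightarrow> bool" where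
  "orientation_preserving f \<longleftrightarrow>
     (\<forall>c \<in> carrier (relative_homology_group 2 (top_of_set disk) disk_boundary).
        hom_induced 2 (top_of_set disk) disk_boundary (top_of_set disk) disk_boundary f c = c)"

text \<open>
  As in \<^const>\<open>BijGroup\<close>, self-maps of \<open>D\<close> are represented by functions that are
  \<^const>\<open>undefined\<close> outside \<open>D\<close>, and the group operation is composition.
\<close>

definition Homeo_disk :: "(complex \<Rightarrow> complex) monoid" where
  "Homeo_disk = (BijGroup disk)
     \<lparr>carrier := {f \<in> extensional disk.
                   (\<exists>g. homeomorphism disk disk f g) \<and> orientation_preserving f}\<rparr>"

definition center :: "('a, 'b) monoid_scheme \<Rightarrow> 'a set" where
  "center G = {z \<in> carrier G. \<forall>g \<in> carrier G. z \<otimes>\<^bsub>G\<^esub> g = g \<otimes>\<^bsub>G\<^esub> z}"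

definition Fix :: "'a set \<Rightarrow> ('a \<Rightarrow> 'a) \<Rightarrow> 'a set" where
  "Fix X f = {x \<in> X. f x = x}"

definition global_Fix :: "'a set \<Rightarrow> ('a \<Rightarrow> 'a) set \<Rightarrow> 'a set" where
  "global_Fix X G = {x \<in> X. \<forall>g \<in> G. g x = x}"

text \<open>
  Neighborhoods are taken in the subspace \<open>X\<close>; \<open>W\<close> need not be open, while
  the neighborhoods \<open>N\<close> to be absorbed may be taken open in \<open>X\<close>.
\<close>

definition attracting_fixed_point ::
    "'a::metric_space set \<Rightarrow> ('a \<Rightarrow> 'a) \<Rightarrow> 'a \<Rightarrow> bool" where
  "attracting_fixed_point X f x \<longleftrightarrow>
     x \<in> Fix X f \<and>
     (\<exists>W. W \<subseteq> X \<and> compact W \<and> x \<in> (top_of_set X) interior_of W \<and>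
          (\<forall>N. openin (top_of_set X) N \<and> x \<in> N \<longrightarrow>
               (\<forall>\<^sub>F n in sequentially. (f ^^ n) ` W \<subseteq> N)))"

definition repelling_fixed_point ::
    "'a::metric_space set \<Rightarrow> ('a \<Rightarrow> 'a) \<Rightarrow> 'a \<Rightarrow> bool" where
  "repelling_fixed_point X f x \<longleftrightarrow> attracting_fixed_point X (inv_into X f) x"

definition pointwise_stabilizer :: "('a \<Rightarrow> 'a) set \<Rightarrow> 'a set \<Rightarrow> ('a \<Rightarrow> 'a) set" where
  "pointwise_stabilizer G K = {g \<in> G. \<forall>x \<in> K. g x = x}"


lemma homeomorphism_disk_ball:
  assumes "homeomorphism disk disk f g"
  shows "f ` ball 0 1 \<subseteq> ball 0 1"
proof -
  have sub: "ball 0 1 \<subseteq> disk"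
    by auto
  have cont: "continuous_on disk f" and gf: "\<And>x. x \<in> disk \<Longrightarrow> g (f x) = x"
    and im: "f ` disk = disk"
    using assms by (simp_all add: homeomorphism_def)
  have "inj_on f disk"
    by (rule inj_on_inverseI[where g = g]) (rule gf)
  then have "open (f ` ball 0 1)"
    by (intro invariance_of_domain continuous_on_subset[OF cont sub] open_ball)
      (rule inj_on_subset[OF _ sub])
  moreover have "f ` ball 0 1 \<subseteq> disk"
    using image_mono[OF sub, of f] im by simp
  ultimately have "f ` ball 0 1 \<subseteq> interior disk"
    by (intro interior_maximal)
  then show ?thesis by simp
qed

lemma homeomorphism_disk_boundary:
  assumes "homeomorphism disk disk f g"
  shows "f ` disk_boundary = disk_boundary"
proof -
  have sub: "f x \<in> disk_boundary"
    if h: "homeomorphism disk disk f g" and x: "x \<in> disk_boundary" for f g x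
  proof (rule ccontr)
    assume "f x \<notin> disk_boundary"
    moreover have "x \<in> disk"
      using x by auto
    then have "f x \<in> disk" and gf: "g (f x) = x"
      using h unfolding homeomorphism_def by blast+
    ultimately have "f x \<in> ball 0 1"
      by auto
    then have "g (f x) \<in> ball 0 1"
      using homeomorphism_disk_ball[OF homeomorphism_symD[OF h]] by blast
    then show False
      using gf x by auto
  qed
  have "y \<in> f ` disk_boundary" if y: "y \<in> disk_boundary" for y
  proof -
    have "g y \<in> disk_boundary"
      using sub[OF homeomorphism_symD[OF assms] y] .
    moreover have "y \<in> disk"
      using y by auto
    then have "f (g y) = y"
      using assms unfolding homeomorphism_def by blast
    ultimately show ?thesis by force
  qed
  then show ?thesis
    using sub[OF assms] by blast
qed

lemma orientation_preserving_cong: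
  assumes "\<And>x. x \<in> disk \<Longrightarrow> f x = g x"
  shows "orientation_preserving f = orientation_preserving g"
proof -
  have "hom_induced 2 (top_of_set disk) disk_boundary (top_of_set disk) disk_boundary f =
        hom_induced 2 (top_of_set disk) disk_boundary (top_of_set disk) disk_boundary g"
    by (rule hom_induced_eq) (use assms in auto)
  then show ?thesis
    by (simp add: orientation_preserving_def)
qed

lemma orientation_preserving_id: "orientation_preserving id"
  by (simp add: orientation_preserving_def hom_induced_id)

lemma hom_induced_disk_compose:
  assumes f: "homeomorphism disk disk f f'" and g: "homeomorphism disk disk g g'"
  shows "hom_induced 2 (top_of_set disk) disk_boundary (top_of_set disk) disk_boundary (g \<circ> f) =
         hom_induced 2 (top_of_set disk) disk_boundary (top_of_set disk) disk_boundary g \<circ>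
         hom_induced 2 (top_of_set disk) disk_boundary (top_of_set disk) disk_boundary f"
proof (rule hom_induced_compose)
  show "continuous_map (top_of_set disk) (top_of_set disk) f"
    and "continuous_map (top_of_set disk) (top_of_set disk) g"
    using f g by (auto simp: homeomorphism_def)
  show "f \<in> disk_boundary \<rightarrow> disk_boundary" "g \<in> disk_boundary \<rightarrow> disk_boundary"
    using homeomorphism_disk_boundary f g by blast+
qed

lemma orientation_preserving_compose:
  assumes "homeomorphism disk disk f f'" "homeomorphism disk disk g g'"
    and "orientation_preserving f" "orientation_preserving g"
  shows "orientation_preserving (g \<circ> f)"
  using assms(3,4) by (simp add: orientation_preserving_def hom_induced_disk_compose[OF assms(1,2)])

lemma orientation_preserving_inverse:
  assumes h: "homeomorphism disk disk f g" and "orientation_preserving f"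
  shows "orientation_preserving g"
proof -
  have "orientation_preserving (g \<circ> f)"
    using orientation_preserving_cong[of "g \<circ> f" id] orientation_preserving_id h
    by (simp add: homeomorphism_def)
  then show ?thesis
    using assms(2)
    by (simp add: orientation_preserving_def hom_induced_disk_compose[OF h homeomorphism_symD[OF h]])
qed

lemma homeomorphism_imp_Bij:
  assumes "homeomorphism S S f g" and "f \<in> extensional S"
  shows "f \<in> Bij S"
proof -
  have "bij_betw f S S"
    by (rule bij_betw_byWitness[where f' = g]) (use assms(1) in \<open>auto simp: homeomorphism_def\<close>)
  then show ?thesis
    using assms(2) by (simp add: Bij_def)
qed

lemma Homeo_disk_carrier_iff:
  "f \<in> carrier Homeo_disk \<longleftrightarrow>
     f \<in> extensional disk \<and> (\<exists>g. homeomorphism disk disk f g) \<and> orientation_preserving f"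
  by (simp add: Homeo_disk_def)

lemma Homeo_disk_subset_Bij: "carrier Homeo_disk \<subseteq> Bij disk"
  using homeomorphism_imp_Bij unfolding Homeo_disk_carrier_iff subset_iff by blast

lemma Homeo_disk_subgroup: "subgroup (carrier Homeo_disk) (BijGroup disk)"
proof
  show "carrier Homeo_disk \<subseteq> carrier (BijGroup disk)"
    using Homeo_disk_subset_Bij by (simp add: BijGroup_def)
next
  have "homeomorphism disk disk (\<lambda>x\<in>disk. x) id"
    by (rule homeomorphism_cong[OF homeomorphism_ident]) auto
  moreover have "orientation_preserving (\<lambda>x\<in>disk. x)"
    using orientation_preserving_cong[of "\<lambda>x\<in>disk. x" id] orientation_preserving_id by simp
  ultimately have "(\<lambda>x\<in>disk. x) \<in> carrier Homeo_disk"
    unfolding Homeo_disk_carrier_iff by blast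
  then show "\<one>\<^bsub>BijGroup disk\<^esub> \<in> carrier Homeo_disk"
    by (simp add: BijGroup_def)
next
  fix f g assume fg: "f \<in> carrier Homeo_disk" "g \<in> carrier Homeo_disk"
  then obtain f' g' where f: "homeomorphism disk disk f f'" "orientation_preserving f"
    and g: "homeomorphism disk disk g g'" "orientation_preserving g"
    unfolding Homeo_disk_carrier_iff by blast
  have B: "f \<in> Bij disk" "g \<in> Bij disk"
    using fg Homeo_disk_subset_Bij by blast+
  have "homeomorphism disk disk (compose disk f g) (g' \<circ> f')"
    by (rule homeomorphism_cong[OF homeomorphism_compose[OF g(1) f(1)]]) (auto simp: compose_def)
  moreover have "orientation_preserving (compose disk f g)"
    using orientation_preserving_compose[OF g(1) f(1) g(2) f(2)]
      orientation_preserving_cong[of "compose disk f g" "f \<circ> g"] by (simp add: compose_def)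
  ultimately have "compose disk f g \<in> carrier Homeo_disk"
    unfolding Homeo_disk_carrier_iff using compose_extensional by blast
  then show "f \<otimes>\<^bsub>BijGroup disk\<^esub> g \<in> carrier Homeo_disk"
    using B by (simp add: BijGroup_def)
next
  fix f assume fc: "f \<in> carrier Homeo_disk"
  then obtain g where f: "homeomorphism disk disk f g" "orientation_preserving f"
    unfolding Homeo_disk_carrier_iff by blast
  have B: "f \<in> Bij disk"
    using fc Homeo_disk_subset_Bij by blast
  then have inj: "inj_on f disk"
    by (simp add: Bij_def bij_betw_def)
  have eq: "inv_into disk f y = g y" if "y \<in> disk" for y
  proof (rule inv_into_f_eq[OF inj])
    show "g y \<in> disk" "f (g y) = y"
      using f(1) that unfolding homeomorphism_def by blast+
  qed
  have "homeomorphism disk disk (\<lambda>x\<in>disk. inv_into disk f x) f"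
    by (rule homeomorphism_cong[OF homeomorphism_symD[OF f(1)]]) (simp_all add: eq)
  moreover have "orientation_preserving (\<lambda>x\<in>disk. inv_into disk f x)"
    using orientation_preserving_inverse[OF f]
      orientation_preserving_cong[of "\<lambda>x\<in>disk. inv_into disk f x" g] eq by simp
  ultimately have "(\<lambda>x\<in>disk. inv_into disk f x) \<in> carrier Homeo_disk"
    unfolding Homeo_disk_carrier_iff using restrict_extensional by blast
  then show "inv\<^bsub>BijGroup disk\<^esub> f \<in> carrier Homeo_disk"
    using inv_BijGroup[OF B] by simp
qed

lemma group_Homeo_disk: "group Homeo_disk"
proof -
  have "Homeo_disk = (BijGroup disk)\<lparr>carrier := carrier Homeo_disk\<rparr>"
    by (simp add: Homeo_disk_def)
  then show ?thesis
    using subgroup.subgroup_is_group[OF Homeo_disk_subgroup group_BijGroup] by simp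
qed

text \<open>
  Elements commuting with \<open>f\<close> permute \<open>Fix(f) \<inter> \<partial>D\<close>; hence the pointwise stabilizer of this set,
  if it is finite, is a subgroup of finite index.
\<close>

lemma Homeo_disk_mult:
  assumes "f \<in> carrier Homeo_disk" "g \<in> carrier Homeo_disk"
  shows "f \<otimes>\<^bsub>Homeo_disk\<^esub> g = compose disk f g"
  using assms Homeo_disk_subset_Bij by (auto simp: Homeo_disk_def BijGroup_def)

lemma Homeo_disk_one: "\<one>\<^bsub>Homeo_disk\<^esub> = (\<lambda>x\<in>disk. x)"
  by (simp add: Homeo_disk_def BijGroup_def)

context
  fixes G :: "(complex \<Rightarrow> complex) set" and f :: "complex \<Rightarrow> complex" and K :: "complex set"
  assumes G: "subgroup G Homeo_disk"
    and f: "f \<in> center (Homeo_disk\<lparr>carrier := G\<rparr>)"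
    and K: "K = Fix disk f \<inter> disk_boundary"
begin

lemma mem_Homeo_disk: "g \<in> G \<Longrightarrow> g \<in> carrier Homeo_disk"
  using subgroup.mem_carrier[OF G] .

lemma f_in_G: "f \<in> G"
  using f by (simp add: center_def)

lemma G_group: "group (Homeo_disk\<lparr>carrier := G\<rparr>)"
  using subgroup.subgroup_is_group[OF G group_Homeo_disk] .

lemma G_mult_apply:
  assumes "g \<in> G" "h \<in> G" "x \<in> disk"
  shows "(g \<otimes>\<^bsub>Homeo_disk\<^esub> h) x = g (h x)"
  using Homeo_disk_mult[OF mem_Homeo_disk mem_Homeo_disk, OF assms(1,2)] assms(3)
  by (simp add: compose_def)

lemma G_maps_K:
  assumes g: "g \<in> G" and x: "x \<in> K"
  shows "g x \<in> K"
proof -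
  obtain g' where h: "homeomorphism disk disk g g'"
    using mem_Homeo_disk[OF g] unfolding Homeo_disk_carrier_iff by blast
  have x': "x \<in> disk" "f x = x" "x \<in> disk_boundary"
    using x unfolding K Fix_def by auto
  have "f \<otimes>\<^bsub>Homeo_disk\<^esub> g = g \<otimes>\<^bsub>Homeo_disk\<^esub> f"
    using f g by (simp add: center_def)
  then have "f (g x) = g x"
    using G_mult_apply[OF f_in_G g x'(1)] G_mult_apply[OF g f_in_G x'(1)] x'(2) by simp
  moreover have "g x \<in> disk_boundary"
    using homeomorphism_disk_boundary[OF h] x'(3) by blast
  moreover have "g x \<in> disk"
    using h x'(1) unfolding homeomorphism_def by blast
  ultimately show ?thesis
    unfolding K Fix_def by blast
qed

lemma K_subset_disk: "K \<subseteq> disk"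
  unfolding K Fix_def by blast

lemma G_inv:
  assumes "g \<in> G"
  shows "inv\<^bsub>Homeo_disk\<^esub> g \<in> G"
    and "x \<in> disk \<Longrightarrow> g ((inv\<^bsub>Homeo_disk\<^esub> g) x) = x"
    and "x \<in> disk \<Longrightarrow> (inv\<^bsub>Homeo_disk\<^esub> g) (g x) = x"
proof -
  show inv: "inv\<^bsub>Homeo_disk\<^esub> g \<in> G"
    using subgroup.m_inv_closed[OF G assms] .
  show "g ((inv\<^bsub>Homeo_disk\<^esub> g) x) = x" if "x \<in> disk"
    using G_mult_apply[OF assms inv that] group.r_inv[OF group_Homeo_disk mem_Homeo_disk[OF assms]]
      that by (simp add: Homeo_disk_one)
  show "(inv\<^bsub>Homeo_disk\<^esub> g) (g x) = x" if "x \<in> disk"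
    using G_mult_apply[OF inv assms that] group.l_inv[OF group_Homeo_disk mem_Homeo_disk[OF assms]]
      that by (simp add: Homeo_disk_one)
qed

lemma pointwise_stabilizer_subgroup:
  "subgroup (pointwise_stabilizer G K) (Homeo_disk\<lparr>carrier := G\<rparr>)"
proof (rule group.subgroupI[OF G_group])
  show "pointwise_stabilizer G K \<subseteq> carrier (Homeo_disk\<lparr>carrier := G\<rparr>)"
    by (auto simp: pointwise_stabilizer_def)
  have "\<one>\<^bsub>Homeo_disk\<^esub> \<in> pointwise_stabilizer G K"
    using subgroup.one_closed[OF G] K_subset_disk
    by (auto simp: pointwise_stabilizer_def Homeo_disk_one)
  then show "pointwise_stabilizer G K \<noteq> {}"
    by blast
next
  fix g assume "g \<in> pointwise_stabilizer G K"
  then have g: "g \<in> G" "\<And>x. x \<in> K \<Longrightarrow> g x = x"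
    by (auto simp: pointwise_stabilizer_def)
  have "(inv\<^bsub>Homeo_disk\<^esub> g) x = x" if "x \<in> K" for x
    using G_inv(3)[OF g(1), of x] g(2)[OF that] that K_subset_disk by auto
  then show "inv\<^bsub>Homeo_disk\<lparr>carrier := G\<rparr>\<^esub> g \<in> pointwise_stabilizer G K"
    using G_inv(1)[OF g(1)] group.m_inv_consistent[OF group_Homeo_disk G g(1)]
    by (simp add: pointwise_stabilizer_def)
next
  fix g h assume "g \<in> pointwise_stabilizer G K" "h \<in> pointwise_stabilizer G K"
  then have g: "g \<in> G" "\<And>x. x \<in> K \<Longrightarrow> g x = x" and h: "h \<in> G" "\<And>x. x \<in> K \<Longrightarrow> h x = x"
    by (auto simp: pointwise_stabilizer_def)
  have "(g \<otimes>\<^bsub>Homeo_disk\<^esub> h) x = x" if "x \<in> K" for x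
    using G_mult_apply[OF g(1) h(1), of x] g(2) h(2) that K_subset_disk by auto
  then show "g \<otimes>\<^bsub>Homeo_disk\<lparr>carrier := G\<rparr>\<^esub> h \<in> pointwise_stabilizer G K"
    using subgroup.m_closed[OF G g(1) h(1)] by (simp add: pointwise_stabilizer_def)
qed

lemma r_coset_pointwise_stabilizer:
  assumes g: "g \<in> G"
  shows "pointwise_stabilizer G K #>\<^bsub>Homeo_disk\<lparr>carrier := G\<rparr>\<^esub> g =
         {h \<in> G. restrict h K = restrict g K}"
proof (intro equalityI subsetI)
  fix h assume "h \<in> pointwise_stabilizer G K #>\<^bsub>Homeo_disk\<lparr>carrier := G\<rparr>\<^esub> g"
  then obtain k where k: "k \<in> G" "\<And>x. x \<in> K \<Longrightarrow> k x = x" and h: "h = k \<otimes>\<^bsub>Homeo_disk\<^esub> g"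
    by (auto simp: r_coset_def pointwise_stabilizer_def)
  have "h x = g x" if "x \<in> K" for x
    using G_mult_apply[OF k(1) g, of x] k(2)[OF G_maps_K[OF g that]] that K_subset_disk h by auto
  then show "h \<in> {h \<in> G. restrict h K = restrict g K}"
    using subgroup.m_closed[OF G k(1) g] h by (auto intro: restrict_ext)
next
  fix h assume "h \<in> {h \<in> G. restrict h K = restrict g K}"
  then have h: "h \<in> G" and eq: "restrict h K = restrict g K"
    by simp_all
  have hg: "h x = g x" if "x \<in> K" for x
    using fun_cong[OF eq, of x] that by simp
  define k where "k = h \<otimes>\<^bsub>Homeo_disk\<^esub> inv\<^bsub>Homeo_disk\<^esub> g"
  have kG: "k \<in> G"
    using subgroup.m_closed[OF G h G_inv(1)[OF g]] by (simp add: k_def)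
  have "k x = x" if "x \<in> K" for x
    using G_mult_apply[OF h G_inv(1)[OF g], of x] hg[OF G_maps_K[OF G_inv(1)[OF g] that]]
      G_inv(2)[OF g, of x] that K_subset_disk by (auto simp: k_def)
  then have "k \<in> pointwise_stabilizer G K"
    using kG by (simp add: pointwise_stabilizer_def)
  moreover have "h = k \<otimes>\<^bsub>Homeo_disk\<^esub> g"
    unfolding k_def
    using group.inv_solve_right[OF group_Homeo_disk mem_Homeo_disk[OF kG]
        mem_Homeo_disk[OF h] mem_Homeo_disk[OF g]] by (simp add: k_def)
  ultimately show "h \<in> pointwise_stabilizer G K #>\<^bsub>Homeo_disk\<lparr>carrier := G\<rparr>\<^esub> g"
    by (auto simp: r_coset_def)
qed

lemma pointwise_stabilizer_finite_index:
  assumes "finite K"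
  shows "finite (rcosets\<^bsub>Homeo_disk\<lparr>carrier := G\<rparr>\<^esub> pointwise_stabilizer G K)"
proof (rule finite_subset)
  show "rcosets\<^bsub>Homeo_disk\<lparr>carrier := G\<rparr>\<^esub> pointwise_stabilizer G K
        \<subseteq> (\<lambda>r. {h \<in> G. restrict h K = r}) ` (K \<rightarrow>\<^sub>E K)"
  proof
    fix C assume "C \<in> rcosets\<^bsub>Homeo_disk\<lparr>carrier := G\<rparr>\<^esub> pointwise_stabilizer G K"
    then obtain g where g: "g \<in> G" and "C = pointwise_stabilizer G K #>\<^bsub>Homeo_disk\<lparr>carrier := G\<rparr>\<^esub> g"
      by (auto simp: RCOSETS_def)
    then have "C = {h \<in> G. restrict h K = restrict g K}"
      using r_coset_pointwise_stabilizer by simp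
    moreover have "restrict g K \<in> K \<rightarrow>\<^sub>E K"
      using G_maps_K[OF g] by auto
    ultimately show "C \<in> (\<lambda>r. {h \<in> G. restrict h K = r}) ` (K \<rightarrow>\<^sub>E K)"
      by blast
  qed
  show "finite ((\<lambda>r. {h \<in> G. restrict h K = r}) ` (K \<rightarrow>\<^sub>E K))"
    using assms by (intro finite_imageI finite_PiE) auto
qed

end

end

theory Submission
  imports Defs
begin

text \<open>
  After exchanging \<open>f\<close> and its inverse \<open>f'\<close> if necessary, \<open>K\<close> contains an attractor \<open>a\<close>. Its
  neighbors \<open>r\<close> and \<open>r2\<close> in \<open>K\<close> along the circle are then repellers, and they are different because \<open>K\<close>
  has more than two points. Let \<open>U\<close> be the basin of \<open>a\<close>, let \<open>\<Gamma>\<close> be its complement in the disk, and let \<open>V\<close>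
  be the basin of \<open>r\<close> under \<open>f'\<close>. A homeomorphism that commutes with \<open>f\<close> and fixes \<open>K\<close> pointwise
  (a symmetry, below) preserves \<open>U\<close>, \<open>V\<close> and the arc \<open>\<sigma>\<close> of the circle between \<open>r\<close> and \<open>a\<close>.

  In the language of prime ends: starting at \<open>r\<close> and going away from \<open>\<sigma>\<close>, the map \<open>f\<close> pushes the ends of \<open>U\<close>
  forward to a first fixed end \<open>e\<close>. As \<open>e\<close> is determined by \<open>f\<close>, \<open>U\<close> and \<open>r\<close>, every symmetry fixes \<open>e\<close>, and
  the claim is that it also fixes every point \<open>x\<close> to which crosscuts around \<open>e\<close> shrink. Let \<open>c\<close> be such a
  crosscut, with far side (the side of \<open>e\<close>) not containing \<open>a\<close>. If \<open>f ` c\<close> did not meet \<open>c\<close>, then \<open>f\<close> or \<open>f'\<close>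
  would map the far side into itself. It cannot be \<open>f\<close>, as all orbits in \<open>U\<close> converge to \<open>a\<close>, and it cannot
  be \<open>f'\<close>, which moves the ends between \<open>r\<close> and \<open>e\<close> back to \<open>r\<close>. So \<open>f ` c\<close> meets \<open>c\<close>, and \<open>f x = x\<close> in the limit.
  For a symmetry \<open>h\<close>, the maps \<open>f\<^sup>i \<circ> h\<close> pull the ends before \<open>e\<close> towards \<open>r\<close> when \<open>i\<close> is very negative, and their
  inverses do so when \<open>i\<close> is very positive. Between the two there is a range of
  exponents, independent of \<open>c\<close>, in which some \<open>f\<^sup>i \<circ> h\<close> maps \<open>c\<close> to a set meeting \<open>c\<close>; hence \<open>f\<^sup>i (h x) = x\<close> in the
  limit, and so \<open>h x = x\<close>.

  In the proof, prime ends are replaced by explicit crosscuts. The arcs \<open>\<beta>\<close> satisfying \<open>xcut\<close> lead from \<open>\<sigma>\<close>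
  to \<open>\<Gamma>\<close> within \<open>V\<close>; the ends of \<open>f\<^sup>m \<circ> \<beta>\<close> move towards \<open>e\<close> as \<open>m\<close> grows, and a set \<open>c\<close> is called essential if it cuts
  all of them off from \<open>a\<close> for large \<open>m\<close>. Essential sets of arbitrarily small diameter exist because
  the collar of \<open>\<Gamma>\<close> in \<open>U\<close> is connected (\<open>connected_collar\<close>) and contains points close to an end before \<open>e\<close>
  (\<open>left_exists\<close>) as well as others (\<open>not_left_exists\<close>): where the kind changes, the
  segments to the closest points of \<open>\<Gamma>\<close> form a small crosscut, which is essential by a linking argument
  (\<open>linked_crosscuts\<close>). All separation arguments rest on Janiszewski's theorem.

  The limit point \<open>x\<close> lies outside \<open>U\<close> and \<open>V\<close> but in the closure of both. On the circle it would be an element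
  of \<open>K\<close>, so an open basin disjoint from \<open>U\<close> or from \<open>V\<close> would contain it. Hence \<open>x\<close> is an interior point.
\<close>

section \<open>Separation in the disk\<close>

lemma eventually_at_left_1: "\<forall>\<^sub>F s in at_left 1. 0 < s \<and> s < (1::real)"
  unfolding eventually_at_left_field by (intro exI[of _ 0]) auto

lemma connected_complement_component:
  fixes U c :: "'a::real_normed_vector set"
  assumes "connected U" "connected c" "c \<subseteq> U"
  shows "connected (U - connected_component_set (U - c) x)"
proof (cases "x \<in> U - c")
  case True
  then have "connected_component_set (U - c) x \<in> components (U - c)"
    by (rule componentsI)
  with assms show ?thesis
    using component_diff_connected[of c U] by blast
next
  case False
  then have "connected_component_set (U - c) x = {}"
    using connected_component_eq_empty by blast
  with assms show ?thesis by (metis Diff_empty)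
qed

lemma connected_Un_component:
  fixes U c :: "'a::metric_space set"
  assumes "connected U" "connected c" "c \<subseteq> U" "locally connected (U - c)"
  shows "connected (c \<union> connected_component_set (U - c) x)"
  by (rule connected_Un_clopen_in_complement[OF assms(2,1,3)])
    (auto intro: openin_connected_component_locally_connected assms closedin_connected_component)

lemma connected_Un_common_point:
  assumes "connected S" "connected T" "x \<in> S" "x \<in> T"
  shows "connected (S \<union> T)"
  using assms by (intro connected_Un) auto

lemma connected_component_overlap:
  assumes "connected S" "S \<subseteq> T" "x \<in> S" "x \<in> connected_component_set T a"
  shows "S \<subseteq> connected_component_set T a"
proof -
  have "S \<subseteq> connected_component_set T x"
    using assms by (intro connected_component_maximal)
  then show ?thesis
    using assms(4) connected_component_eq[of x T a] by simp
qed

lemma locally_path_connected_openin_disk: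
  assumes "openin (top_of_set disk) S"
  shows "locally path_connected S"
  by (rule locally_open_subset[OF convex_imp_locally_path_connected[OF convex_cball] assms])

lemma locally_connected_openin_disk:
  assumes "openin (top_of_set disk) S"
  shows "locally connected S"
  using locally_path_connected_imp_locally_connected[OF locally_path_connected_openin_disk[OF assms]] .

lemma openin_disk_Diff:
  assumes "closed S"
  shows "openin (top_of_set disk) (disk - S)"
  using openin_open_Int[of "- S" disk] assms by (simp add: Diff_eq open_Compl)

lemma openin_disk_component:
  assumes "openin (top_of_set disk) S"
  shows "openin (top_of_set disk) (connected_component_set S x)"
  using openin_connected_component_locally_connected[OF locally_connected_openin_disk[OF assms]]
    assms openin_trans by blast

text \<open>
  Multiplying a path by \<open>1 - \<eta> t (1 - t)\<close> pushes it off the circle except at its ends, and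
  moves it by less than \<open>\<eta>\<close>.
\<close>

lemma path_through_interior:
  assumes op: "openin (top_of_set disk) S" and "connected S" "x \<in> S" "y \<in> S"
  obtains g where "path g" "path_image g \<subseteq> S" "pathstart g = x" "pathfinish g = y"
    "\<And>t. t \<in> {0<..<1} \<Longrightarrow> g t \<in> ball 0 1"
proof -
  have "path_connected S"
    unfolding path_connected_component connected_iff_connected_component[symmetric]
    using path_component_eq_connected_component[OF locally_path_connected_openin_disk[OF op]] assms(2)
    by (simp add: connected_iff_connected_component)
  then obtain h where h: "path h" "path_image h \<subseteq> S" "pathstart h = x" "pathfinish h = y"
    using assms unfolding path_connected_def by blast
  obtain T where T: "open T" "S = T \<inter> disk"
    using op openin_open by (metis inf_commute)
  obtain e where e: "e > 0" "(\<Union>x\<in>path_image h. ball x e) \<subseteq> T"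
    using compact_subset_open_imp_ball_epsilon_subset[OF compact_path_image[OF h(1)] T(1)] h(2) T(2)
    by blast
  define \<eta> where "\<eta> = min (e/2) 1"
  have \<eta>: "0 < \<eta>" "\<eta> < e" "\<eta> \<le> 1"
    using e by (auto simp: \<eta>_def)
  define k where "k t = 1 - \<eta> * (t * (1 - t))" for t :: real
  define g where "g t = of_real (k t) * h t" for t
  have hd: "norm (h t) \<le> 1" if "t \<in> {0..1}" for t
  proof -
    have "h t \<in> path_image h" using that by (simp add: path_image_def)
    then have "h t \<in> disk" using h(2) T(2) by blast
    then show ?thesis by simp
  qed
  have k: "0 \<le> k t" "k t \<le> 1" "1 - k t < e" if "t \<in> {0..1}" for t
  proof -
    have t: "0 \<le> t * (1 - t)" "t * (1 - t) \<le> 1"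
      using that by (auto intro: mult_le_one)
    then have "0 \<le> \<eta> * (t * (1 - t))" "\<eta> * (t * (1 - t)) \<le> \<eta>"
      using \<eta> by (auto intro: mult_left_le mult_nonneg_nonneg)
    then show "0 \<le> k t" "k t \<le> 1" "1 - k t < e"
      using \<eta> unfolding k_def by linarith+
  qed
  have kl: "k t < 1" if "t \<in> {0<..<1}" for t
    using that \<eta> by (simp add: k_def)
  show ?thesis
  proof
    show "path g"
      using h(1) unfolding path_def g_def k_def by (intro continuous_intros) auto
    show "pathstart g = x" "pathfinish g = y"
      using h by (simp_all add: pathstart_def pathfinish_def g_def k_def)
    have ng: "norm (g t) = k t * norm (h t)" if "t \<in> {0..1}" for t
      using k[OF that] by (simp add: g_def norm_mult)
    show "g t \<in> ball 0 1" if "t \<in> {0<..<1}" for t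
    proof -
      have t: "t \<in> {0..1}" using that by auto
      have "norm (g t) \<le> k t * 1"
        unfolding ng[OF t] using k(1)[OF t] hd[OF t] by (intro mult_left_mono) auto
      then show ?thesis using kl[OF that] by simp
    qed
    show "path_image g \<subseteq> S"
    proof
      fix z assume "z \<in> path_image g"
      then obtain t where t: "t \<in> {0..1}" "z = g t"
        by (auto simp: path_image_def)
      have "norm (g t) \<le> 1"
        unfolding ng[OF t(1)] using k(1,2)[OF t(1)] hd[OF t(1)] by (intro mult_le_one) auto
      moreover have "dist (h t) (g t) < e"
      proof -
        have "h t - g t = of_real (1 - k t) * h t"
          by (simp add: g_def algebra_simps)
        then have "dist (h t) (g t) = (1 - k t) * norm (h t)"
          using k(2)[OF t(1)] by (simp add: dist_norm norm_mult del: of_real_diff)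
        also have "\<dots> \<le> (1 - k t) * 1"
          using k(2)[OF t(1)] hd[OF t(1)] by (intro mult_left_mono) auto
        finally show ?thesis using k(3)[OF t(1)] by simp
      qed
      then have "g t \<in> T"
        using e(2) t(1) by (force simp: path_image_def)
      ultimately show "z \<in> S"
        using t T(2) by simp
    qed
  qed
qed

lemma connected_exterior: "connected (- disk)"
  by (rule connected_complement_bounded_convex) auto

lemma connected_avoiding_sphere:
  assumes "connected T" "T \<inter> disk_boundary = {}" "u \<in> T" "u \<in> ball 0 1"
  shows "T \<subseteq> ball 0 (1::real)"
proof (rule ccontr)
  assume "\<not> T \<subseteq> ball 0 1"
  then have "T \<inter> - disk \<noteq> {}"
    using assms(2) by force
  moreover have "T \<inter> ball 0 1 \<noteq> {}" using assms by blast
  moreover have "T \<subseteq> ball 0 1 \<union> - disk"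
    using assms(2) by force
  moreover have "open (ball 0 1 :: complex set)" "open (- disk)"
    by auto
  moreover have "ball 0 1 \<inter> - disk \<inter> T = {}"
    by auto
  ultimately show False
    using assms(1) unfolding connected_def by blast
qed

text \<open>
  A connected set joining the two common ends of the complementary arcs \<open>J1\<close> and \<open>J2\<close> of the
  circle meets every path through the disk from one arc to the other. Otherwise neither
  \<open>E \<union> J1\<close> nor \<open>E \<union> J2\<close> separates an interior point of the path from infinity, hence by Janiszewski's
  theorem neither does their union, which contains the circle.
\<close>

lemma crossing_in_disk:
  assumes E: "compact E" "connected E" "E \<subseteq> disk"
    and J: "compact J1" "connected J1" "compact J2" "connected J2"
    and un: "J1 \<union> J2 = disk_boundary" and int: "J1 \<inter> J2 \<subseteq> E" "J1 \<inter> J2 \<noteq> {}"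
    and g: "path g" "\<And>t. t \<in> {0<..<1} \<Longrightarrow> g t \<in> ball 0 1"
    and ends: "pathstart g \<in> J1 - J2" "pathfinish g \<in> J2 - J1"
  shows "path_image g \<inter> E \<noteq> {}"
proof
  assume dis: "path_image g \<inter> E = {}"
  (* The sets are compared on m and on the point 2 of the exterior of the disk. *)
  define m where "m = g (1/2)"
  have m: "m \<in> ball 0 1"
    unfolding m_def by (rule g(2)) auto
  have reach: "connected_component (- (E \<union> J)) m 2"
    if "J \<subseteq> disk_boundary" and P: "P \<subseteq> path_image g" "connected P" "m \<in> P" "q \<in> P"
      and q: "q \<in> disk_boundary - J" and PJ: "P \<inter> J = {}" for J P q
  proof -
    let ?T = "P \<union> (insert q (- disk))"
    have "connected (insert q (- disk))"
    proof (rule connected_intermediate_closure[OF connected_exterior])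
      have "closure (- disk) = - ball 0 1"
        by (simp add: closure_complement)
      then show "insert q (- disk) \<subseteq> closure (- disk)"
        using q by auto
    qed auto
    then have "connected ?T"
      using P by (intro connected_Un) auto
    moreover have "?T \<subseteq> - (E \<union> J)"
      using P dis q PJ E(3) that(1) by force
    moreover have "m \<in> ?T" "2 \<in> ?T"
      using P by auto
    ultimately show ?thesis
      unfolding connected_component_def by blast
  qed
  have part: "g ` {s..t} \<subseteq> path_image g" "connected (g ` {s..t})" if "0 \<le> s" "t \<le> 1" for s t
  proof -
    show "g ` {s..t} \<subseteq> path_image g"
      using that by (auto simp: path_image_def)
    show "connected (g ` {s..t})"
      using g(1) that unfolding path_def
      by (auto intro: connected_continuous_image[OF continuous_on_subset[of "{0..1}" g]])
  qed
  have J': "J1 \<subseteq> disk_boundary" "J2 \<subseteq> disk_boundary"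
    using un by auto
  have c1: "connected_component (- (E \<union> J1)) m 2"
  proof (rule reach[of J1 "g ` {1/2..1}" "g 1"])
    have "g t \<notin> J1" if "t \<in> {1/2..1}" for t
    proof (cases "t = 1")
      case True then show ?thesis using ends by (auto simp: pathfinish_def)
    next
      case False
      then have "t \<in> {0<..<1}" using that by auto
      from g(2)[OF this] J'(1) show ?thesis by auto
    qed
    then show "g ` {1/2..1} \<inter> J1 = {}" by blast
    show "g 1 \<in> disk_boundary - J1"
      using ends J' by (auto simp: pathfinish_def)
  qed (use J' part[of "1/2" 1] in \<open>auto simp: m_def\<close>)
  have c2: "connected_component (- (E \<union> J2)) m 2"
  proof (rule reach[of J2 "g ` {0..1/2}" "g 0"])
    have "g t \<notin> J2" if "t \<in> {0..1/2}" for t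
    proof (cases "t = 0")
      case True then show ?thesis using ends by (auto simp: pathstart_def)
    next
      case False
      then have "t \<in> {0<..<1}" using that by auto
      from g(2)[OF this] J'(2) show ?thesis by auto
    qed
    then show "g ` {0..1/2} \<inter> J2 = {}" by blast
    show "g 0 \<in> disk_boundary - J2"
      using ends J' by (auto simp: pathstart_def)
  qed (use J' part[of 0 "1/2"] in \<open>auto simp: m_def\<close>)
  have "(E \<union> J1) \<inter> (E \<union> J2) = E"
    using int by auto
  moreover have "compact (E \<union> J1)" "closed (E \<union> J2)"
    using E(1) J by (simp_all add: compact_Un closed_Un compact_imp_closed)
  ultimately have "connected_component (- ((E \<union> J1) \<union> (E \<union> J2))) m 2"
    using Janiszewski[of "E \<union> J1" "E \<union> J2" m 2] c1 c2 E(2) by simp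
  then obtain T where T: "connected T" "T \<subseteq> - ((E \<union> J1) \<union> (E \<union> J2))" "m \<in> T" "2 \<in> T"
    unfolding connected_component_def by blast
  have "T \<subseteq> ball 0 1"
    by (rule connected_avoiding_sphere[OF T(1) _ T(3) m]) (use T(2) un in auto)
  with T(4) show False by auto
qed

text \<open>
  The set \<open>c\<close> shows that \<open>u\<close> and \<open>v\<close> are not separated by \<open>\<Gamma>\<close>, the circle and the crosscut obtained from \<open>g\<close>
  by replacing its initial part \<open>g ` {0..t}\<close> by \<open>M\<close>. The initial part and \<open>M\<close> together do not separate
  them either. The intersection of the two obstacles is the connected set \<open>M\<close>, so by Janiszewski's theorem
  their union, which contains the original crosscut, does not separate \<open>u\<close> from \<open>v\<close>.
\<close>

lemma reroute_initial_part:
  assumes \<Gamma>: "compact \<Gamma>" "\<Gamma> \<subseteq> disk" and g: "arc g" "pathstart g \<in> disk_boundary"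
    and gi: "\<And>t. t \<in> {0<..<1} \<Longrightarrow> g t \<in> ball 0 1" and g\<Gamma>: "\<And>t. t \<in> {0..<1} \<Longrightarrow> g t \<notin> \<Gamma>"
    and t: "t \<in> {0<..<1}"
    and M: "compact M" "connected M" "pathstart g \<in> M" "g t \<in> M"
    and c: "connected c" "c \<subseteq> ball 0 1 - \<Gamma>" "c \<inter> g ` {t..1} = {}" "c \<inter> M = {}" "u \<in> c" "v \<in> c"
    and uv: "connected_component (- (g ` {0..t} \<union> M)) u v"
  shows "connected_component (ball 0 1 - \<Gamma> - path_image g) u v"
proof -
  have cg: "continuous_on {0..1} g"
    using g(1) by (simp add: arc_def path_def)
  have inj: "inj_on g {0..1}"
    using g(1) by (simp add: arc_def)
  have t': "0 < t" "t < 1" using t by auto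
  have cp: "compact (g ` {0..t})" "compact (g ` {t..1})"
    using cg t' by (auto intro!: compact_continuous_image intro: continuous_on_subset)
  let ?S = "\<Gamma> \<union> disk_boundary \<union> g ` {t..1} \<union> M" and ?T = "g ` {0..t} \<union> M"
  have "?S \<inter> ?T \<subseteq> M"
  proof (rule subsetI, rule ccontr)
    fix z assume "z \<in> ?S \<inter> ?T" and zM: "z \<notin> M"
    then have z: "z \<in> ?S" "z \<in> ?T" "z \<notin> M" by blast+
    then obtain s where s: "s \<in> {0..t}" "z = g s" by auto
    have "s \<noteq> 0" "s \<noteq> t"
      using z(3) s(2) M by (auto simp: pathstart_def)
    then have s': "s \<in> {0<..<1}" "s \<in> {0..<1}" "s < t"
      using s t' by auto
    have "z \<notin> \<Gamma>" using g\<Gamma>[OF s'(2)] s by simp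
    moreover have "z \<notin> disk_boundary" using gi[OF s'(1)] s by auto
    moreover have "z \<notin> g ` {t..1}"
    proof
      assume "z \<in> g ` {t..1}"
      then obtain r where "r \<in> {t..1}" "g s = g r" using s by auto
      then have "s = r"
        using inj_onD[OF inj, of s r] s' t' by auto
      then show False using s' \<open>r \<in> {t..1}\<close> by auto
    qed
    ultimately show False using z by auto
  qed
  then have eq: "?S \<inter> ?T = M" by blast
  have "connected_component (- ?S) u v"
    unfolding connected_component_def using c by (intro exI[of _ c]) auto
  moreover have "compact ?S" "closed ?T"
    using \<Gamma>(1) cp M(1) by (simp_all add: compact_Un closed_Un compact_imp_closed)
  ultimately have "connected_component (- (?S \<union> ?T)) u v"
    using Janiszewski[of ?S ?T u v] uv M(2) eq by simp
  then obtain T where T: "connected T" "T \<subseteq> - (?S \<union> ?T)" "u \<in> T" "v \<in> T"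
    unfolding connected_component_def by blast
  have "T \<subseteq> ball 0 1"
    by (rule connected_avoiding_sphere[OF T(1) _ T(3)]) (use T c in auto)
  moreover have "path_image g = g ` {0..t} \<union> g ` {t..1}"
    using t' ivl_disj_un_two_touch(4)[of 0 t 1] by (simp add: path_image_def image_Un[symmetric])
  ultimately show ?thesis
    unfolding connected_component_def using T by (intro exI[of _ T]) auto
qed

lemma segment_to_closest_point:
  fixes z :: complex
  assumes "closed \<Gamma>" "\<Gamma> \<noteq> {}" "\<Gamma> \<subseteq> disk" "z \<in> ball 0 1 - \<Gamma>" "t \<in> {0..<1}"
  shows "linepath z (closest_point \<Gamma> z) t \<in> ball 0 1 - \<Gamma>"
    and "infdist (linepath z (closest_point \<Gamma> z) t) \<Gamma> \<le> infdist z \<Gamma>"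
proof -
  let ?p = "closest_point \<Gamma> z" and ?w = "linepath z (closest_point \<Gamma> z) t"
  have p: "?p \<in> \<Gamma>" using closest_point_in_set assms by blast
  have w1: "z - ?w = t *\<^sub>R (z - ?p)" and w2: "?p - ?w = (1 - t) *\<^sub>R (?p - z)"
    by (simp_all add: linepath_def algebra_simps scaleR_conv_of_real)
  have zp: "0 < dist z ?p" using p assms by auto
  have "?w \<notin> \<Gamma>"
  proof
    assume "?w \<in> \<Gamma>"
    then have "dist z ?p \<le> dist z ?w"
      using closest_point_le assms by blast
    also have "\<dots> = t * dist z ?p"
      using assms(5) by (simp add: dist_norm w1)
    finally show False using zp assms(5) by auto
  qed
  moreover have "norm ?w < 1"
  proof -
    have "norm ?w \<le> (1 - t) * norm z + t * norm ?p"
      unfolding linepath_def using assms(5) norm_triangle_ineq[of "(1-t) *\<^sub>R z" "t *\<^sub>R ?p"] by auto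
    also have "\<dots> < (1 - t) * 1 + t * 1"
    proof (rule add_less_le_mono)
      show "(1 - t) * norm z < (1 - t) * 1"
        using assms by (intro mult_strict_left_mono) auto
      show "t * norm ?p \<le> t * 1"
        using assms p by (intro mult_left_mono) auto
    qed
    finally show ?thesis by simp
  qed
  ultimately show "?w \<in> ball 0 1 - \<Gamma>" by simp
  have "infdist ?w \<Gamma> \<le> dist ?w ?p"
    using infdist_le[OF p] .
  also have "\<dots> = (1 - t) * dist z ?p"
    using assms(5) w2 by (simp add: dist_norm norm_minus_commute)
  also have "\<dots> \<le> 1 * dist z ?p"
    using assms(5) by (intro mult_right_mono) auto
  also have "dist z ?p = infdist z \<Gamma>"
    using setdist_closest_point[OF assms(1,2), of z] by (simp add: infdist_eq_setdist)
  finally show "infdist ?w \<Gamma> \<le> infdist z \<Gamma>" by simp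
qed

text \<open>
  The set \<open>\<Gamma>\<close> together with the circle does not separate \<open>u\<close> from \<open>v\<close>, as \<open>ball 0 1 - \<Gamma>\<close> is connected. Neither
  do the points at distance at least \<open>e\<close> from \<open>\<Gamma>\<close> together with \<open>I\<close>, because \<open>u\<close> and \<open>v\<close> are joined through
  \<open>\<Gamma>\<close>. The arc \<open>I\<close> makes the intersection of the two obstacles connected, as Janiszewski's theorem requires.
\<close>

lemma connected_collar:
  assumes \<Gamma>: "compact \<Gamma>" "connected \<Gamma>" "\<Gamma> \<noteq> {}" "\<Gamma> \<subseteq> disk"
    and I: "compact I" "connected I" "I \<subseteq> disk_boundary - \<Gamma>"
      "{z \<in> disk_boundary. e \<le> infdist z \<Gamma>} \<subseteq> I"
    and U: "connected (ball 0 1 - \<Gamma>)"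
    and uv: "u \<in> ball 0 1 - \<Gamma>" "v \<in> ball 0 1 - \<Gamma>" "infdist u \<Gamma> < e" "infdist v \<Gamma> < e"
  shows "connected_component {z \<in> ball 0 1 - \<Gamma>. infdist z \<Gamma> < e} u v"
proof -
  let ?S = "\<Gamma> \<union> disk_boundary" and ?T = "{z \<in> disk. e \<le> infdist z \<Gamma>} \<union> I"
  have clT: "closed {z \<in> disk. e \<le> infdist z \<Gamma>}"
  proof -
    have "closed {z. e \<le> infdist z \<Gamma>}"
      by (intro closed_Collect_le continuous_intros)
    then have "closed (disk \<inter> {z. e \<le> infdist z \<Gamma>})" by (intro closed_Int) auto
    then show ?thesis by (simp add: Int_def)
  qed
  have e: "e > 0" using uv(3) infdist_nonneg[of u \<Gamma>] by linarith
  have "?S \<inter> ?T = I"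
    using I e by auto
  have S: "connected_component (- ?S) u v"
    unfolding connected_component_def using U uv by (intro exI[of _ "ball 0 1 - \<Gamma>"]) auto
  have T: "connected_component (- ?T) w (closest_point \<Gamma> w)"
    if w: "w \<in> ball 0 1 - \<Gamma>" "infdist w \<Gamma> < e" for w
    unfolding connected_component_def
  proof (intro exI conjI)
    let ?p = "closest_point \<Gamma> w"
    show "connected (closed_segment w ?p)" by simp
    have p: "?p \<in> \<Gamma>" using closest_point_in_set \<Gamma> compact_imp_closed by blast
    show "closed_segment w ?p \<subseteq> - ?T"
    proof
      fix z assume "z \<in> closed_segment w ?p"
      then obtain t where t: "t \<in> {0..1}" "z = linepath w ?p t"
        by (metis linepath_image_01 imageE)
      show "z \<in> - ?T"
      proof (cases "t = 1")
        case True
        then have "z = ?p" using t by (simp add: linepath_def)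
        then show ?thesis using p I(3) e by auto
      next
        case False
        then have "t \<in> {0..<1}" using t by auto
        note segment_to_closest_point[OF compact_imp_closed[OF \<Gamma>(1)] \<Gamma>(3,4) w(1) this]
        then show ?thesis using w(2) t I(3) by auto
      qed
    qed
  qed auto
  have "\<Gamma> \<subseteq> - ?T"
    using e I(3) by auto
  then have "connected_component (- ?T) (closest_point \<Gamma> u) (closest_point \<Gamma> v)"
    unfolding connected_component_def
    using \<Gamma>(2) closest_point_in_set[OF compact_imp_closed[OF \<Gamma>(1)] \<Gamma>(3)] by blast
  then have "connected_component (- ?T) u v"
    by (rule connected_component_trans[OF connected_component_trans[OF T[OF uv(1,3)]]
          connected_component_sym[OF T[OF uv(2,4)]]])
  moreover have "compact ?S" "closed ?T"
    using \<Gamma>(1) I(1) clT by (simp_all add: compact_Un closed_Un compact_imp_closed)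
  ultimately have "connected_component (- (?S \<union> ?T)) u v"
    using Janiszewski[of ?S ?T u v] S I(2) \<open>?S \<inter> ?T = I\<close> by simp
  then obtain T where T: "connected T" "T \<subseteq> - (?S \<union> ?T)" "u \<in> T" "v \<in> T"
    unfolding connected_component_def by blast
  have "T \<subseteq> ball 0 1"
    by (rule connected_avoiding_sphere[OF T(1) _ T(3)]) (use T uv in auto)
  then have "T \<subseteq> {z \<in> ball 0 1 - \<Gamma>. infdist z \<Gamma> < e}"
    using T(2) by force
  then show ?thesis
    unfolding connected_component_def using T by blast
qed

section \<open>Arcs of the circle\<close>

lemma cis_eq_imp:
  assumes "cis x = cis y" "\<bar>x - y\<bar> < 2 * pi"
  shows "x = y"
proof -
  have "cis (x - y) = 1"
    using assms(1) by (simp flip: cis_divide)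
  then have "cos (x - y) = 1"
    by (metis cis.sel(1) one_complex.sel(1))
  then obtain k :: int where k: "x - y = k * 2 * pi"
    using cos_one_2pi_int by auto
  then have "\<bar>real_of_int k\<bar> * (2 * pi) < 1 * (2 * pi)"
    using assms(2) by (simp add: abs_mult)
  then have "\<bar>real_of_int k\<bar> < 1"
    by (subst (asm) mult_less_cancel_right_pos) auto
  then have "k = 0" by linarith
  then show ?thesis using k by simp
qed

lemma sphere_eq_cis_image: "disk_boundary = (\<lambda>s. cis (e * s)) ` {t..t + 2 * pi}" if "\<bar>e\<bar> = 1"
proof
  show "(\<lambda>s. cis (e * s)) ` {t..t + 2 * pi} \<subseteq> disk_boundary" by auto
  show "disk_boundary \<subseteq> (\<lambda>s. cis (e * s)) ` {t..t + 2 * pi}"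
  proof
    fix z :: complex assume "z \<in> disk_boundary"
    then have z: "z = cis (Arg z)"
      using cis_Arg[of z] by (cases "z = 0") (auto simp: sgn_eq)
    have ee: "e * e = 1" using that by (metis abs_mult_self mult_1)
    define x where "x = e * Arg z"
    define k where "k = \<lfloor>(x - t) / (2 * pi)\<rfloor>"
    define s where "s = x - 2 * pi * k"
    have zx: "z = cis (e * x)"
      using z ee by (simp add: x_def flip: mult.assoc)
    have "k \<le> (x - t) / (2 * pi)" "(x - t) / (2 * pi) < k + 1"
      unfolding k_def by linarith+
    then have "2 * pi * k \<le> x - t" "x - t < 2 * pi * (k + 1)"
      by (simp_all add: field_simps)
    then have "s \<in> {t..t + 2 * pi}"
      by (simp add: s_def algebra_simps)
    moreover have "cis (e * s) = z"
    proof -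
      have "cis (e * s) = cis (e * x) * cis (2 * pi * (- e * k))"
        by (simp add: s_def cis_mult algebra_simps)
      moreover have "- e * k \<in> \<int>"
        using that by (cases "e = 1") (auto simp: abs_if split: if_splits)
      then have "cis (2 * pi * (- e * k)) = 1"
        by (rule cis_multiple_2pi)
      ultimately show ?thesis
        using zx by (metis mult.right_neutral)
    qed
    ultimately show "z \<in> (\<lambda>s. cis (e * s)) ` {t..t + 2 * pi}" by blast
  qed
qed

lemma cis_mult_eq_imp:
  assumes "\<bar>e\<bar> = 1" "cis (e * x) = cis (e * y)" "\<bar>x - y\<bar> < 2 * pi"
  shows "x = y"
proof -
  have "\<bar>e * x - e * y\<bar> = \<bar>e * (x - y)\<bar>" by (simp add: algebra_simps)
  then have "\<bar>e * x - e * y\<bar> < 2 * pi" using assms by (simp add: abs_mult)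
  then have "e * x = e * y" using cis_eq_imp assms(2) by blast
  then show ?thesis using assms(1) by auto
qed

lemma cis_mult_periodic: "cis (e * (t + 2 * pi)) = cis (e * t)" if "\<bar>e\<bar> = 1"
proof -
  have "e = 1 \<or> e = -1" using that by linarith
  then have "e \<in> \<int>" by auto
  then have "cis (2 * pi * e) = 1" by (rule cis_multiple_2pi)
  moreover have "cis (e * (t + 2 * pi)) = cis (e * t) * cis (2 * pi * e)"
    by (simp add: cis_mult algebra_simps)
  ultimately show ?thesis by (metis mult.right_neutral)
qed

lemma cis_close:
  assumes "d > 0"
  obtains \<eta> where "\<eta> > 0" "\<And>s. \<bar>s - t\<bar> < \<eta> \<Longrightarrow> dist (cis s) (cis t) < d"
proof -
  have "continuous_on UNIV cis" by (intro continuous_intros)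
  then obtain \<eta> where "\<eta> > 0" "\<forall>s\<in>UNIV. dist s t < \<eta> \<longrightarrow> dist (cis s) (cis t) < d"
    using assms unfolding continuous_on_iff by blast
  then show ?thesis using that by (auto simp: dist_real_def)
qed

text \<open>
  The sign \<open>e\<close> selects the orientation of the circle. Facts about the arc on one side of a point then also
  give the mirror-image facts about the other side.
\<close>

lemma connected_subset_arc:
  assumes S: "connected S" "S \<subseteq> disk_boundary" and e: "\<bar>e\<bar> = 1"
    and t: "t < u" "u < t'" "t' < t + 2 * pi"
    and mem: "cis (e * u) \<in> S" "cis (e * t) \<notin> S" "cis (e * t') \<notin> S"
  shows "S \<subseteq> (\<lambda>s. cis (e * s)) ` {t<..<t'}"
proof -
  let ?p = "\<lambda>s. cis (e * s)"
  have cl: "closed (?p ` {x..y})" for x y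
    by (intro compact_imp_closed compact_continuous_image continuous_intros) auto
  have "{t..t'} \<union> {t'..t + 2 * pi} = {t..t + 2 * pi}"
    using t by auto
  then have cover: "S \<subseteq> ?p ` {t..t'} \<union> ?p ` {t'..t + 2 * pi}"
    using S(2) sphere_eq_cis_image[OF e, of t] by (simp flip: image_Un)
  have disj: "?p ` {t..t'} \<inter> ?p ` {t'..t + 2 * pi} \<inter> S = {}"
  proof (rule ccontr)
    assume "?p ` {t..t'} \<inter> ?p ` {t'..t + 2 * pi} \<inter> S \<noteq> {}"
    then obtain x y where xy: "x \<in> {t..t'}" "y \<in> {t'..t + 2 * pi}" "?p x = ?p y" "?p x \<in> S"
      by blast
    show False
    proof (cases "y - x < 2 * pi")
      case True
      then have "x = y" using cis_mult_eq_imp[OF e xy(3)] xy by auto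
      then have "x = t'" using xy by auto
      then show False using xy mem by simp
    next
      case False
      then have "x = t" using xy by auto
      then show False using xy(4) mem(2) by simp
    qed
  qed
  have "?p ` {t..t'} \<inter> S \<noteq> {}"
  proof -
    have "u \<in> {t..t'}" using t by auto
    then show ?thesis using mem(1) by blast
  qed
  then have "?p ` {t'..t + 2 * pi} \<inter> S = {}"
    using S(1) cl cover disj unfolding connected_closed by blast
  then have "S \<subseteq> ?p ` {t..t'}"
    using cover by blast
  moreover have "{t..t'} \<subseteq> insert t (insert t' {t<..<t'})" by auto
  ultimately show ?thesis using mem(2,3) by blast
qed

section \<open>Basins of attraction\<close>

definition basin :: "(complex \<Rightarrow> complex) \<Rightarrow> complex \<Rightarrow> complex set" where
  "basin f a = {x \<in> disk. (\<lambda>n. (f ^^ n) x) \<longlonglongrightarrow> a}"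

text \<open>
  The caps of the disk cut off by chords perpendicular to the radius of the boundary point \<open>a\<close>. Unlike
  intersections with balls around \<open>a\<close>, they have convex complements in the disk.
\<close>

definition cap :: "complex \<Rightarrow> real \<Rightarrow> complex set" where
  "cap a c = {z \<in> disk. c < Re (z * cnj a)}"

definition closed_cap :: "complex \<Rightarrow> real \<Rightarrow> complex set" where
  "closed_cap a c = {z \<in> disk. c \<le> Re (z * cnj a)}"

lemma openin_cap: "openin (top_of_set disk) (cap a c)"
proof -
  have "open {z. c < Re (z * cnj a)}" by (intro open_Collect_less continuous_intros)
  then have "openin (top_of_set disk) (disk \<inter> {z. c < Re (z * cnj a)})" by (rule openin_open_Int)
  then show ?thesis by (simp add: cap_def Int_def)
qed

lemma cap_nhd:
  assumes N: "openin (top_of_set disk) N" "a \<in> N" "a \<in> disk_boundary"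
  obtains c where "0 < c" "c < 1" "closed_cap a c \<subseteq> N"
proof -
  obtain T where T: "open T" "N = T \<inter> disk"
    using N openin_open by (metis inf_commute)
  then obtain e where e: "e > 0" "ball a e \<subseteq> T"
    using N(2) open_contains_ball by blast
  define c where "c = max (1/2) (1 - e^2 / 4)"
  have c: "0 < c" "c < 1" "2 - 2 * c < e^2"
  proof -
    have "e^2 > 0" using e by simp
    then show "0 < c" "c < 1" "2 - 2 * c < e^2" by (auto simp: c_def max_def)
  qed
  have na: "norm a = 1" using N(3) by simp
  have "closed_cap a c \<subseteq> N"
  proof
    fix z assume "z \<in> closed_cap a c"
    then have z: "norm z \<le> 1" "c \<le> Re (z * cnj a)" by (auto simp: closed_cap_def)
    have "(norm (a - z))^2 = (norm a)^2 + (norm z)^2 - 2 * Re (z * cnj a)"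
      unfolding cmod_power2 by (simp add: power2_eq_square algebra_simps)
    also have "\<dots> \<le> 1 + 1 - 2 * c"
      using z na power_le_one[of "norm z" 2] by auto
    also have "\<dots> < e^2" using c(3) by simp
    finally have "norm (a - z) < e"
      using e(1) power2_less_imp_less by (metis less_imp_le)
    then have "z \<in> ball a e" by (simp add: dist_norm)
    then show "z \<in> N" using e T z by auto
  qed
  then show ?thesis using that c by blast
qed

lemma Re_mult_cnj_sgn: "Re (sgn z * cnj a) = Re (z * cnj a) / norm z"
  by (simp add: sgn_eq)

text \<open>
  The part of the circle in a cap is the image of the convex cap under radial projection, which
  does not decrease \<open>Re (z * cnj a)\<close> where it is positive.
\<close>

lemma connected_cap:
  assumes "a \<in> disk_boundary" "0 < c"
  shows "connected (cap a c)" "connected (cap a c \<inter> ball 0 1)" "connected (cap a c \<inter> disk_boundary)"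
    "connected (closed_cap a c \<inter> disk_boundary)" "connected (disk - cap a c)"
proof -
  have cap: "cap a c = disk \<inter> {z. c < a \<bullet> z}" "closed_cap a c = disk \<inter> {z. c \<le> a \<bullet> z}"
    "disk - cap a c = disk \<inter> {z. a \<bullet> z \<le> c}"
    by (auto simp: cap_def closed_cap_def inner_complex_def mult.commute)
  have convex: "convex (cap a c)" "convex (closed_cap a c)" "convex (disk - cap a c)"
    using convex_halfspace_gt[of c a] convex_halfspace_ge[of c a] convex_halfspace_le[of a c]
    unfolding cap(3) unfolding cap(1,2) by (auto intro: convex_Int simp: inner_commute)
  show "connected (disk - cap a c)"
    using convex(3) by (rule convex_connected)
  show "connected (cap a c)" "connected (cap a c \<inter> ball 0 1)"
    using convex(1)
    by (auto intro: convex_connected convex_Int)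
  have sg: "connected (S \<inter> disk_boundary)"
    if "convex S" "S \<subseteq> closed_cap a c" and up: "\<And>z. z \<in> S \<Longrightarrow> sgn z \<in> S" for S
  proof -
    have nz: "z \<noteq> 0" if "z \<in> S" for z
      using that \<open>S \<subseteq> closed_cap a c\<close> assms(2) by (auto simp: closed_cap_def)
    have "S \<inter> disk_boundary = sgn ` S"
    proof
      show "S \<inter> disk_boundary \<subseteq> sgn ` S"
      proof
        fix z assume z: "z \<in> S \<inter> disk_boundary"
        then have "z = sgn z" by (simp add: sgn_div_norm)
        then show "z \<in> sgn ` S" using z by blast
      qed
      show "sgn ` S \<subseteq> S \<inter> disk_boundary"
        using up nz by (auto simp: norm_sgn)
    qed
    moreover have "connected (sgn ` S)"
      using \<open>convex S\<close> nz by (intro connected_continuous_image convex_connected continuous_intros) auto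
    ultimately show ?thesis by simp
  qed
  have le: "x \<le> x / r" if "0 < x" "0 < r" "r \<le> 1" for x r :: real
    using that by (simp add: field_simps mult_left_le_one_le)
  have pos: "z \<noteq> 0" "Re (z * cnj a) \<le> Re (sgn z * cnj a)" if "z \<in> closed_cap a c" for z
  proof -
    have z: "norm z \<le> 1" "c \<le> Re (z * cnj a)" using that by (auto simp: closed_cap_def)
    show "z \<noteq> 0" using z assms(2) by auto
    then show "Re (z * cnj a) \<le> Re (sgn z * cnj a)"
      unfolding Re_mult_cnj_sgn using z assms(2) by (intro le) auto
  qed
  have sub: "cap a c \<subseteq> closed_cap a c" by (auto simp: cap_def closed_cap_def)
  show "connected (cap a c \<inter> disk_boundary)"
  proof (rule sg[OF convex(1) sub])
    fix z assume z: "z \<in> cap a c"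
    then show "sgn z \<in> cap a c"
      using pos[of z] sub by (auto simp: cap_def norm_sgn)
  qed
  show "connected (closed_cap a c \<inter> disk_boundary)"
  proof (rule sg[OF convex(2) order_refl])
    fix z assume z: "z \<in> closed_cap a c"
    then show "sgn z \<in> closed_cap a c"
      using pos[of z] by (auto simp: closed_cap_def norm_sgn)
  qed
qed

locale disk_homeo =
  fixes f f' :: "complex \<Rightarrow> complex"
  assumes hom: "homeomorphism disk disk f f'"
begin

lemma in_disk: "x \<in> disk \<Longrightarrow> f x \<in> disk" "x \<in> disk \<Longrightarrow> f' x \<in> disk"
  and inv: "x \<in> disk \<Longrightarrow> f' (f x) = x" "x \<in> disk \<Longrightarrow> f (f' x) = x"
  and cont: "continuous_on disk f" "continuous_on disk f'"
  using hom unfolding homeomorphism_def by blast+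

lemma inj: "inj_on f disk"
  by (rule inj_on_inverseI[where g = f']) (rule inv)

lemma in_sphere_iff: "x \<in> disk \<Longrightarrow> f x \<in> disk_boundary \<longleftrightarrow> x \<in> disk_boundary"
  using homeomorphism_disk_boundary[OF hom] homeomorphism_disk_boundary[OF homeomorphism_symD[OF hom]]
    inv(1) by (metis imageI)

lemma in_ball_iff: "x \<in> disk \<Longrightarrow> f x \<in> ball 0 1 \<longleftrightarrow> x \<in> ball 0 1"
  using in_sphere_iff[of x] in_disk(1)[of x] by auto

lemma inverse: "disk_homeo f' f"
  using hom by unfold_locales (rule homeomorphism_symD)

lemma image_openin: "openin (top_of_set disk) S \<Longrightarrow> openin (top_of_set disk) (f ` S)"
  using homeomorphism_imp_open_map[OF hom] .

lemma compact_image: "compact S \<Longrightarrow> S \<subseteq> disk \<Longrightarrow> compact (f ` S)"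
  using cont(1) by (blast intro: compact_continuous_image continuous_on_subset)

lemma connected_image: "connected S \<Longrightarrow> S \<subseteq> disk \<Longrightarrow> connected (f ` S)"
  using cont(1) by (blast intro: connected_continuous_image continuous_on_subset)

end

lemma disk_homeo_compose:
  assumes "disk_homeo f f'" "disk_homeo g g'"
  shows "disk_homeo (f \<circ> g) (g' \<circ> f')"
  using assms homeomorphism_compose unfolding disk_homeo_def by blast

lemma disk_homeo_funpow:
  assumes "disk_homeo f f'"
  shows "disk_homeo (f ^^ n) (f' ^^ n)"
proof (induction n)
  case 0
  then show ?case
    using homeomorphism_ident by (simp add: disk_homeo_def id_def)
next
  case (Suc n)
  have "disk_homeo (f ^^ Suc n) (f' ^^ n \<circ> f')"
    using disk_homeo_compose[OF assms Suc] by simp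
  then show ?case by (simp only: funpow_Suc_right)
qed

locale attractor = disk_homeo +
  fixes a
  assumes attracting: "attracting_fixed_point disk f a"
begin

lemma pow: "disk_homeo (f ^^ n) (f' ^^ n)"
  using disk_homeo_funpow inverse disk_homeo.inverse by blast

lemma fixed: "a \<in> disk" "f a = a"
  using attracting by (auto simp: attracting_fixed_point_def Fix_def)

lemma pow_fixed: "(f ^^ n) a = a"
  by (induction n) (use fixed in auto)

lemma trapping_nhd:
  obtains W T where "compact W" "W \<subseteq> disk" "openin (top_of_set disk) T" "a \<in> T" "T \<subseteq> W"
    "\<And>N. openin (top_of_set disk) N \<Longrightarrow> a \<in> N \<Longrightarrow> \<forall>\<^sub>F n in sequentially. (f ^^ n) ` W \<subseteq> N"
proof -
  obtain W where W: "W \<subseteq> disk" "compact W" "a \<in> (top_of_set disk) interior_of W"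
    "\<forall>N. openin (top_of_set disk) N \<and> a \<in> N \<longrightarrow> (\<forall>\<^sub>F n in sequentially. (f ^^ n) ` W \<subseteq> N)"
    using attracting unfolding attracting_fixed_point_def by blast
  show ?thesis
    using that[OF W(2,1) openin_interior_of W(3) interior_of_subset] W(4) by blast
qed

lemma pow_add_apply: "(f ^^ (m + n)) x = (f ^^ m) ((f ^^ n) x)"
  by (simp add: funpow_add)

lemma basin_eq_Union:
  assumes T: "openin (top_of_set disk) T" "a \<in> T" "T \<subseteq> W"
    and W: "W \<subseteq> disk"
      "\<And>N. openin (top_of_set disk) N \<Longrightarrow> a \<in> N \<Longrightarrow> \<forall>\<^sub>F n in sequentially. (f ^^ n) ` W \<subseteq> N"
  shows "basin f a = {x \<in> disk. \<exists>n. (f ^^ n) x \<in> T}" "basin f a = {x \<in> disk. \<exists>n. (f ^^ n) x \<in> W}"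
proof -
  have 1: "\<exists>n. (f ^^ n) x \<in> T" if "x \<in> basin f a" for x
  proof -
    obtain G where G: "open G" "T = disk \<inter> G" using T(1) openin_open by blast
    have "\<forall>\<^sub>F n in sequentially. (f ^^ n) x \<in> G"
      using that G T(2) unfolding basin_def by (auto intro: topological_tendstoD)
    then obtain n where "(f ^^ n) x \<in> G" using eventually_sequentially by auto
    then show ?thesis
      using G disk_homeo.in_disk(1)[OF pow] that by (auto simp: basin_def)
  qed
  have 2: "x \<in> basin f a" if x: "x \<in> disk" "(f ^^ n) x \<in> W" for x n
  proof -
    have "(\<lambda>k. (f ^^ (k + n)) x) \<longlonglongrightarrow> a"
    proof (rule topological_tendstoI)
      fix S assume "open S" "a \<in> S"
      then have "openin (top_of_set disk) (disk \<inter> S)" "a \<in> disk \<inter> S"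
        using fixed by (auto simp: openin_open_Int)
      from W(2)[OF this] show "\<forall>\<^sub>F k in sequentially. (f ^^ (k + n)) x \<in> S"
        by eventually_elim (use x(2) in \<open>auto simp: pow_add_apply\<close>)
    qed
    then have "(\<lambda>k. (f ^^ k) x) \<longlonglongrightarrow> a"
      by (rule LIMSEQ_offset)
    with x show ?thesis by (simp add: basin_def)
  qed
  have "basin f a \<subseteq> disk" by (auto simp: basin_def)
  then show "basin f a = {x \<in> disk. \<exists>n. (f ^^ n) x \<in> T}" "basin f a = {x \<in> disk. \<exists>n. (f ^^ n) x \<in> W}"
    using 1 2 T(3) by blast+
qed

lemma basin_subset: "basin f a \<subseteq> disk"
  by (auto simp: basin_def)

lemma attractor_in_basin: "a \<in> basin f a"
  using fixed pow_fixed by (simp add: basin_def)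

lemma basin_openin: "openin (top_of_set disk) (basin f a)"
proof -
  obtain W T where WT: "compact W" "W \<subseteq> disk" "openin (top_of_set disk) T" "a \<in> T" "T \<subseteq> W"
    "\<And>N. openin (top_of_set disk) N \<Longrightarrow> a \<in> N \<Longrightarrow> \<forall>\<^sub>F n in sequentially. (f ^^ n) ` W \<subseteq> N"
    using trapping_nhd by blast
  have "basin f a = (\<Union>n. disk \<inter> (f ^^ n) -` T)"
    using basin_eq_Union(1)[OF WT(3-5,2,6)] by (simp add: set_eq_iff)
  moreover have "openin (top_of_set disk) (disk \<inter> (f ^^ n) -` T)" for n
    by (rule continuous_openin_preimage[OF disk_homeo.cont(1)[OF pow] _ WT(3)])
      (use disk_homeo.in_disk(1)[OF pow] in auto)
  ultimately show ?thesis by (metis (no_types, lifting) imageE openin_Union)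
qed

text \<open>
  The convergence in the definition of an attracting fixed point is uniform on one neighborhood,
  hence on every compact subset of the basin.
\<close>

lemma compact_uniformly_attracted:
  assumes Z: "compact Z" "Z \<subseteq> basin f a" and N: "openin (top_of_set disk) N" "a \<in> N"
  shows "\<forall>\<^sub>F n in sequentially. (f ^^ n) ` Z \<subseteq> N"
proof -
  obtain W T where WT: "compact W" "W \<subseteq> disk" "openin (top_of_set disk) T" "a \<in> T" "T \<subseteq> W"
    "\<And>N. openin (top_of_set disk) N \<Longrightarrow> a \<in> N \<Longrightarrow> \<forall>\<^sub>F n in sequentially. (f ^^ n) ` W \<subseteq> N"
    using trapping_nhd by blast
  have "openin (top_of_set disk) (disk \<inter> (f ^^ n) -` T)" for n
    by (rule continuous_openin_preimage[OF disk_homeo.cont(1)[OF pow] _ WT(3)])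
      (use disk_homeo.in_disk(1)[OF pow] in auto)
  then have "\<exists>G. open G \<and> disk \<inter> (f ^^ n) -` T = disk \<inter> G" for n
    using openin_open by blast
  then obtain G where G: "\<And>n. open (G n)" "\<And>n. disk \<inter> (f ^^ n) -` T = disk \<inter> G n"
    by metis
  have "Z \<subseteq> (\<Union>n. G n)"
  proof
    fix z assume "z \<in> Z"
    then have "z \<in> disk" "\<exists>n. (f ^^ n) z \<in> T"
      using Z(2) basin_eq_Union(1)[OF WT(3-5,2,6)] by auto
    then show "z \<in> (\<Union>n. G n)" using G(2) by blast
  qed
  then obtain I where I: "I \<subseteq> UNIV" "finite I" "Z \<subseteq> (\<Union>n\<in>I. G n)"
    by (rule compactE_image[OF Z(1) G(1)])
  obtain b where b: "\<And>i. i \<in> I \<Longrightarrow> i \<le> b"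
    using I(2) finite_nat_set_iff_bounded_le by auto
  obtain k where k: "\<And>n. n \<ge> k \<Longrightarrow> (f ^^ n) ` W \<subseteq> N"
    using WT(6)[OF N] unfolding eventually_sequentially by blast
  have "(f ^^ n) ` Z \<subseteq> N" if n: "n \<ge> b + k" for n
  proof clarify
    fix z assume z: "z \<in> Z"
    then obtain i where i: "i \<in> I" "z \<in> G i" using I(3) by blast
    have "z \<in> disk" using z Z(2) basin_subset by blast
    then have "(f ^^ i) z \<in> W" using i G(2) WT(5) by blast
    moreover have "n = (n - i) + i" "n - i \<ge> k"
      using b[OF i(1)] n by auto
    ultimately show "(f ^^ n) z \<in> N"
      using k[of "n - i"] pow_add_apply[of "n - i" i z] by auto
  qed
  then show ?thesis unfolding eventually_sequentially by blast
qed

text \<open>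
  This is how the hypothesis on the center is used: what commutes with \<open>f\<close> and fixes the attractor
  preserves its basin.
\<close>

lemma commuting_maps_basin:
  assumes h: "continuous_on disk h" "h ` disk \<subseteq> disk" "\<And>x. x \<in> disk \<Longrightarrow> h (f x) = f (h x)" "h a = a"
    and x: "x \<in> basin f a"
  shows "h x \<in> basin f a"
proof -
  have xd: "x \<in> disk" using x basin_subset by blast
  have pd: "(f ^^ n) x \<in> disk" for n using disk_homeo.in_disk(1)[OF pow xd] .
  have eq: "(f ^^ n) (h x) = h ((f ^^ n) x)" for n
    by (induction n) (use h(3) pd in auto)
  have "(\<lambda>n. h ((f ^^ n) x)) \<longlonglongrightarrow> h a"
    using x pd fixed by (intro continuous_on_tendsto_compose[OF h(1)]) (auto simp: basin_def)
  then show ?thesis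
    using h(2,4) image_subset_iff[THEN iffD1, OF h(2)] xd by (simp add: basin_def eq)
qed

lemma basin_invariant: "x \<in> disk \<Longrightarrow> f x \<in> basin f a \<longleftrightarrow> x \<in> basin f a"
proof
  show "f x \<in> basin f a" if "x \<in> basin f a"
    by (rule commuting_maps_basin[OF cont(1)]) (use in_disk fixed that in auto)
  assume x: "x \<in> disk" "f x \<in> basin f a"
  have "f' a = a" using inv(1)[of a] fixed by simp
  then have "f' (f x) \<in> basin f a"
    by (intro commuting_maps_basin[OF cont(2)]) (use in_disk inv x in auto)
  then show "x \<in> basin f a" using inv x by simp
qed

lemma pow_basin_invariant: "x \<in> disk \<Longrightarrow> (f ^^ n) x \<in> basin f a \<longleftrightarrow> x \<in> basin f a"
  by (induction n) (use basin_invariant disk_homeo.in_disk(1)[OF pow] in auto)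

end

locale boundary_attractor = attractor +
  assumes on_boundary: "a \<in> disk_boundary"
begin

text \<open>
  A small cap around the attractor is mapped into itself by all high powers of \<open>f\<close>, so the basin
  is an increasing union of preimages of the cap under multiples of one power.
\<close>

lemma basin_exhaustion:
  obtains c M where "0 < c" "c < 1" "closed_cap a c \<subseteq> basin f a"
    "\<And>k. (f' ^^ (k * M)) ` cap a c \<subseteq> (f' ^^ (Suc k * M)) ` cap a c"
    "\<And>x. x \<in> basin f a \<longleftrightarrow> (\<exists>k. x \<in> (f' ^^ (k * M)) ` cap a c)"
    "\<And>Z. compact Z \<Longrightarrow> Z \<subseteq> basin f a \<Longrightarrow> \<exists>k. Z \<subseteq> (f' ^^ (k * M)) ` cap a c"
proof -
  obtain W T where WT: "compact W" "W \<subseteq> disk" "openin (top_of_set disk) T" "a \<in> T" "T \<subseteq> W"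
    "\<And>N. openin (top_of_set disk) N \<Longrightarrow> a \<in> N \<Longrightarrow> \<forall>\<^sub>F n in sequentially. (f ^^ n) ` W \<subseteq> N"
    using trapping_nhd by blast
  obtain c where c: "0 < c" "c < 1" "closed_cap a c \<subseteq> T"
    using cap_nhd[OF WT(3,4) on_boundary] by blast
  have sub: "cap a c \<subseteq> closed_cap a c" "cap a c \<subseteq> disk" by (auto simp: cap_def closed_cap_def)
  have na: "Re (a * cnj a) = 1"
    using on_boundary cmod_power2[of a] by (simp add: power2_eq_square)
  have aO: "a \<in> cap a c" using c na fixed by (simp add: cap_def del: times_complex.sel)
  obtain m where m: "\<And>n. n \<ge> m \<Longrightarrow> (f ^^ n) ` W \<subseteq> cap a c"
    using WT(6)[OF openin_cap aO] unfolding eventually_sequentially by blast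
  (* M is positive, so that k * M runs through arbitrarily large exponents. *)
  define M where "M = Suc m"
  have Wb: "W \<subseteq> basin f a"
  proof
    fix x assume "x \<in> W"
    then have "x \<in> disk" "(f ^^ 0) x \<in> W" using WT(2) by auto
    then show "x \<in> basin f a" using basin_eq_Union(2)[OF WT(3-5,2,6)] by blast
  qed
  have OM: "(f ^^ M) ` cap a c \<subseteq> cap a c"
  proof -
    have "cap a c \<subseteq> W" using sub c(3) WT(5) by blast
    then have "(f ^^ M) ` cap a c \<subseteq> (f ^^ M) ` W" by (rule image_mono)
    also have "\<dots> \<subseteq> cap a c" by (rule m) (simp add: M_def)
    finally show ?thesis .
  qed
  have preim: "x \<in> (f' ^^ n) ` cap a c \<longleftrightarrow> x \<in> disk \<and> (f ^^ n) x \<in> cap a c" for x n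
  proof
    assume "x \<in> (f' ^^ n) ` cap a c"
    then show "x \<in> disk \<and> (f ^^ n) x \<in> cap a c"
      using disk_homeo.in_disk(2)[OF pow] disk_homeo.inv(2)[OF pow] sub by auto
  next
    assume "x \<in> disk \<and> (f ^^ n) x \<in> cap a c"
    then show "x \<in> (f' ^^ n) ` cap a c"
      using disk_homeo.inv(1)[OF pow] by (metis imageI)
  qed
  have exh: "\<exists>k. Z \<subseteq> (f' ^^ (k * M)) ` cap a c" if Z: "compact Z" "Z \<subseteq> basin f a" for Z
  proof -
    obtain n where n: "\<And>i. i \<ge> n \<Longrightarrow> (f ^^ i) ` Z \<subseteq> cap a c"
      using compact_uniformly_attracted[OF Z openin_cap aO] unfolding eventually_sequentially by blast
    have "n * M \<ge> n" by (simp add: M_def)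
    then have "Z \<subseteq> (f' ^^ (n * M)) ` cap a c"
      using n[of "n * M"] preim Z(2) basin_subset by blast
    then show ?thesis by blast
  qed
  show ?thesis
  proof (rule that[OF c(1,2), of M])
    show "closed_cap a c \<subseteq> basin f a" using c(3) WT(5) Wb by blast
    show "(f' ^^ (k * M)) ` cap a c \<subseteq> (f' ^^ (Suc k * M)) ` cap a c" for k
    proof
      fix x assume "x \<in> (f' ^^ (k * M)) ` cap a c"
      then have "x \<in> disk" "(f ^^ (k * M)) x \<in> cap a c" using preim by auto
      moreover from this have "(f ^^ M) ((f ^^ (k * M)) x) \<in> cap a c" using OM by blast
      ultimately show "x \<in> (f' ^^ (Suc k * M)) ` cap a c"
        unfolding preim by (simp add: pow_add_apply)
    qed
    show "x \<in> basin f a \<longleftrightarrow> (\<exists>k. x \<in> (f' ^^ (k * M)) ` cap a c)" for x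
    proof
      assume "x \<in> basin f a"
      then show "\<exists>k. x \<in> (f' ^^ (k * M)) ` cap a c" using exh[of "{x}"] by auto
    next
      assume "\<exists>k. x \<in> (f' ^^ (k * M)) ` cap a c"
      then obtain k where k: "x \<in> disk" "(f ^^ (k * M)) x \<in> cap a c" using preim by auto
      then have "(f ^^ (k * M)) x \<in> W" using sub c(3) WT(5) by blast
      then show "x \<in> basin f a" using k(1) basin_eq_Union(2)[OF WT(3-5,2,6)] by blast
    qed
    show "\<exists>k. Z \<subseteq> (f' ^^ (k * M)) ` cap a c" if "compact Z" "Z \<subseteq> basin f a" for Z
      using exh that by blast
  qed
qed

lemma Re_self_mult_cnj: "Re (a * cnj a) = 1"
  using on_boundary cmod_power2[of a] by (simp add: power2_eq_square)

lemma cap_interior_point: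
  assumes "c < r" "0 < r" "r < 1"
  shows "of_real r * a \<in> cap a c \<inter> ball 0 1"
proof -
  have "Re (of_real r * a * cnj a) = r"
    using Re_self_mult_cnj by (simp only: mult.assoc times_complex.sel Im_complex_of_real) simp
  moreover have "norm (of_real r * a) = r"
    using assms on_boundary by (simp add: norm_mult)
  ultimately show ?thesis
    using assms by (simp add: cap_def del: times_complex.sel)
qed

lemma attractor_in_cap: "c < 1 \<Longrightarrow> a \<in> cap a c \<inter> disk_boundary"
  using on_boundary Re_self_mult_cnj by (simp add: cap_def del: times_complex.sel)

text \<open>
  The basin is an increasing union of homeomorphic images of a cap, and its complement a decreasing
  intersection of images of the complement of the cap. The complement is therefore connected, which
  means that the basin has no holes.
\<close>

lemma basin_connected:
  shows "connected (basin f a)" "connected (basin f a \<inter> ball 0 1)" "connected (basin f a \<inter> disk_boundary)"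
    and basin_complement: "compact (disk - basin f a)" "connected (disk - basin f a)"
proof -
  obtain c M where c: "0 < c" "c < 1"
    and inc: "\<And>k. (f' ^^ (k * M)) ` cap a c \<subseteq> (f' ^^ (Suc k * M)) ` cap a c"
    and bas: "\<And>x. x \<in> basin f a \<longleftrightarrow> (\<exists>k. x \<in> (f' ^^ (k * M)) ` cap a c)"
    using basin_exhaustion by metis
  let ?O = "cap a c" and ?P = "\<lambda>k. (f' ^^ (k * M)) ` cap a c"
  have sub: "?O \<subseteq> disk" by (auto simp: cap_def)
  have mono: "?P k \<subseteq> ?P l" if "k \<le> l" for k l
    using inc that by (rule lift_Suc_mono_le[of ?P])
  have union: "connected (basin f a \<inter> X)"
    if X: "\<And>n x. x \<in> disk \<Longrightarrow> (f' ^^ n) x \<in> X \<longleftrightarrow> x \<in> X" and con: "connected (?O \<inter> X)" and ne: "?O \<inter> X \<noteq> {}" for X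
  proof -
    have eq: "?P k \<inter> X = (f' ^^ (k * M)) ` (?O \<inter> X)" for k
      using X sub by auto
    have "basin f a \<inter> X = (\<Union>k. ?P k \<inter> X)" using bas by auto
    also have "connected \<dots>"
    proof (rule connected_Union)
      have "connected (?P k \<inter> X)" for k
        unfolding eq using disk_homeo.connected_image[OF disk_homeo.inverse[OF pow] con] sub by blast
      then show "connected S" if "S \<in> range (\<lambda>k. ?P k \<inter> X)" for S
        using that by blast
      have "?O \<inter> X \<subseteq> ?P k \<inter> X" for k
        using mono[of 0 k] by auto
      then show "\<Inter> (range (\<lambda>k. ?P k \<inter> X)) \<noteq> {}" using ne by blast
    qed
    finally show ?thesis .
  qed
  have "of_real ((1 + c) / 2) * a \<in> cap a c \<inter> ball 0 1"
    by (rule cap_interior_point) (use c in auto)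
  then have ne: "cap a c \<inter> ball 0 1 \<noteq> {}" by blast
  note con = connected_cap[OF on_boundary c(1)]
  have "connected (basin f a \<inter> UNIV)"
    by (rule union) (use con attractor_in_cap c in auto)
  then show "connected (basin f a)" by simp
  show "connected (basin f a \<inter> ball 0 1)"
    by (rule union) (use con ne disk_homeo.in_ball_iff[OF disk_homeo.inverse[OF pow]] in blast)+
  show "connected (basin f a \<inter> disk_boundary)"
    by (rule union) (use con attractor_in_cap[OF c(2)] disk_homeo.in_sphere_iff[OF disk_homeo.inverse[OF pow]] in blast)+
  show "compact (disk - basin f a)"
  proof -
    have "closedin (top_of_set disk) (disk - basin f a)"
      by (rule closedin_diff[OF closedin_self basin_openin])
    then show ?thesis by (rule closedin_compact[OF compact_cball])
  qed
  let ?C = "\<lambda>k. (f' ^^ (k * M)) ` (disk - ?O)"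
  have C: "?C k = disk - ?P k" for k
  proof -
    interpret p: disk_homeo "f' ^^ (k * M)" "f ^^ (k * M)"
      using disk_homeo.inverse[OF pow] .
    have "(f' ^^ (k * M)) ` disk = disk"
      using p.hom by (simp add: homeomorphism_def)
    then show ?thesis
      using inj_on_image_set_diff[OF p.inj, of disk ?O] sub by auto
  qed
  have "connected (\<Inter> (range ?C))"
  proof (rule connected_nest)
    have "compact (disk - ?O)"
      by (rule closedin_compact[OF compact_cball closedin_diff[OF closedin_self openin_cap]])
    then show "compact (?C k)" for k
      using disk_homeo.compact_image[OF disk_homeo.inverse[OF pow]] by blast
    show "connected (?C k)" for k
      using disk_homeo.connected_image[OF disk_homeo.inverse[OF pow]] con(5) by blast
    show "?C n \<subseteq> ?C m" if "m \<le> n" for m n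
      using mono[OF that] unfolding C by blast
  qed
  moreover have "\<Inter> (range ?C) = disk - basin f a"
    unfolding C using bas by auto
  ultimately show "connected (disk - basin f a)" by simp
qed

text \<open>
  The required set is the boundary part of an iterated preimage of a closed cap. It plays the role of the
  arc \<open>I\<close> in \<open>connected_collar\<close>.
\<close>

lemma basin_boundary_compact_subset:
  assumes Z: "compact Z" "Z \<subseteq> basin f a \<inter> disk_boundary"
  obtains I where "compact I" "connected I" "Z \<subseteq> I" "I \<subseteq> basin f a \<inter> disk_boundary"
proof -
  obtain c M where c: "0 < c" "c < 1" and cc: "closed_cap a c \<subseteq> basin f a"
    and exh: "\<And>Z. compact Z \<Longrightarrow> Z \<subseteq> basin f a \<Longrightarrow> \<exists>k. Z \<subseteq> (f' ^^ (k * M)) ` cap a c"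
    using basin_exhaustion by metis
  obtain k where k: "Z \<subseteq> (f' ^^ (k * M)) ` cap a c"
    using exh Z by blast
  let ?h = "f' ^^ (k * M)" and ?C = "closed_cap a c \<inter> disk_boundary"
  interpret p: disk_homeo ?h "f ^^ (k * M)"
    using disk_homeo.inverse[OF pow] .
  have sub: "cap a c \<subseteq> closed_cap a c" "?C \<subseteq> disk" "cap a c \<subseteq> disk" by (auto simp: cap_def closed_cap_def)
  show ?thesis
  proof
    have "closed {z. c \<le> Re (z * cnj a)}" by (intro closed_Collect_le continuous_intros)
    then have "compact (disk_boundary \<inter> {z. c \<le> Re (z * cnj a)})"
      by (rule compact_Int_closed[OF compact_sphere])
    moreover have "disk_boundary \<inter> {z. c \<le> Re (z * cnj a)} = ?C"
      by (auto simp: closed_cap_def)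
    ultimately show "compact (?h ` ?C)" using p.compact_image sub by simp
    show "connected (?h ` ?C)"
      using connected_cap(4)[OF on_boundary c(1)] p.connected_image sub by simp
    show "Z \<subseteq> ?h ` ?C"
    proof
      fix z assume z: "z \<in> Z"
      then obtain x where x: "x \<in> cap a c" "z = ?h x" using k by blast
      then have "x \<in> disk_boundary"
        using p.in_sphere_iff[of x] sub z Z(2) by blast
      then show "z \<in> ?h ` ?C" using x sub by blast
    qed
    show "?h ` ?C \<subseteq> basin f a \<inter> disk_boundary"
    proof clarify
      fix x assume x: "x \<in> closed_cap a c" "x \<in> disk_boundary"
      then have xd: "x \<in> disk" by auto
      have "(f ^^ (k * M)) (?h x) \<in> basin f a"
        using p.inv(1)[OF xd] cc x by auto
      then have "?h x \<in> basin f a"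
        using pow_basin_invariant p.in_disk(1)[OF xd] by blast
      then show "?h x \<in> basin f a \<inter> disk_boundary"
        using p.in_sphere_iff[OF xd] x by blast
    qed
  qed
qed

end

section \<open>Dynamics on the boundary circle\<close>

text \<open>
  If the arc were not mapped into itself, it would be mapped into the complementary arc. The image of the
  closed arc, which joins the two ends there, would then contain the third fixed point.
\<close>

lemma arc_between_fixed_points_preserved:
  assumes h: "disk_homeo h h'" and e: "\<bar>e\<bar> = 1"
    and t: "t1 < ta" "ta < t2" "t2 < t1 + 2 * pi"
    and fix1: "h (cis (e * t1)) = cis (e * t1)" and fixa: "h (cis (e * ta)) = cis (e * ta)"
    and fix2: "h (cis (e * t2)) = cis (e * t2)"
  shows "h ` (\<lambda>s. cis (e * s)) ` {t1<..<ta} \<subseteq> (\<lambda>s. cis (e * s)) ` {t1<..<ta}"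
proof (rule ccontr)
  let ?p = "\<lambda>s. cis (e * s)"
  let ?S = "h ` ?p ` {t1<..<ta}" and ?S' = "h ` ?p ` {t1..ta}"
  interpret h: disk_homeo h h' by (rule h)
  note inj = cis_mult_eq_imp[OF e]
  have pd: "?p s \<in> disk" "?p s \<in> disk_boundary" for s by auto
  have sub: "?p ` X \<subseteq> disk" for X by auto
  have Ssub: "h ` ?p ` X \<subseteq> disk_boundary" for X
    using h.in_sphere_iff pd by blast
  have con: "connected ?S" "connected ?S'"
    by (intro h.connected_image connected_continuous_image continuous_intros sub connected_Ioo connected_Icc)+
  have hinj: "h x = h y \<Longrightarrow> x = y" if "x \<in> disk" "y \<in> disk" for x y
    using h.inj that by (meson inj_onD)
  have notin: "?p t1 \<notin> ?S" "?p ta \<notin> ?S" "?p t2 \<notin> ?S'"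
  proof -
    show "?p t1 \<notin> ?S"
    proof
      assume "?p t1 \<in> ?S"
      then obtain s where s: "s \<in> {t1<..<ta}" "h (?p t1) = h (?p s)" using fix1 by auto
      then have "t1 = s" using hinj[OF pd(1) pd(1)] inj[of t1 s] t by auto
      then show False using s by auto
    qed
    show "?p ta \<notin> ?S"
    proof
      assume "?p ta \<in> ?S"
      then obtain s where s: "s \<in> {t1<..<ta}" "h (?p ta) = h (?p s)" using fixa by auto
      then have "ta = s" using hinj[OF pd(1) pd(1)] inj[of ta s] t by auto
      then show False using s by auto
    qed
    show "?p t2 \<notin> ?S'"
    proof
      assume "?p t2 \<in> ?S'"
      then obtain s where s: "s \<in> {t1..ta}" "h (?p t2) = h (?p s)" using fix2 by auto
      then have "t2 = s" using hinj[OF pd(1) pd(1)] inj[of t2 s] t by auto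
      then show False using s t by auto
    qed
  qed
  assume "\<not> ?S \<subseteq> ?p ` {t1<..<ta}"
  then obtain x where x: "x \<in> ?S" "x \<notin> ?p ` {t1<..<ta}" by blast
  have "x \<in> disk_boundary" using x(1) Ssub by blast
  then obtain s where s: "x = ?p s" "s \<in> {t1..t1 + 2 * pi}"
    using sphere_eq_cis_image[OF e, of t1] by blast
  have "s \<noteq> t1" "s \<noteq> t1 + 2 * pi" "s \<noteq> ta"
    using s(1) x(1) notin cis_mult_periodic[OF e] by auto
  moreover have "s \<notin> {t1<..<ta}" using x(2) s(1) by blast
  ultimately have s': "ta < s" "s < t1 + 2 * pi" using s(2) by auto
  have "?S \<subseteq> ?p ` {ta<..<t1 + 2 * pi}"
    by (rule connected_subset_arc[OF con(1) Ssub e s'])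
      (use t s x notin cis_mult_periodic[OF e] in auto)
  (* The image of the closed arc misses this point of the arc and the third fixed point, which
     together separate its ends. *)
  define tm where "tm = (t1 + ta) / 2"
  have tm: "t1 < tm" "tm < ta" using t by (auto simp: tm_def)
  have "?S' \<subseteq> insert (?p t1) (insert (?p ta) ?S)"
  proof -
    have "{t1..ta} \<subseteq> insert t1 (insert ta {t1<..<ta})" by auto
    then show ?thesis using fix1 fixa by blast
  qed
  moreover have "?p tm \<notin> ?S"
  proof
    assume "?p tm \<in> ?S"
    then obtain s where "s \<in> {ta<..<t1 + 2 * pi}" "?p tm = ?p s"
      using \<open>?S \<subseteq> ?p ` {ta<..<t1 + 2 * pi}\<close> by blast
    then show False using inj[of tm s] tm by auto
  qed
  moreover have "?p tm \<noteq> ?p t1" "?p tm \<noteq> ?p ta"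
    using inj[of tm t1] inj[of tm ta] tm t by auto
  ultimately have "?p tm \<notin> ?S'" by blast
  have "?p ta \<in> ?S'" "?p t1 \<in> ?S'" using fixa fix1 t by force+
  have "?S' \<subseteq> ?p ` {tm<..<t2}"
    by (rule connected_subset_arc[OF con(2) Ssub e tm(2) t(2)])
      (use t tm notin \<open>?p tm \<notin> ?S'\<close> \<open>?p ta \<in> ?S'\<close> in auto)
  then obtain s where "s \<in> {tm<..<t2}" "?p t1 = ?p s" using \<open>?p t1 \<in> ?S'\<close> by blast
  then show False using inj[of t1 s] tm t by auto
qed

lemma (in attractor) fixed_point_in_basin: "x \<in> basin f a \<Longrightarrow> f x = x \<Longrightarrow> x = a"
proof -
  assume x: "x \<in> basin f a" "f x = x"
  have "(f ^^ n) x = x" for n by (induction n) (use x in auto)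
  then have "(\<lambda>n. x) \<longlonglongrightarrow> a" using x by (simp add: basin_def)
  then show "x = a" by (simp add: LIMSEQ_const_iff)
qed

lemma basin_disjoint: "a \<noteq> b \<Longrightarrow> basin f a \<inter> basin f b = {}"
  using LIMSEQ_unique by (auto simp: basin_def)

text \<open>
  If the basin did not contain the arc, then by continuity the last point of the arc outside the basin would
  be mapped to a point of the arc that is not farther from the attractor. As its image is not in the
  basin either, it would be fixed.
\<close>

lemma (in boundary_attractor) fixed_point_free_arc_in_basin:
  assumes e: "\<bar>e\<bar> = 1" and t: "t1 < ta" "ta < t2" "t2 < t1 + 2 * pi" and a: "a = cis (e * ta)"
    and fix1: "f (cis (e * t1)) = cis (e * t1)" and fix2: "f (cis (e * t2)) = cis (e * t2)"
    and free: "\<And>s. s \<in> {t1<..<ta} \<Longrightarrow> f (cis (e * s)) \<noteq> cis (e * s)"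
  shows "(\<lambda>s. cis (e * s)) ` {t1<..ta} \<subseteq> basin f a"
proof (rule ccontr)
  let ?p = "\<lambda>s. cis (e * s)"
  note inj = cis_mult_eq_imp[OF e]
  have pd: "?p s \<in> disk" "?p s \<in> disk_boundary" for s by auto
  define Z where "Z = {t1..ta} \<inter> ?p -` (disk - basin f a)"
  have "closed (?p -` (disk - basin f a))"
    by (intro continuous_closed_vimage compact_imp_closed basin_complement continuous_intros)
  then have "compact Z" unfolding Z_def by (rule compact_Int_closed[OF compact_Icc])
  have "?p t1 \<noteq> a" using inj[of t1 ta] t a by auto
  then have "t1 \<in> Z"
    using fixed_point_in_basin fix1 t pd by (auto simp: Z_def)
  then obtain s where s: "s \<in> Z" "\<And>x. x \<in> Z \<Longrightarrow> x \<le> s"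
    using compact_attains_sup[OF \<open>compact Z\<close>] by blast
  assume "\<not> ?p ` {t1<..ta} \<subseteq> basin f a"
  then obtain x where "x \<in> {t1<..ta}" "?p x \<notin> basin f a" by blast
  then have "x \<in> Z" using pd by (auto simp: Z_def)
  then have "s > t1" using s(2)[of x] \<open>x \<in> {t1<..ta}\<close> by auto
  have sb: "?p s \<notin> basin f a" "s \<le> ta" using s(1) by (auto simp: Z_def)
  then have "s < ta" using attractor_in_basin a by (cases "s = ta") auto
  have above: "?p x \<in> basin f a" if "x \<in> {s<..ta}" for x
  proof (rule ccontr)
    assume "?p x \<notin> basin f a"
    then have "x \<in> Z" using that \<open>s > t1\<close> pd by (auto simp: Z_def)
    then show False using s(2)[of x] that by auto
  qed
  have "?p t2 \<noteq> a" using inj[of t2 ta] t a by auto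
  then have "?p t2 \<notin> basin f a" using fixed_point_in_basin fix2 by blast
  then have sub: "basin f a \<inter> disk_boundary \<subseteq> ?p ` {s<..<t2}"
    by (intro connected_subset_arc[OF basin_connected(3) _ e \<open>s < ta\<close> t(2)])
      (use sb \<open>s > t1\<close> t attractor_in_basin a pd in auto)
  have pres: "f ` ?p ` {t1<..<ta} \<subseteq> ?p ` {t1<..<ta}"
    by (rule arc_between_fixed_points_preserved[OF _ e t fix1 _ fix2])
      (use fixed(2) a disk_homeo_axioms in auto)
  (* Points of the arc beyond s stay beyond s, and by continuity so does the boundary point itself. *)
  have "(f \<circ> ?p) ` closure {s<..<ta} \<subseteq> ?p ` {s..ta}"
  proof (rule image_closure_subset)
    show "continuous_on (closure {s<..<ta}) (f \<circ> ?p)"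
      by (intro continuous_on_compose continuous_on_subset[OF cont(1)] continuous_intros) auto
    show "closed (?p ` {s..ta})"
      by (intro compact_imp_closed compact_continuous_image continuous_intros) auto
    show "(f \<circ> ?p) ` {s<..<ta} \<subseteq> ?p ` {s..ta}"
    proof
      fix y assume "y \<in> (f \<circ> ?p) ` {s<..<ta}"
      then obtain x where x: "x \<in> {s<..<ta}" "y = f (?p x)" by auto
      have "f (?p x) \<in> basin f a" "f (?p x) \<in> disk_boundary"
        using basin_invariant[OF pd(1)] above[of x] x in_sphere_iff[OF pd(1)] pd by auto
      then obtain u where u: "u \<in> {s<..<t2}" "y = ?p u" using sub x by blast
      have "?p x \<in> ?p ` {t1<..<ta}" using x(1) \<open>s > t1\<close> by auto
      then have "f (?p x) \<in> ?p ` {t1<..<ta}" using pres by blast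
      then obtain v where v: "v \<in> {t1<..<ta}" "y = ?p v" using x(2) by blast
      have "u = v" using inj[of u v] u v \<open>s > t1\<close> t by auto
      then show "y \<in> ?p ` {s..ta}" using u v by auto
    qed
  qed
  moreover have "s \<in> closure {s<..<ta}" using \<open>s < ta\<close> by simp
  ultimately have "f (?p s) \<in> ?p ` {s..ta}" by auto
  then obtain u where u: "u \<in> {s..ta}" "f (?p s) = ?p u" by blast
  have "f (?p s) \<notin> basin f a" using basin_invariant[OF pd(1)] sb by blast
  then have "u = s" using above[of u] u by (cases "u = s") auto
  then show False using free[of s] u \<open>s > t1\<close> \<open>s < ta\<close> by auto
qed

section \<open>Crosscuts of a basin\<close>

locale adjacent_fixed_points =
  boundary_attractor f f' a + rep: boundary_attractor f' f r + rep2: boundary_attractor f' f r2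
  for f f' a r r2 +
  fixes t1 ta t2 :: real
  assumes order: "t1 < ta" "ta < t2" "t2 < t1 + 2 * pi"
    and points: "r = cis t1" "a = cis ta" "r2 = cis t2"
    and arcs_in_basin: "cis ` {t1<..ta} \<subseteq> basin f a" "cis ` {ta..<t2} \<subseteq> basin f a"
begin

abbreviation "U \<equiv> basin f a"
abbreviation "V \<equiv> basin f' r"
abbreviation "\<Gamma> \<equiv> disk - U"

lemma cis_inj: "cis x = cis y \<Longrightarrow> \<bar>x - y\<bar> < 2 * pi \<Longrightarrow> x = y"
  by (rule cis_eq_imp)

lemma distinct: "r \<noteq> a" "r2 \<noteq> a" "r \<noteq> r2"
  using cis_inj[of t1 ta] cis_inj[of t2 ta] cis_inj[of t1 t2] order unfolding points by auto

lemma U_V: "U \<subseteq> disk" "V \<subseteq> disk" "a \<notin> V" "r \<notin> U" "r2 \<notin> U" "r2 \<notin> V" "r \<in> \<Gamma>" "a \<in> U" "r \<in> V"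
proof -
  show "U \<subseteq> disk" "V \<subseteq> disk" using basin_subset rep.basin_subset by blast+
  have f'a: "f' a = a" using inv(1)[of a] fixed by simp
  have fr: "f r = r" using inv(2)[of r] rep.fixed by simp
  have fr2: "f r2 = r2" using inv(2)[of r2] rep2.fixed by simp
  show "a \<notin> V" using rep.fixed_point_in_basin f'a distinct by metis
  show "r2 \<notin> V" using rep.fixed_point_in_basin rep2.fixed distinct by metis
  show "r \<notin> U" "r2 \<notin> U" using fixed_point_in_basin fr fr2 distinct by metis+
  then show "r \<in> \<Gamma>" using rep.fixed by simp
  show "a \<in> U" "r \<in> V" using attractor_in_basin rep.attractor_in_basin by blast+
qed

lemma U_boundary: "U \<inter> disk_boundary \<subseteq> cis ` {t1<..<t2}"
  using connected_subset_arc[OF basin_connected(3), of 1 t1 ta t2] order U_V on_boundary points by auto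

lemma V_boundary: "V \<inter> disk_boundary \<subseteq> cis ` {t2 - 2 * pi<..<ta}"
proof -
  have "cis (t2 - 2 * pi) = r2"
    using cis_mult_periodic[of 1 "t2 - 2 * pi"] points by simp
  then show ?thesis
    using connected_subset_arc[OF rep.basin_connected(3), of 1 "t2 - 2 * pi" t1 ta] order U_V
      rep.on_boundary points by auto
qed

text \<open>
  The inverse is an argument because it is applied as often as \<open>h\<close> itself. On the boundary only \<open>a\<close>, \<open>r\<close> and \<open>r2\<close> have to be fixed: the third
  fixed point keeps \<open>h\<close> from exchanging the two arcs that end at \<open>a\<close>.
\<close>

definition symmetry :: "(complex \<Rightarrow> complex) \<Rightarrow> (complex \<Rightarrow> complex) \<Rightarrow> bool" where
  "symmetry h h' \<longleftrightarrow> disk_homeo h h' \<and> (\<forall>x\<in>disk. h (f x) = f (h x)) \<and> h a = a \<and> h r = r \<and> h r2 = r2"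

lemma symmetry_homeo: "symmetry h h' \<Longrightarrow> disk_homeo h h'"
  by (simp add: symmetry_def)

lemma symmetry_commutes:
  assumes "symmetry h h'" "x \<in> disk"
  shows "h (f x) = f (h x)" "h (f' x) = f' (h x)" "h ((f ^^ n) x) = (f ^^ n) (h x)"
    "h ((f' ^^ n) x) = (f' ^^ n) (h x)"
proof -
  interpret h: disk_homeo h h' using assms symmetry_homeo by blast
  have 1: "h (f y) = f (h y)" if "y \<in> disk" for y
    using assms(1) that by (simp add: symmetry_def)
  have 2: "h (f' y) = f' (h y)" if "y \<in> disk" for y
  proof -
    have "h y = f (h (f' y))" using 1[of "f' y"] in_disk inv that by simp
    then show ?thesis using inv(1) h.in_disk in_disk that by metis
  qed
  show "h (f x) = f (h x)" "h (f' x) = f' (h x)" using 1 2 assms(2) by auto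
  show "h ((f ^^ n) x) = (f ^^ n) (h x)"
    by (induction n) (use 1 assms(2) disk_homeo.in_disk(1)[OF pow] in auto)
  show "h ((f' ^^ n) x) = (f' ^^ n) (h x)"
    by (induction n) (use 2 assms(2) disk_homeo.in_disk(2)[OF pow] in auto)
qed

lemma symmetry_fixes: "symmetry h h' \<Longrightarrow> h a = a" "symmetry h h' \<Longrightarrow> h r = r" "symmetry h h' \<Longrightarrow> h r2 = r2"
  by (simp_all add: symmetry_def)

lemma symmetry_inverse:
  assumes "symmetry h h'"
  shows "symmetry h' h"
proof -
  interpret h: disk_homeo h h' using assms symmetry_homeo by blast
  have "h' (f x) = f (h' x)" if "x \<in> disk" for x
  proof -
    have "h (f (h' x)) = f x"
      using symmetry_commutes(1)[OF assms, of "h' x"] h.in_disk h.inv that by simp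
    then show ?thesis using h.inv(1) in_disk h.in_disk that by metis
  qed
  moreover have "h' a = a" "h' r = r" "h' r2 = r2"
    using symmetry_fixes[OF assms] h.inv(1) fixed(1) rep.fixed(1) rep2.fixed(1) by metis+
  ultimately show ?thesis using h.inverse by (simp add: symmetry_def)
qed

lemma symmetry_compose:
  assumes "symmetry h h'" "symmetry k k'"
  shows "symmetry (h \<circ> k) (k' \<circ> h')"
proof -
  have "k x \<in> disk" if "x \<in> disk" for x
    using disk_homeo.in_disk(1)[OF symmetry_homeo[OF assms(2)] that] .
  then show ?thesis
    using assms by (auto simp: symmetry_def intro!: disk_homeo_compose)
qed

lemma symmetry_self: "symmetry f f'"
proof -
  have "f r = r" "f r2 = r2"
    using inv(2) rep.fixed rep2.fixed by metis+
  then show ?thesis using disk_homeo_axioms fixed by (simp add: symmetry_def)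
qed

lemma symmetry_id: "symmetry id id"
  using homeomorphism_ident by (simp add: symmetry_def disk_homeo_def id_def)

lemma symmetry_funpow: "symmetry h h' \<Longrightarrow> symmetry (h ^^ n) (h' ^^ n)"
proof (induction n)
  case 0
  then show ?case using symmetry_id by (simp add: id_def)
next
  case (Suc n)
  then have "symmetry (h ^^ Suc n) (h' ^^ n \<circ> h')"
    using symmetry_compose[of h h' "h ^^ n" "h' ^^ n"] by simp
  then show ?case by (simp only: funpow_Suc_right)
qed

lemma symmetry_basins:
  assumes "symmetry h h'" "x \<in> disk"
  shows "h x \<in> U \<longleftrightarrow> x \<in> U" "h x \<in> V \<longleftrightarrow> x \<in> V"
proof -
  have *: "(x \<in> U \<longrightarrow> h x \<in> U) \<and> (x \<in> V \<longrightarrow> h x \<in> V)" if h: "symmetry h h'" for h h' x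
  proof -
    interpret h: disk_homeo h h' using h symmetry_homeo by blast
    have "h ` disk \<subseteq> disk" using h.in_disk by blast
    then show ?thesis
      using commuting_maps_basin[OF h.cont(1)] rep.commuting_maps_basin[OF h.cont(1)]
        symmetry_commutes(1,2)[OF h] symmetry_fixes[OF h] by blast
  qed
  have "h' (h x) = x"
    using disk_homeo.inv(1)[OF symmetry_homeo[OF assms(1)] assms(2)] .
  then show "h x \<in> U \<longleftrightarrow> x \<in> U" "h x \<in> V \<longleftrightarrow> x \<in> V"
    using *[OF assms(1), of x] *[OF symmetry_inverse[OF assms(1)], of "h x"] by auto
qed

abbreviation "\<sigma> \<equiv> cis ` {t1<..<ta}"

lemma symmetry_arc:
  assumes h: "symmetry h h'"
  shows "h ` \<sigma> \<subseteq> \<sigma>"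
  using arc_between_fixed_points_preserved[OF symmetry_homeo[OF h], of 1 t1 ta t2] order
    symmetry_fixes[OF h] points by simp

lemma \<sigma>: "\<sigma> \<subseteq> U" "\<sigma> \<subseteq> disk_boundary"
  using arcs_in_basin(1) by auto

text \<open>
  These crosscuts of \<open>U\<close> cut off the end of \<open>\<sigma>\<close> at \<open>r\<close> from \<open>a\<close>. Being compact subsets of \<open>V - {r}\<close>, any two of them become
  disjoint after applying a high power of \<open>f\<close> to one of them.
\<close>

definition xcut :: "(real \<Rightarrow> complex) \<Rightarrow> bool" where
  "xcut \<gamma> \<longleftrightarrow> arc \<gamma> \<and> \<gamma> 0 \<in> \<sigma> \<and> (\<forall>t\<in>{0<..<1}. \<gamma> t \<in> ball 0 1 \<inter> U) \<and> \<gamma> 1 \<in> \<Gamma> \<and>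
     path_image \<gamma> \<subseteq> V - {r}"

lemma xcutD:
  assumes "xcut \<gamma>"
  shows "arc \<gamma>" "path \<gamma>" "\<gamma> 0 \<in> \<sigma>" "\<gamma> 1 \<in> \<Gamma>" "path_image \<gamma> \<subseteq> V" "r \<notin> path_image \<gamma>" "path_image \<gamma> \<subseteq> disk"
    "compact (path_image \<gamma>)" "a \<notin> path_image \<gamma>"
    "\<And>t. t \<in> {0<..<1} \<Longrightarrow> \<gamma> t \<in> ball 0 1" "\<And>t. t \<in> {0..<1} \<Longrightarrow> \<gamma> t \<in> U"
    "\<And>t. t \<in> {0..1} \<Longrightarrow> \<gamma> t \<in> disk" "\<And>t. t \<in> {0..1} \<Longrightarrow> \<gamma> t \<in> path_image \<gamma>"
proof -
  show *: "arc \<gamma>" "\<gamma> 0 \<in> \<sigma>" "\<gamma> 1 \<in> \<Gamma>" "path_image \<gamma> \<subseteq> V" "r \<notin> path_image \<gamma>"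
    "\<And>t. t \<in> {0<..<1} \<Longrightarrow> \<gamma> t \<in> ball 0 1"
    using assms by (auto simp: xcut_def)
  show "path \<gamma>" "path_image \<gamma> \<subseteq> disk" "a \<notin> path_image \<gamma>" using * U_V arc_imp_path by blast+
  then show "compact (path_image \<gamma>)" by blast
  show "\<gamma> t \<in> path_image \<gamma>" if "t \<in> {0..1}" for t using that by (simp add: path_image_def)
  then show "\<gamma> t \<in> disk" if "t \<in> {0..1}" for t using that \<open>path_image \<gamma> \<subseteq> disk\<close> by blast
  show "\<gamma> t \<in> U" if "t \<in> {0..<1}" for t
  proof (cases "t = 0")
    case True then show ?thesis using *(2) \<sigma> by blast
  next
    case False
    then have "t \<in> {0<..<1}" using that by auto
    then show ?thesis using assms by (auto simp: xcut_def)
  qed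
qed

lemma xcut_symmetry:
  assumes h: "symmetry h h'" and \<gamma>: "xcut \<gamma>"
  shows "xcut (h \<circ> \<gamma>)"
proof -
  interpret h: disk_homeo h h' using h symmetry_homeo by blast
  note D = xcutD[OF \<gamma>]
  have "path (h \<circ> \<gamma>)"
    using path_continuous_image[OF D(2)] continuous_on_subset[OF h.cont(1) D(7)] by blast
  moreover have "inj_on (h \<circ> \<gamma>) {0..1}"
    using D(1,7) h.inj by (auto simp: arc_def path_image_def intro: comp_inj_on inj_on_subset)
  ultimately have "arc (h \<circ> \<gamma>)" by (simp add: arc_def)
  moreover have "(h \<circ> \<gamma>) 0 \<in> \<sigma>" using symmetry_arc[OF h] D(3) by auto
  moreover have "(h \<circ> \<gamma>) t \<in> ball 0 1 \<inter> U" if "t \<in> {0<..<1}" for t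
  proof -
    have "t \<in> {0..1}" using that by auto
    from D(12)[OF this] show ?thesis
      using D(10)[OF that] D(11)[of t] that h.in_ball_iff[of "\<gamma> t"] symmetry_basins[OF h, of "\<gamma> t"] by auto
  qed
  moreover have "(h \<circ> \<gamma>) 1 \<in> \<Gamma>"
    using D(4) symmetry_basins[OF h, of "\<gamma> 1"] h.in_disk by auto
  moreover have "path_image (h \<circ> \<gamma>) \<subseteq> V - {r}"
  proof -
    have "h x \<in> V - {r}" if "x \<in> path_image \<gamma>" for x
    proof -
      have x: "x \<in> disk" "x \<in> V" "x \<noteq> r" using that D by blast+
      moreover have "h x \<noteq> r" using h.inj x(1,3) rep.fixed(1) symmetry_fixes(2)[OF h] by (metis inj_onD)
      ultimately show ?thesis using symmetry_basins(2)[OF h] by blast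
    qed
    then show ?thesis unfolding path_image_compose by blast
  qed
  ultimately show ?thesis by (simp add: xcut_def)
qed

text \<open>
  The correction term \<open>t (1 - t) |p - q|\<^sup>2\<close> in the square of the norm is what keeps chords of the circle off
  the circle.
\<close>

lemma norm_chord_less:
  fixes p q :: complex
  assumes "norm p = 1" "norm q = 1" "p \<noteq> q" "t \<in> {0<..<1}"
  shows "norm (linepath p q t) < 1"
proof -
  have eq: "(norm (linepath p q t))^2 = (1 - t) * (norm p)^2 + t * (norm q)^2 - t * (1 - t) * (norm (p - q))^2"
    unfolding cmod_power2 linepath_def by (simp add: power2_eq_square algebra_simps)
  have "0 < t * (1 - t) * (norm (p - q))^2" using assms by auto
  then have "(norm (linepath p q t))^2 < 1^2" using eq assms by simp
  then show ?thesis by (rule power2_less_imp_less) simp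
qed

text \<open>
  A short chord from \<open>\<sigma>\<close> across \<open>r\<close> to the other side lies in \<open>V\<close>. Its second end is not in \<open>U\<close>, so that the chord
  can be cut at its first point in \<open>\<Gamma>\<close>. A chord ending at \<open>r\<close> itself would not do: the first point
  in \<open>\<Gamma>\<close> could be the fixed point \<open>r\<close>.
\<close>

lemma xcut_exists: "\<exists>\<gamma>. xcut \<gamma>"
proof -
  obtain G where G: "open G" "V = disk \<inter> G"
    using rep.basin_openin openin_open by blast
  then obtain d where d: "d > 0" "ball r d \<subseteq> G"
    using U_V(9) open_contains_ball by blast
  obtain \<eta> where \<eta>: "\<eta> > 0" "\<And>s. \<bar>s - t1\<bar> < \<eta> \<Longrightarrow> dist (cis s) r < d"
    using cis_close[OF d(1)] points by metis
  (* The bound by t1 + 2 * pi - t2 keeps q on the circle outside the arc that contains the boundary part of U. *)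
  define x where "x = min (\<eta> / 2) (min ((ta - t1) / 2) ((t1 + 2 * pi - t2) / 2))"
  have x: "0 < x" "x < \<eta>" "x < ta - t1" "x < t1 + 2 * pi - t2"
    using \<eta>(1) order by (auto simp: x_def min_def)
  define p where "p = cis (t1 + x)"
  define q where "q = cis (t1 - x)"
  have pq: "p \<in> ball r d" "q \<in> ball r d"
    using \<eta>(2)[of "t1 + x"] \<eta>(2)[of "t1 - x"] x by (auto simp: p_def q_def dist_commute)
  have p\<sigma>: "p \<in> \<sigma>" using x by (auto simp: p_def)
  have "q \<notin> U"
  proof
    assume "q \<in> U"
    then have "q \<in> cis ` {t1<..<t2}" using U_boundary by (auto simp: q_def)
    then obtain u where u: "u \<in> {t1<..<t2}" "q = cis u" by blast
    then show False using cis_inj[of u "t1 - x"] x order by (auto simp: q_def)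
  qed
  then have "q \<in> \<Gamma>" by (simp add: q_def)
  have "p \<in> U" using p\<sigma> \<sigma> by blast
  then have "p \<noteq> q" using \<open>q \<notin> U\<close> by blast
  have npq: "norm p = 1" "norm q = 1" by (simp_all add: p_def q_def)
  have qr: "p \<noteq> r" "q \<noteq> r"
    using cis_inj[of "t1 + x" t1] cis_inj[of "t1 - x" t1] x order by (auto simp: p_def q_def points)
  let ?l = "linepath p q"
  define Z where "Z = {0..1} \<inter> ?l -` \<Gamma>"
  have "compact Z"
    unfolding Z_def
    by (intro compact_Int_closed continuous_closed_vimage compact_imp_closed basin_complement continuous_intros) auto
  moreover have "1 \<in> Z" using \<open>q \<in> \<Gamma>\<close> by (simp add: Z_def linepath_1')
  ultimately obtain u where u: "u \<in> Z" "\<And>y. y \<in> Z \<Longrightarrow> u \<le> y"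
    using compact_attains_inf by (metis empty_iff)
  have u01: "u \<in> {0..1}" "?l u \<in> \<Gamma>" using u(1) by (auto simp: Z_def)
  have "u \<noteq> 0" using u01 \<open>p \<in> U\<close> by (auto simp: linepath_0')
  then have u0: "0 < u" "u \<le> 1" using u01 by auto
  define \<gamma> where "\<gamma> = linepath p (?l u)"
  have \<gamma>: "\<gamma> t = ?l (u * t)" for t
    by (simp add: \<gamma>_def linepath_def algebra_simps scaleR_conv_of_real)
  have in_ball: "?l s \<in> ball 0 1" if "s \<in> {0<..<1}" for s
    using norm_chord_less[OF npq \<open>p \<noteq> q\<close> that] by simp
  have in_V: "?l s \<in> V - {r}" if "s \<in> {0..1}" for s
  proof -
    have l: "?l s \<in> closed_segment p q" using that by (metis linepath_image_01 imageI)
    have "closed_segment p q \<subseteq> ball r d" "closed_segment p q \<subseteq> disk"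
      using pq npq by (intro closed_segment_subset convex_ball convex_cball; simp)+
    then have "?l s \<in> V" using G(2) d(2) l by blast
    moreover have "?l s \<noteq> r"
    proof (cases "s = 0 \<or> s = 1")
      case True then show ?thesis using qr by (auto simp: linepath_0' linepath_1')
    next
      case False
      then have "s \<in> {0<..<1}" using that by auto
      then show ?thesis using in_ball[of s] rep.on_boundary by auto
    qed
    ultimately show ?thesis by blast
  qed
  have um: "u * t \<in> {0..1}" if "t \<in> {0..1}" for t
    using that u0 by (auto intro: mult_le_one)
  have ut: "u * t \<in> {0<..<1}" "u * t < u" if "t \<in> {0<..<1}" for t
  proof -
    have "u * t < u * 1" using that u0 by (intro mult_strict_left_mono) auto
    then show lt: "u * t < u" by simp
    have "0 < u * t" using that u0 by simp
    then show "u * t \<in> {0<..<1}" using lt u0(2) by simp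
  qed
  have "xcut \<gamma>"
    unfolding xcut_def
  proof (intro conjI ballI)
    have "p \<noteq> ?l u" using u01 \<open>p \<in> U\<close> by auto
    then show "arc \<gamma>" by (simp add: \<gamma>_def)
    show "\<gamma> 0 \<in> \<sigma>" using p\<sigma> by (simp add: \<gamma>_def linepath_0')
    show "\<gamma> 1 \<in> \<Gamma>" using u01 \<gamma> by simp
    show "\<gamma> t \<in> ball 0 1 \<inter> U" if "t \<in> {0<..<1}" for t
    proof -
      have "u * t \<notin> Z" using u(2)[of "u * t"] ut(2)[OF that] by auto
      moreover have "u * t \<in> {0..1}" using um[of t] that by auto
      ultimately have "?l (u * t) \<notin> \<Gamma>" by (simp add: Z_def)
      then show ?thesis using in_ball[OF ut(1)[OF that]] \<gamma>[of t] by auto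
    qed
    show "path_image \<gamma> \<subseteq> V - {r}"
    proof
      fix z assume "z \<in> path_image \<gamma>"
      then obtain t where "t \<in> {0..1}" "z = \<gamma> t" by (auto simp: path_image_def)
      then show "z \<in> V - {r}" using in_V[OF um] \<gamma> by simp
    qed
  qed
  then show ?thesis by blast
qed

definition near :: "(real \<Rightarrow> complex) \<Rightarrow> complex set" where
  "near \<gamma> = connected_component_set (U - path_image \<gamma>) a"

lemma near:
  assumes "xcut \<gamma>"
  shows "openin (top_of_set disk) (near \<gamma>)" "connected (near \<gamma>)" "a \<in> near \<gamma>" "near \<gamma> \<subseteq> U - path_image \<gamma>"
proof -
  have "openin (top_of_set disk) (U - path_image \<gamma>)"
    using basin_openin closed_subset[OF xcutD(7)[OF assms]] xcutD(8)[OF assms]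
    by (intro openin_diff) (auto intro: compact_imp_closed)
  then show "openin (top_of_set disk) (near \<gamma>)"
    unfolding near_def by (rule openin_disk_component)
  show "connected (near \<gamma>)" "near \<gamma> \<subseteq> U - path_image \<gamma>"
    unfolding near_def by (simp_all add: connected_component_subset)
  show "a \<in> near \<gamma>"
    unfolding near_def using U_V(8) xcutD(9)[OF assms] by (simp add: connected_component_refl)
qed

lemma connected_meets_near:
  assumes "connected S" "S \<subseteq> U - path_image \<gamma>" "S \<inter> near \<gamma> \<noteq> {}"
  shows "S \<subseteq> near \<gamma>"
  using assms connected_component_overlap unfolding near_def by blast

text \<open>
  A path from this part of \<open>\<sigma>\<close> to the attractor would have to cross the connected set \<open>path_image \<gamma> \<union> \<Gamma>\<close>, which
  joins the starting point of \<open>\<gamma>\<close> to \<open>r\<close>.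
\<close>

lemma xcut_separates:
  assumes \<gamma>: "xcut \<gamma>" and t: "\<gamma> 0 = cis t0" "t1 < t" "t < t0" "t0 < ta"
  shows "cis t \<notin> near \<gamma>"
proof
  assume mem: "cis t \<in> near \<gamma>"
  note D = xcutD[OF \<gamma>]
  obtain g where g: "path g" "path_image g \<subseteq> near \<gamma>" "pathstart g = cis t" "pathfinish g = a"
    "\<And>s. s \<in> {0<..<1} \<Longrightarrow> g s \<in> ball 0 1"
    using path_through_interior[OF near(1,2)[OF \<gamma>] mem near(3)[OF \<gamma>]] by blast
  let ?E = "path_image \<gamma> \<union> \<Gamma>" and ?J1 = "cis ` {t1..t0}" and ?J2 = "cis ` {t0..t1 + 2 * pi}"
  have J: "compact (cis ` {x..y})" "connected (cis ` {x..y})" for x y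
    by (intro compact_continuous_image connected_continuous_image continuous_intros compact_Icc connected_Icc)+
  have E: "compact ?E" "?E \<subseteq> disk"
    using D(7,8) basin_complement by auto
  have "\<gamma> 1 \<in> path_image \<gamma>" by (rule D(13)) simp
  then have Ec: "connected ?E"
    using D(2,4) basin_complement by (intro connected_Un connected_path_image) auto
  have "{t1..t0} \<union> {t0..t1 + 2 * pi} = {t1..t1 + 2 * pi}"
    using t order by auto
  then have un: "?J1 \<union> ?J2 = disk_boundary"
    using sphere_eq_cis_image[of 1 t1] by (simp flip: image_Un)
  have per: "cis (t1 + 2 * pi) = r"
    using cis_mult_periodic[of 1 t1] points by simp
  have "\<gamma> 0 \<in> path_image \<gamma>" by (rule D(13)) simp
  have int: "?J1 \<inter> ?J2 \<subseteq> ?E"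
  proof
    fix z assume "z \<in> ?J1 \<inter> ?J2"
    then obtain x y where xy: "x \<in> {t1..t0}" "y \<in> {t0..t1 + 2 * pi}" "z = cis x" "z = cis y" by blast
    show "z \<in> ?E"
    proof (cases "y - x < 2 * pi")
      case True
      then have "x = y" using cis_inj[of x y] xy by auto
      then have "x = t0" using xy by auto
      then show ?thesis using xy(3) t(1) \<open>\<gamma> 0 \<in> path_image \<gamma>\<close> by simp
    next
      case False
      then have "y = t1 + 2 * pi" using xy by auto
      then show ?thesis using xy(4) per U_V(7) by simp
    qed
  qed
  have ne: "?J1 \<inter> ?J2 \<noteq> {}"
  proof -
    have "t0 \<in> {t1..t0}" "t0 \<in> {t0..t1 + 2 * pi}" using t order by auto
    then show ?thesis by blast
  qed
  have start: "pathstart g \<in> ?J1 - ?J2"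
  proof -
    have "cis t \<notin> ?J2"
    proof
      assume "cis t \<in> ?J2"
      then obtain y where "y \<in> {t0..t1 + 2 * pi}" "cis t = cis y" by blast
      then show False using cis_inj[of t y] t order by auto
    qed
    then show ?thesis using g(3) t by auto
  qed
  have finish: "pathfinish g \<in> ?J2 - ?J1"
  proof -
    have "cis ta \<notin> ?J1"
    proof
      assume "cis ta \<in> ?J1"
      then obtain y where "y \<in> {t1..t0}" "cis ta = cis y" by blast
      then show False using cis_inj[of ta y] t order by auto
    qed
    then show ?thesis using g(4) t order points by auto
  qed
  have "path_image g \<inter> ?E \<noteq> {}"
    by (rule crossing_in_disk[OF E(1) Ec E(2) J J un int ne g(1) g(5) start finish])
  then show False using g(2) near(4)[OF \<gamma>] by blast
qed

lemma compact_avoids_point_eventually: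
  assumes "compact Z" "Z \<subseteq> V" "compact Y" "r \<notin> Y"
  shows "\<forall>\<^sub>F m in sequentially. (f' ^^ m) ` Z \<inter> Y = {}"
proof -
  have "openin (top_of_set disk) (disk - Y)"
    by (rule openin_disk_Diff[OF compact_imp_closed[OF assms(3)]])
  then have "\<forall>\<^sub>F m in sequentially. (f' ^^ m) ` Z \<subseteq> disk - Y"
    using rep.fixed(1) assms(4) by (intro rep.compact_uniformly_attracted[OF assms(1,2)]) auto
  then show ?thesis by (rule eventually_mono) blast
qed

lemma pow_image_inverse:
  assumes "X \<subseteq> disk" "Y \<subseteq> disk"
  shows "(f' ^^ m) ` X \<inter> Y = {} \<longleftrightarrow> X \<inter> (f ^^ m) ` Y = {}"
proof
  interpret p: disk_homeo "f ^^ m" "f' ^^ m" by (rule pow)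
  show "X \<inter> (f ^^ m) ` Y = {}" if dis: "(f' ^^ m) ` X \<inter> Y = {}"
  proof (rule ccontr)
    assume "X \<inter> (f ^^ m) ` Y \<noteq> {}"
    then obtain y where "y \<in> Y" "(f ^^ m) y \<in> X" by blast
    moreover from this have "(f' ^^ m) ((f ^^ m) y) = y" using p.inv(1) assms by blast
    ultimately show False using dis by (metis IntI empty_iff imageI)
  qed
  show "(f' ^^ m) ` X \<inter> Y = {}" if dis: "X \<inter> (f ^^ m) ` Y = {}"
  proof (rule ccontr)
    assume "(f' ^^ m) ` X \<inter> Y \<noteq> {}"
    then obtain x where "x \<in> X" "(f' ^^ m) x \<in> Y" by blast
    moreover from this have "(f ^^ m) ((f' ^^ m) x) = x" using p.inv(2) assms by blast
    ultimately show False using dis by (metis IntI empty_iff imageI)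
  qed
qed

lemma xcut_pow: "xcut \<beta> \<Longrightarrow> xcut ((f ^^ m) \<circ> \<beta>)"
  by (rule xcut_symmetry[OF symmetry_funpow[OF symmetry_self]])

text \<open>
  High powers of \<open>f\<close> move the starting point of \<open>\<beta>\<close> along \<open>\<sigma>\<close> beyond that of \<open>\<alpha>\<close>. As the crosscuts are then disjoint,
  all of \<open>\<alpha>\<close> lies on the side of \<open>r\<close>.
\<close>

lemma xcut_eventually_beyond:
  assumes \<alpha>: "xcut \<alpha>" and \<beta>: "xcut \<beta>"
  shows "\<forall>\<^sub>F m in sequentially. path_image \<alpha> \<inter> path_image ((f ^^ m) \<circ> \<beta>) = {} \<and>
     path_image \<alpha> \<inter> near ((f ^^ m) \<circ> \<beta>) = {} \<and> near ((f ^^ m) \<circ> \<beta>) \<subseteq> near \<alpha>"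
proof -
  note A = xcutD[OF \<alpha>] and B = xcutD[OF \<beta>]
  obtain s0 where s0: "t1 < s0" "s0 < ta" "\<alpha> 0 = cis s0" using A(3) by auto
  have "compact (cis ` {t1..s0})" by (intro compact_continuous_image continuous_intros compact_Icc)
  moreover have "a \<notin> cis ` {t1..s0}"
  proof
    assume "a \<in> cis ` {t1..s0}"
    then obtain y where "y \<in> {t1..s0}" "cis ta = cis y" using points by auto
    then show False using cis_inj[of ta y] s0 order by auto
  qed
  ultimately have "openin (top_of_set disk) (disk - cis ` {t1..s0})" "a \<in> disk - cis ` {t1..s0}"
    using openin_disk_Diff[OF compact_imp_closed] fixed(1) by blast+
  then have ev1: "\<forall>\<^sub>F m in sequentially. (f ^^ m) ` {\<beta> 0} \<subseteq> disk - cis ` {t1..s0}"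
    using B(3) \<sigma> by (intro compact_uniformly_attracted) auto
  have ev2: "\<forall>\<^sub>F m in sequentially. (f' ^^ m) ` path_image \<alpha> \<inter> path_image \<beta> = {}"
    by (rule compact_avoids_point_eventually[OF A(8,5) B(8,6)])
  from ev1 ev2 show ?thesis
  proof eventually_elim
    case (elim m)
    define \<delta> where "\<delta> = (f ^^ m) \<circ> \<beta>"
    have x: "xcut \<delta>" unfolding \<delta>_def by (rule xcut_pow[OF \<beta>])
    have dis: "path_image \<alpha> \<inter> path_image \<delta> = {}"
      unfolding \<delta>_def path_image_compose using pow_image_inverse[OF A(7) B(7)] elim(2) by blast
    obtain s where s: "t1 < s" "s < ta" "\<delta> 0 = cis s" using xcutD(3)[OF x] by auto
    have "s0 < s"
    proof (rule ccontr)
      assume "\<not> s0 < s"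
      then have "\<delta> 0 \<in> cis ` {t1..s0}" using s by auto
      then show False using elim(1) by (auto simp: \<delta>_def)
    qed
    then have "\<alpha> 0 \<notin> near \<delta>"
      unfolding s0(3) by (intro xcut_separates[OF x s(3) s0(1) _ s(2)])
    have img: "path_image \<alpha> = insert (\<alpha> 1) (\<alpha> ` {0..<1})"
      unfolding path_image_def by (simp flip: image_insert) (metis atLeastAtMost_insertL atLeastLessThan_eq_atLeastAtMost_diff insert_Diff atLeastAtMost_iff order_refl zero_le_one)
    have "\<alpha> ` {0..<1} \<subseteq> U - path_image \<delta>"
      using A(11) dis img by blast
    moreover have "connected (\<alpha> ` {0..<1})"
    proof (rule connected_continuous_image)
      show "continuous_on {0..<1} \<alpha>"
        by (rule continuous_on_subset[OF A(2)[unfolded path_def]]) auto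
    qed auto
    moreover have "\<alpha> 0 \<in> \<alpha> ` {0..<1}" by simp
    ultimately have "\<alpha> ` {0..<1} \<inter> near \<delta> = {}"
      using connected_meets_near \<open>\<alpha> 0 \<notin> near \<delta>\<close> by blast
    moreover have "\<alpha> 1 \<notin> near \<delta>" using A(4) near(4)[OF x] by blast
    ultimately have 2: "path_image \<alpha> \<inter> near \<delta> = {}" unfolding img by blast
    have "near \<delta> \<subseteq> near \<alpha>"
    proof (rule connected_meets_near[OF near(2)[OF x]])
      show "near \<delta> \<subseteq> U - path_image \<alpha>" using near(4)[OF x] 2 by blast
      show "near \<delta> \<inter> near \<alpha> \<noteq> {}" using near(3)[OF x] near(3)[OF \<alpha>] by blast
    qed
    then show ?case using dis 2 unfolding \<delta>_def by blast
  qed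
qed

lemma xcut_end_eventually_ne:
  assumes "xcut \<beta>"
  shows "\<forall>\<^sub>F m in sequentially. (f ^^ m) (\<beta> 1) \<noteq> p"
proof (cases "p \<in> V")
  case True
  note B = xcutD[OF assms]
  have "\<forall>\<^sub>F m in sequentially. (f' ^^ m) ` {p} \<inter> path_image \<beta> = {}"
    using True B by (intro compact_avoids_point_eventually) auto
  then show ?thesis
  proof eventually_elim
    case (elim m)
    show ?case
    proof
      assume "(f ^^ m) (\<beta> 1) = p"
      then have "(f' ^^ m) p = \<beta> 1"
        using disk_homeo.inv(1)[OF pow, of "\<beta> 1"] B(12)[of 1] by auto
      then show False using elim B(13)[of 1] by auto
    qed
  qed
next
  case False
  have "(f ^^ m) (\<beta> 1) \<in> V" for m
    using xcutD(5)[OF xcut_pow[OF assms, of m]] xcutD(13)[OF xcut_pow[OF assms, of m], of 1] by auto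
  then show ?thesis using False by (metis (mono_tags, lifting) always_eventually)
qed

section \<open>Small crosscuts around the fixed end of the basin\<close>

abbreviation "proj \<equiv> closest_point \<Gamma>"
abbreviation "ray z \<equiv> linepath z (closest_point \<Gamma> z)"

text \<open>
  The segment from \<open>z\<close> to the closest point of \<open>\<Gamma>\<close> determines an end of the basin. The end lies before the
  fixed end, or to the left of it, if some crosscut cuts it off from the attractor.
\<close>

definition left :: "complex \<Rightarrow> bool" where
  "left z \<longleftrightarrow> (\<exists>\<gamma>. xcut \<gamma> \<and> \<gamma> 1 \<noteq> proj z \<and> (\<forall>\<^sub>F t in at_left 1. ray z t \<notin> near \<gamma>))"

text \<open>
  All components of \<open>U - c\<close> except the one containing \<open>a\<close> are collected, so that \<open>U\<close> is split into two
  connected sets: that component, and the union of \<open>c\<close> and its far side.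
\<close>

definition far :: "complex set \<Rightarrow> complex set" where
  "far c = U - c - connected_component_set (U - c) a"

text \<open>
  An essential set has the fixed end on its far side. In place of the end itself, the tails of the crosscuts
  \<open>f\<^sup>m \<circ> \<beta>\<close> are used; they converge to it as \<open>m\<close> grows. The condition does not change when \<open>c\<close> is replaced by its
  image under a symmetry, since symmetries permute the crosscuts \<open>\<beta>\<close>.
\<close>

definition essential :: "complex set \<Rightarrow> bool" where
  "essential c \<longleftrightarrow> connected c \<and> c \<subseteq> U \<inter> ball 0 1 \<and> closed (c \<union> \<Gamma>) \<and>
     (\<forall>\<beta>. xcut \<beta> \<longrightarrow> (\<forall>\<^sub>F m in sequentially. \<forall>\<^sub>F t in at_left 1. (f ^^ m) (\<beta> t) \<in> far c))"

lemma \<Gamma>: "compact \<Gamma>" "closed \<Gamma>" "connected \<Gamma>" "\<Gamma> \<noteq> {}" "\<Gamma> \<subseteq> disk" "proj z \<in> \<Gamma>"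
proof -
  show *: "compact \<Gamma>" "closed \<Gamma>" "connected \<Gamma>" "\<Gamma> \<noteq> {}" "\<Gamma> \<subseteq> disk"
    using basin_complement U_V(7) compact_imp_closed by blast+
  show "proj z \<in> \<Gamma>" by (rule closest_point_in_set[OF *(2,4)])
qed

lemma ray_in: "z \<in> U \<inter> ball 0 1 \<Longrightarrow> t \<in> {0..<1} \<Longrightarrow> ray z t \<in> U \<inter> ball 0 1"
  using segment_to_closest_point(1)[OF \<Gamma>(2,4,5), of z t] by auto

lemma ray_ends: "ray z 0 = z" "ray z 1 = proj z"
  by (simp_all add: linepath_0' linepath_1')

lemma dist_ray: "t \<in> {0..1} \<Longrightarrow> dist z (ray z t) \<le> dist z (proj z)"
proof -
  assume "t \<in> {0..1}"
  then have "ray z t \<in> closed_segment z (proj z)" by (metis linepath_image_01 imageI)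
  then show ?thesis using dist_in_closed_segment by (metis dist_commute)
qed

lemma dist_proj: "dist z (proj z) = infdist z \<Gamma>"
  using setdist_closest_point[OF \<Gamma>(2,4), of z] by (simp add: infdist_eq_setdist)

lemma connected_ray: "connected (ray z ` S)" if "connected S"
  using that by (intro connected_continuous_image continuous_intros)

lemma joined_rays:
  assumes z: "z \<in> U \<inter> ball 0 1" and z': "z' \<in> U \<inter> ball 0 1"
    and seg: "closed_segment z z' \<subseteq> U \<inter> ball 0 1"
    and c: "c = ray z ` {0..<1} \<union> closed_segment z z' \<union> ray z' ` {0..<1}"
  shows "ray z ` {0..1} \<union> closed_segment z z' \<union> ray z' ` {0..1} = insert (proj z) (insert (proj z') c)"
    and "compact (ray z ` {0..1} \<union> closed_segment z z' \<union> ray z' ` {0..1})"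
    and "c \<subseteq> U \<inter> ball 0 1" and "closed (c \<union> \<Gamma>)" and "connected c"
proof -
  let ?K = "ray z ` {0..1} \<union> closed_segment z z' \<union> ray z' ` {0..1}"
  have i1: "{0..1} = insert 1 {0..<1::real}" by auto
  show K: "?K = insert (proj z) (insert (proj z') c)"
    unfolding c i1 by (auto simp: ray_ends)
  show "compact ?K"
    by (intro compact_Un compact_continuous_image continuous_intros compact_segment) auto
  then have "closed (?K \<union> \<Gamma>)"
    using \<Gamma>(2) by (simp add: closed_Un compact_imp_closed)
  moreover have "?K \<union> \<Gamma> = c \<union> \<Gamma>" unfolding K using \<Gamma>(6) by blast
  ultimately show "closed (c \<union> \<Gamma>)" by simp
  show "c \<subseteq> U \<inter> ball 0 1"
    using ray_in[OF z] ray_in[OF z'] seg unfolding c by blast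
  show "connected c"
    unfolding c
  proof (intro connected_Un connected_ray)
    have "z \<in> ray z ` {0..<1}" "z' \<in> ray z' ` {0..<1}" by (force simp: ray_ends image_iff)+
    then show "ray z ` {0..<1} \<inter> closed_segment z z' \<noteq> {}"
      "(ray z ` {0..<1} \<union> closed_segment z z') \<inter> ray z' ` {0..<1} \<noteq> {}" by auto
  qed auto
qed

lemma openin_far:
  assumes "closed (c \<union> \<Gamma>)" "c \<subseteq> U"
  shows "openin (top_of_set disk) (U - c)" "openin (top_of_set disk) (connected_component_set (U - c) a)"
    "locally connected (U - c)"
proof -
  have "U - c = disk \<inter> - (c \<union> \<Gamma>)" using assms(2) U_V(1) by blast
  then show *: "openin (top_of_set disk) (U - c)"
    using assms(1) by (metis openin_open_Int open_Compl)
  show "openin (top_of_set disk) (connected_component_set (U - c) a)"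
    by (rule openin_disk_component[OF *])
  show "locally connected (U - c)"
    by (rule locally_connected_openin_disk[OF *])
qed

lemma boundary_in_component:
  assumes "c \<subseteq> ball 0 1"
  shows "U \<inter> disk_boundary \<subseteq> connected_component_set (U - c) a"
  using assms U_V(8) on_boundary basin_connected(3) by (intro connected_component_maximal) auto

text \<open>
  If \<open>\<alpha>\<close> separates the two ends of \<open>c\<close>, then \<open>c\<close> separates the two ends of \<open>\<alpha>\<close>. Otherwise \<open>\<alpha>\<close> could be rerouted,
  without changing its tail, to avoid \<open>c\<close>. Then \<open>\<alpha>\<close> itself would not separate the two ends of \<open>c\<close>, because these
  are joined by \<open>\<Gamma>\<close> away from the modification.
\<close>

lemma linked_crosscuts:
  assumes \<alpha>: "xcut \<alpha>" and z: "z \<in> U \<inter> ball 0 1" and z': "z' \<in> U \<inter> ball 0 1"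
    and seg: "closed_segment z z' \<subseteq> U \<inter> ball 0 1"
    and c: "c = ray z ` {0..<1} \<union> closed_segment z z' \<union> ray z' ` {0..<1}"
    and ne: "\<alpha> 1 \<noteq> proj z" "\<alpha> 1 \<noteq> proj z'"
    and L: "\<forall>\<^sub>F t in at_left 1. ray z t \<notin> near \<alpha>" and R: "\<exists>\<^sub>F t in at_left 1. ray z' t \<in> near \<alpha>"
  shows "\<forall>\<^sub>F t in at_left 1. \<alpha> t \<in> far c"
proof -
  note A = xcutD[OF \<alpha>]
  define K where "K = ray z ` {0..1} \<union> closed_segment z z' \<union> ray z' ` {0..1}"
  note facts = joined_rays[OF z z' seg c]
  have Keq: "K = insert (proj z) (insert (proj z') c)" and "compact K"
    using facts(1,2) by (simp_all add: K_def)
  note cU = facts(3) and cK = facts(4) and conc = facts(5)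
  let ?B = "connected_component_set (U - c) a"
  have "\<alpha> 1 \<notin> K" using Keq ne A(4) cU by blast
  have cont\<alpha>: "continuous_on {0..1} \<alpha>" using A(2) by (simp add: path_def)
  have "((\<lambda>t. \<alpha> t) \<longlongrightarrow> \<alpha> 1) (at_left 1)"
    using cont\<alpha> by (simp add: continuous_on_Icc_at_leftD)
  then have "\<forall>\<^sub>F t in at_left 1. \<alpha> t \<in> - K"
    using \<open>compact K\<close> \<open>\<alpha> 1 \<notin> K\<close> by (intro topological_tendstoD) (auto simp: compact_imp_closed open_Compl)
  then obtain b where b: "b < 1" "\<And>t. b < t \<Longrightarrow> t < 1 \<Longrightarrow> \<alpha> t \<notin> K"
    unfolding eventually_at_left_field by auto
  define t0 where "t0 = max ((b + 1) / 2) (1/2)"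
  have t0: "0 < t0" "t0 < 1" "b < t0" using b by (auto simp: t0_def max_def)
  have tailK: "\<alpha> t \<notin> K" if "t \<in> {t0..1}" for t
    using that t0 b(2)[of t] \<open>\<alpha> 1 \<notin> K\<close> by (cases "t = 1") auto
  have tail: "\<alpha> ` {t0..<1} \<subseteq> U - c" "connected (\<alpha> ` {t0..<1})"
  proof -
    show "\<alpha> ` {t0..<1} \<subseteq> U - c" using tailK A(11) t0 Keq by fastforce
    show "connected (\<alpha> ` {t0..<1})"
    proof (rule connected_continuous_image)
      show "continuous_on {t0..<1} \<alpha>"
        by (rule continuous_on_subset[OF cont\<alpha>]) (use t0 in auto)
    qed auto
  qed
  have "\<alpha> t0 \<notin> ?B"
  proof
    assume mem: "\<alpha> t0 \<in> ?B"
    have "\<alpha> 0 \<in> ?B"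
      using boundary_in_component[of c] cU A(3) \<sigma> by blast
    moreover have "openin (top_of_set disk) ?B" "connected ?B"
      using openin_far(2)[OF cK] cU by auto
    ultimately obtain g where g: "path g" "path_image g \<subseteq> ?B" "pathstart g = \<alpha> 0" "pathfinish g = \<alpha> t0"
      using path_through_interior[of ?B "\<alpha> 0" "\<alpha> t0"] mem by metis
    let ?M = "path_image g" and ?T = "\<alpha> ` {0..t0} \<union> path_image g"
    have M: "compact ?M" "connected ?M" "\<alpha> 0 \<in> ?M" "\<alpha> t0 \<in> ?M" "?M \<subseteq> U - c"
      using g pathstart_in_path_image[of g] pathfinish_in_path_image[of g] connected_component_subset[of "U - c" a]
      by (auto simp: compact_path_image connected_path_image)
    have "compact (\<alpha> ` {0..t0})"
      using cont\<alpha> t0 by (auto intro!: compact_continuous_image intro: continuous_on_subset)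
    then have T: "compact ?T" using M(1) by (rule compact_Un)
    have TU: "?T \<subseteq> U" using A(11) M(5) t0 by fastforce
    have reach: "\<forall>\<^sub>F s in at_left 1. \<forall>x\<in>{s..1}. ray w x \<notin> ?T" for w
    proof -
      have "((\<lambda>t. ray w t) \<longlongrightarrow> ray w 1) (at_left 1)"
        unfolding linepath_def by (auto intro!: tendsto_eq_intros)
      moreover have "ray w 1 \<notin> ?T" using \<Gamma>(6)[of w] TU ray_ends by auto
      ultimately have "\<forall>\<^sub>F t in at_left 1. ray w t \<in> - ?T"
        using compact_imp_closed[OF T, THEN open_Compl] by (intro topological_tendstoD) blast+
      then obtain b where "b < 1" "\<And>t. b < t \<Longrightarrow> t < 1 \<Longrightarrow> ray w t \<notin> ?T"
        unfolding eventually_at_left_field by auto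
      then have "\<forall>x\<in>{s..1}. ray w x \<notin> ?T" if "b < s" "s < 1" for s
        using that \<open>ray w 1 \<notin> ?T\<close> by (metis atLeastAtMost_iff order_less_le order_less_le_trans)
      then show ?thesis
        using \<open>b < 1\<close> unfolding eventually_at_left_field by blast
    qed
    then obtain s where s: "0 < s" "s < 1" "ray z s \<notin> near \<alpha>" "\<forall>x\<in>{s..1}. ray z x \<notin> ?T"
      using eventually_happens[OF eventually_conj[OF eventually_conj[OF L reach[of z]] eventually_at_left_1]]
        trivial_limit_at_left_real by blast
    have "\<exists>\<^sub>F s in at_left 1. ray z' s \<in> near \<alpha> \<and> (\<forall>x\<in>{s..1}. ray z' x \<notin> ?T) \<and> 0 < s \<and> s < 1"
      by (rule frequently_eventually_frequently[OF R eventually_conj[OF reach[of z'] eventually_at_left_1]])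
    then obtain s' where s': "0 < s'" "s' < 1" "ray z' s' \<in> near \<alpha>" "\<forall>x\<in>{s'..1}. ray z' x \<notin> ?T"
      using frequently_ex by blast
    have uv: "ray z s \<in> c" "ray z' s' \<in> c" using s s' unfolding c by auto
    have "connected_component (- ?T) (ray z s) (ray z' s')"
      unfolding connected_component_def
    proof (intro exI conjI)
      let ?P = "ray z ` {s..1} \<union> \<Gamma> \<union> ray z' ` {s'..1}"
      have "ray z 1 \<in> ray z ` {s..1}" "ray z' 1 \<in> ray z' ` {s'..1}"
        by (rule imageI, use s s' in simp)+
      then have p: "proj z \<in> ray z ` {s..1}" "proj z' \<in> ray z' ` {s'..1}"
        unfolding ray_ends .
      have "connected (ray z ` {s..1} \<union> \<Gamma>)"
        by (rule connected_Un_common_point[OF connected_ray[OF connected_Icc] \<Gamma>(3) p(1) \<Gamma>(6)])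
      then show "connected ?P"
        by (rule connected_Un_common_point[OF _ connected_ray[OF connected_Icc] UnI2[OF \<Gamma>(6)] p(2)])
      have "ray z ` {s..1} \<inter> ?T = {}" "ray z' ` {s'..1} \<inter> ?T = {}"
        using s(4) s'(4) by (simp_all only: disjoint_iff) (auto simp del: Un_iff)
      moreover have "\<Gamma> \<inter> ?T = {}" using TU by (simp only: disjoint_iff) blast
      ultimately show "?P \<subseteq> - ?T" by (simp only: Un_subset_iff disjoint_eq_subset_Compl)
      show "ray z s \<in> ?P" "ray z' s' \<in> ?P" using s s' by auto
    qed
    note conn = this
    have "connected_component (ball 0 1 - \<Gamma> - path_image \<alpha>) (ray z s) (ray z' s')"
    proof (rule reroute_initial_part[OF \<Gamma>(1,5) A(1) _ A(10) _ _ M(1,2) _ M(4) conc _ _ _ uv conn])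
      show "pathstart \<alpha> \<in> disk_boundary" "pathstart \<alpha> \<in> ?M"
        using A(3) \<sigma>(2) M(3) by (auto simp: pathstart_def)
      show "\<alpha> t \<notin> \<Gamma>" if "t \<in> {0..<1}" for t using A(11)[OF that] by blast
      show "t0 \<in> {0<..<1}" using t0 by simp
      show "c \<subseteq> ball 0 1 - \<Gamma>" using cU by blast
      show "c \<inter> \<alpha> ` {t0..1} = {}" using tailK unfolding Keq by blast
      show "c \<inter> ?M = {}" using M(5) by blast
    qed
    then obtain P where P: "connected P" "P \<subseteq> ball 0 1 - \<Gamma> - path_image \<alpha>" "ray z s \<in> P" "ray z' s' \<in> P"
      unfolding connected_component_def by blast
    have "P \<subseteq> U - path_image \<alpha>" using P(2) by auto
    then have "P \<subseteq> near \<alpha>" using connected_meets_near[OF P(1)] P(4) s'(3) by blast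
    then show False using P(3) s(3) by blast
  qed
  have "\<alpha> ` {t0..<1} \<inter> ?B = {}"
  proof (rule ccontr)
    assume "\<alpha> ` {t0..<1} \<inter> ?B \<noteq> {}"
    then have "\<alpha> ` {t0..<1} \<subseteq> ?B"
      using connected_component_overlap[OF tail(2,1)] by blast
    moreover have "\<alpha> t0 \<in> \<alpha> ` {t0..<1}" using t0 by auto
    ultimately show False using \<open>\<alpha> t0 \<notin> ?B\<close> by blast
  qed
  then have "\<alpha> t \<in> far c" if "t0 < t" "t < 1" for t
  proof -
    have "\<alpha> t \<in> \<alpha> ` {t0..<1}" using that by simp
    then show ?thesis
      using tail(1) \<open>\<alpha> ` {t0..<1} \<inter> ?B = {}\<close> unfolding far_def by blast
  qed
  then show ?thesis
    unfolding eventually_at_left_field using t0(2) by blast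
qed

text \<open>
  The witness that \<open>z\<close> is to the left lies before \<open>f\<^sup>m \<circ> \<beta>\<close> for large \<open>m\<close>, so that \<open>f\<^sup>m \<circ> \<beta>\<close> separates the left end of \<open>c\<close>
  from the other one.
\<close>

lemma essential_crosscut:
  assumes "left z" "\<not> left z'" and z: "z \<in> U \<inter> ball 0 1" and z': "z' \<in> U \<inter> ball 0 1"
    and seg: "closed_segment z z' \<subseteq> U \<inter> ball 0 1"
    and c: "c = ray z ` {0..<1} \<union> closed_segment z z' \<union> ray z' ` {0..<1}"
  shows "essential c"
proof -
  obtain \<gamma> where \<gamma>: "xcut \<gamma>" "\<forall>\<^sub>F t in at_left 1. ray z t \<notin> near \<gamma>"
    using assms(1) unfolding left_def by blast
  note facts = joined_rays[OF z z' seg c]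
  have "\<forall>\<^sub>F m in sequentially. \<forall>\<^sub>F t in at_left 1. (f ^^ m) (\<beta> t) \<in> far c" if \<beta>: "xcut \<beta>" for \<beta>
    using xcut_eventually_beyond[OF \<gamma>(1) \<beta>] xcut_end_eventually_ne[OF \<beta>, of "proj z"]
      xcut_end_eventually_ne[OF \<beta>, of "proj z'"]
  proof eventually_elim
    case (elim m)
    have x: "xcut ((f ^^ m) \<circ> \<beta>)" by (rule xcut_pow[OF \<beta>])
    have "\<forall>\<^sub>F t in at_left 1. ((f ^^ m) \<circ> \<beta>) t \<in> far c"
    proof (rule linked_crosscuts[OF x z z' seg c])
      show "((f ^^ m) \<circ> \<beta>) 1 \<noteq> proj z" "((f ^^ m) \<circ> \<beta>) 1 \<noteq> proj z'" using elim by auto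
      show "\<forall>\<^sub>F t in at_left 1. ray z t \<notin> near ((f ^^ m) \<circ> \<beta>)"
        using \<gamma>(2) by eventually_elim (use elim(1) in blast)
      show "\<exists>\<^sub>F t in at_left 1. ray z' t \<in> near ((f ^^ m) \<circ> \<beta>)"
        using assms(2) x elim(3) unfolding left_def frequently_def by auto
    qed
    then show ?case by simp
  qed
  then show ?thesis using facts(3-5) unfolding essential_def by blast
qed

lemma ray_in_ball:
  assumes "dist z (proj z) < e" "t \<in> {0..1}"
  shows "ray z t \<in> ball z e"
  using dist_ray[OF assms(2), of z] assms(1) by simp

lemma dist_proj_le: "y \<in> \<Gamma> \<Longrightarrow> dist z (proj z) \<le> dist z y"
  using closest_point_le[OF \<Gamma>(2)] .

text \<open>
  The end point of a crosscut \<open>\<alpha>\<close> is cut off by \<open>f\<^sup>m \<circ> \<alpha>\<close> for large \<open>m\<close>, hence so are all ends close to it.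
\<close>

lemma left_exists:
  assumes "e > 0"
  shows "\<exists>z. z \<in> U \<inter> ball 0 1 \<and> infdist z \<Gamma> < e \<and> left z"
proof -
  obtain \<alpha> where \<alpha>: "xcut \<alpha>" using xcut_exists by blast
  note A = xcutD[OF \<alpha>]
  obtain m where m: "path_image \<alpha> \<inter> path_image ((f ^^ m) \<circ> \<alpha>) = {}" "path_image \<alpha> \<inter> near ((f ^^ m) \<circ> \<alpha>) = {}"
    using eventually_happens[OF xcut_eventually_beyond[OF \<alpha> \<alpha>]] by auto
  define \<beta> where "\<beta> = (f ^^ m) \<circ> \<alpha>"
  have \<beta>: "xcut \<beta>" unfolding \<beta>_def by (rule xcut_pow[OF \<alpha>])
  note B = xcutD[OF \<beta>]
  have dis: "path_image \<alpha> \<inter> path_image \<beta> = {}" "path_image \<alpha> \<inter> near \<beta> = {}"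
    using m unfolding \<beta>_def by auto
  have y: "\<alpha> 1 \<notin> path_image \<beta>" using dis(1) A(13)[of 1] by auto
  have "open (- path_image \<beta>)" using B(8) by (simp add: compact_imp_closed open_Compl)
  then obtain d where d: "d > 0" "ball (\<alpha> 1) d \<subseteq> - path_image \<beta>"
    using y open_contains_ball by (metis ComplI)
  have "((\<lambda>t. \<alpha> t) \<longlongrightarrow> \<alpha> 1) (at_left 1)"
    using A(2) by (simp add: path_def continuous_on_Icc_at_leftD)
  then have ev: "\<forall>\<^sub>F t in at_left 1. dist (\<alpha> t) (\<alpha> 1) < min (d / 3) e"
    using d assms by (intro tendstoD) auto
  obtain t where t: "0 < t" "t < 1" "dist (\<alpha> t) (\<alpha> 1) < min (d / 3) e"
    using eventually_happens[OF eventually_conj[OF ev eventually_at_left_1]] trivial_limit_at_left_real by blast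
  define z where "z = \<alpha> t"
  have z: "z \<in> U \<inter> ball 0 1" using A(10)[of t] A(11)[of t] t by (simp add: z_def)
  have dz: "dist z (\<alpha> 1) < d / 3" "dist z (\<alpha> 1) < e" using t(3) by (simp_all add: z_def)
  have dp: "dist z (proj z) \<le> dist z (\<alpha> 1)" by (rule dist_proj_le[OF A(4)])
  have "infdist z \<Gamma> < e" using dp dz(2) dist_proj by (metis le_less_trans)
  moreover have "left z"
    unfolding left_def
  proof (intro exI conjI)
    show "xcut \<beta>" by (rule \<beta>)
    have sub: "ray z s \<in> ball (\<alpha> 1) d" if "s \<in> {0..1}" for s
    proof -
      have "dist (\<alpha> 1) (ray z s) \<le> dist (\<alpha> 1) z + dist z (ray z s)" by (rule dist_triangle)
      also have "\<dots> < d / 3 + d / 3"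
        using dz(1) dp dist_ray[OF that, of z] by (simp add: dist_commute)
      finally show ?thesis using d(1) by simp
    qed
    have "\<beta> 1 \<in> path_image \<beta>" by (rule B(13)) simp
    then show "\<beta> 1 \<noteq> proj z" using sub[of 1] d(2) ray_ends(2)[of z] by auto
    have c: "connected (ray z ` {0..<1})" by (rule connected_ray) simp
    have "ray z ` {0..<1} \<subseteq> U - path_image \<beta>"
      using ray_in[OF z] sub d(2) by fastforce
    moreover have "z \<in> ray z ` {0..<1}" by (force simp: ray_ends image_iff)
    moreover have "z \<notin> near \<beta>" using dis(2) A(13)[of t] t unfolding z_def by auto
    ultimately have n: "ray z ` {0..<1} \<inter> near \<beta> = {}"
      using connected_meets_near[OF c] by blast
    have "ray z s \<notin> near \<beta>" if "0 < s" "s < 1" for s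
    proof -
      have "ray z s \<in> ray z ` {0..<1}" using that by simp
      then show ?thesis using n by blast
    qed
    then show "\<forall>\<^sub>F s in at_left 1. ray z s \<notin> near \<beta>"
      unfolding eventually_at_left_field by (intro exI[of _ 0]) auto
  qed
  ultimately show ?thesis using z by blast
qed

text \<open>
  Near the other end \<open>r2\<close> of the boundary arc of \<open>U\<close>, the basin of \<open>r2\<close> under the inverse map is disjoint
  from \<open>V\<close>, hence from all crosscuts.
\<close>

lemma not_left_exists:
  assumes "e > 0"
  shows "\<exists>z. z \<in> U \<inter> ball 0 1 \<and> infdist z \<Gamma> < e \<and> \<not> left z"
proof -
  let ?V2 = "basin f' r2"
  have disV: "V \<inter> ?V2 = {}" by (rule basin_disjoint[OF distinct(3)])
  obtain G where G: "open G" "?V2 = disk \<inter> G"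
    using rep2.basin_openin openin_open by blast
  moreover have "r2 \<in> G" using rep2.attractor_in_basin G(2) by blast
  ultimately obtain d0 where d0: "d0 > 0" "ball r2 d0 \<subseteq> G"
    using open_contains_ball by blast
  define d where "d = min d0 e"
  have d: "0 < d" "d \<le> e" "ball r2 d \<inter> disk \<subseteq> ?V2" using d0 assms G by (auto simp: d_def)
  obtain \<eta> where \<eta>: "\<eta> > 0" "\<And>s. \<bar>s - t2\<bar> < \<eta> \<Longrightarrow> dist (cis s) (cis t2) < d / 4"
    using cis_close[of "d / 4" t2] d by auto
  define x where "x = min (\<eta> / 2) ((t2 - ta) / 2)"
  have "x \<le> \<eta> / 2" "x \<le> (t2 - ta) / 2" "0 < x"
    using \<eta>(1) order unfolding x_def by (simp_all only: min.cobounded1 min.cobounded2 min_less_iff_conj) auto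
  then have x: "0 < x" "x < \<eta>" "ta < t2 - x" using \<eta>(1) order by auto
  define w where "w = cis (t2 - x)"
  have wr: "dist w r2 < d / 4" using \<eta>(2)[of "t2 - x"] x by (simp add: w_def points)
  have wU: "w \<in> U" using arcs_in_basin(2) x by (auto simp: w_def)
  obtain H where H: "open H" "U = disk \<inter> H"
    using basin_openin openin_open by blast
  then obtain \<delta>0 where \<delta>0: "\<delta>0 > 0" "ball w \<delta>0 \<subseteq> H"
    using wU open_contains_ball by blast
  define \<delta> where "\<delta> = min (\<delta>0 / 2) (min (d / 4) (1/2))"
  have \<delta>: "0 < \<delta>" "\<delta> < \<delta>0" "\<delta> \<le> d / 4" "\<delta> < 1" using \<delta>0 d(1) by (auto simp: \<delta>_def)
  define z where "z = of_real (1 - \<delta>) * w"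
  have nw: "norm w = 1" by (simp add: w_def)
  have nz: "norm z = 1 - \<delta>" using \<delta> nw unfolding z_def norm_mult by (simp del: of_real_diff)
  have "w - z = of_real \<delta> * w" by (simp add: z_def algebra_simps)
  then have dwz: "dist w z = \<delta>" using \<delta> nw by (simp add: dist_norm norm_mult)
  have seg: "closed_segment w z \<subseteq> disk \<inter> ball w \<delta>0" "closed_segment w z \<subseteq> ball r2 d"
  proof -
    have "w \<in> disk" "z \<in> disk" using nw nz \<delta> by auto
    moreover have "w \<in> ball w \<delta>0" "z \<in> ball w \<delta>0" using \<delta> dwz \<delta>0 by auto
    ultimately show "closed_segment w z \<subseteq> disk \<inter> ball w \<delta>0"
      by (intro closed_segment_subset convex_Int) auto
    have "dist r2 z \<le> dist r2 w + dist w z" by (rule dist_triangle)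
    then have "w \<in> ball r2 d" "z \<in> ball r2 d" using wr dwz \<delta> d(1) by (auto simp: dist_commute)
    then show "closed_segment w z \<subseteq> ball r2 d" by (intro closed_segment_subset) auto
  qed
  have segU: "closed_segment w z \<subseteq> U" using seg(1) \<delta>0(2) H(2) by blast
  have z: "z \<in> U \<inter> ball 0 1" using segU nz \<delta> by auto
  have "dist z r2 \<le> dist z w + dist w r2" by (rule dist_triangle)
  then have zr: "dist z r2 < d / 2" using wr dwz \<delta> by (simp add: dist_commute)
  have "r2 \<in> \<Gamma>" using U_V(5) rep2.fixed by simp
  then have dp: "dist z (proj z) < d / 2" using dist_proj_le[of r2 z] zr by simp
  then have "infdist z \<Gamma> < e" using dist_proj[of z] d by simp
  moreover have "\<not> left z"
  proof
    assume "left z"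
    then obtain \<gamma> where \<gamma>: "xcut \<gamma>" "\<forall>\<^sub>F t in at_left 1. ray z t \<notin> near \<gamma>"
      unfolding left_def by blast
    let ?I = "cis ` {ta..t2 - x}" and ?R = "ray z ` {0..<1}"
    have I: "connected ?I" "?I \<subseteq> U"
    proof -
      show "connected ?I" by (intro connected_continuous_image continuous_intros connected_Icc)
      have "{ta..t2 - x} \<subseteq> {ta..<t2}" using x by auto
      then show "?I \<subseteq> U" using arcs_in_basin(2) by blast
    qed
    have IV: "?I \<inter> V = {}"
    proof (rule ccontr)
      assume "?I \<inter> V \<noteq> {}"
      then obtain s where s: "s \<in> {ta..t2 - x}" "cis s \<in> V" by blast
      then have "cis s \<in> cis ` {t2 - 2 * pi<..<ta}" using V_boundary by auto
      then obtain u where "u \<in> {t2 - 2 * pi<..<ta}" "cis s = cis u" by blast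
      then show False using cis_inj[of s u] s(1) x by auto
    qed
    have RV2: "?R \<subseteq> ?V2"
    proof
      fix y assume "y \<in> ?R"
      then obtain t where t: "t \<in> {0..<1}" "y = ray z t" by blast
      have "dist r2 y \<le> dist r2 z + dist z y" by (rule dist_triangle)
      also have "\<dots> < d / 2 + d / 2"
        using zr ray_in_ball[OF dp, of t] t by (intro add_strict_mono) (auto simp: dist_commute)
      finally have "y \<in> ball r2 d" by simp
      moreover have "y \<in> disk" using ray_in[OF z t(1)] t(2) by auto
      ultimately show "y \<in> ?V2" using d(3) by blast
    qed
    have RU: "?R \<subseteq> U" using ray_in[OF z] by blast
    have segV2: "closed_segment w z \<subseteq> ?V2" using seg d(3) by blast
    let ?S = "(?I \<union> closed_segment w z) \<union> ?R"
    have zR: "z \<in> ?R" by (force simp: ray_ends image_iff)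
    have wI: "w \<in> ?I" using x by (auto simp: w_def)
    have "connected (?I \<union> closed_segment w z)"
      by (rule connected_Un_common_point[OF I(1) connected_segment(1) wI ends_in_segment(1)])
    moreover have "connected ?R" by (rule connected_ray) simp
    ultimately have "connected ?S"
      by (rule connected_Un_common_point[OF _ _ UnI2[OF ends_in_segment(2)] zR])
    moreover have "?I \<subseteq> U - path_image \<gamma>"
      using xcutD(5)[OF \<gamma>(1)] I(2) IV by blast
    moreover have "closed_segment w z \<subseteq> U - path_image \<gamma>"
      using xcutD(5)[OF \<gamma>(1)] segU segV2 disV by blast
    moreover have "?R \<subseteq> U - path_image \<gamma>"
      using xcutD(5)[OF \<gamma>(1)] RU RV2 disV by blast
    moreover have "a \<in> ?I" using x points by auto
    ultimately have S: "?S \<subseteq> near \<gamma>"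
      using near(3)[OF \<gamma>(1)] by (intro connected_meets_near) blast+
    obtain t where t: "0 < t" "t < 1" "ray z t \<notin> near \<gamma>"
      using eventually_happens[OF eventually_conj[OF \<gamma>(2) eventually_at_left_1]] trivial_limit_at_left_real by blast
    then have "ray z t \<in> ?R" by simp
    then show False using S t(3) by blast
  qed
  ultimately show ?thesis using z by blast
qed

text \<open>
  Being to the left cannot be locally constant on the connected collar of \<open>\<Gamma>\<close>, so there are two
  arbitrarily close points \<open>z\<close> and \<open>y\<close> in the collar exactly one of which is to the left.
\<close>

lemma small_essential_exists:
  assumes "\<epsilon> > 0"
  obtains c z p where "essential c" "c \<subseteq> ball z \<epsilon>" "z \<in> c" "p \<in> \<Gamma>" "p \<in> ball z \<epsilon>"
proof -
  (* Points of the crosscut constructed below have distance less than 3 * e from z. *)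
  define e where "e = \<epsilon> / 4"
  have e: "e > 0" "4 * e = \<epsilon>" using assms by (auto simp: e_def)
  let ?Co = "{z \<in> ball 0 1 - \<Gamma>. infdist z \<Gamma> < e}"
  have bU: "ball 0 1 - \<Gamma> = U \<inter> ball 0 1" by auto
  obtain u where u: "u \<in> U \<inter> ball 0 1" "infdist u \<Gamma> < e" "left u"
    using left_exists[OF e(1)] by blast
  obtain v where v: "v \<in> U \<inter> ball 0 1" "infdist v \<Gamma> < e" "\<not> left v"
    using not_left_exists[OF e(1)] by blast
  let ?Z = "{z \<in> disk_boundary. e \<le> infdist z \<Gamma>}"
  have "closed {z. e \<le> infdist z \<Gamma>}" by (intro closed_Collect_le continuous_intros)
  then have "compact (disk_boundary \<inter> {z. e \<le> infdist z \<Gamma>})" by (rule compact_Int_closed[OF compact_sphere])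
  moreover have "disk_boundary \<inter> {z. e \<le> infdist z \<Gamma>} = ?Z" by auto
  ultimately have "compact ?Z" by simp
  moreover have "?Z \<subseteq> U \<inter> disk_boundary"
  proof
    fix z assume z: "z \<in> ?Z"
    then have ez: "e \<le> infdist z \<Gamma>" by simp
    have "z \<notin> \<Gamma>"
    proof
      assume "z \<in> \<Gamma>"
      then have "infdist z \<Gamma> = 0" by (rule infdist_zero)
      then show False using ez e(1) by linarith
    qed
    moreover have "z \<in> disk" "z \<in> disk_boundary" using z by auto
    ultimately show "z \<in> U \<inter> disk_boundary" by blast
  qed
  ultimately obtain I where I: "compact I" "connected I" "?Z \<subseteq> I" "I \<subseteq> U \<inter> disk_boundary"
    by (rule basin_boundary_compact_subset)
  have "connected_component ?Co u v"
  proof (rule connected_collar[OF \<Gamma>(1,3,4,5) I(1,2) _ I(3)])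
    show "I \<subseteq> disk_boundary - \<Gamma>" using I(4) by blast
    show "connected (ball 0 1 - \<Gamma>)" unfolding bU by (rule basin_connected(2))
  qed (use u v bU in auto)
  then obtain T where T: "connected T" "T \<subseteq> ?Co" "u \<in> T" "v \<in> T"
    unfolding connected_component_def by blast
  have "\<exists>z\<in>T. \<not> (\<forall>\<^sub>F y in at z within T. left z = left y)"
    using connected_local_const[OF T(1,3,4), of left] u(3) v(3) by blast
  then obtain z where z: "z \<in> T" "\<not> (\<forall>\<^sub>F y in at z within T. left z = left y)" by blast
  have zU: "z \<in> U \<inter> ball 0 1" "infdist z \<Gamma> < e" using z(1) T(2) by auto
  have "open (ball 0 1 - \<Gamma>)" using \<Gamma>(2) by auto
  then obtain \<eta>0 where \<eta>0: "\<eta>0 > 0" "ball z \<eta>0 \<subseteq> ball 0 1 - \<Gamma>"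
    using zU(1) bU open_contains_ball by (metis (no_types, lifting))
  define \<eta> where "\<eta> = min \<eta>0 e"
  have \<eta>: "\<eta> > 0" "\<eta> \<le> e" "ball z \<eta> \<subseteq> U \<inter> ball 0 1" using \<eta>0 e bU by (auto simp: \<eta>_def)
  have "\<exists>y\<in>T. y \<in> ball z \<eta> \<and> left z \<noteq> left y"
  proof (rule ccontr)
    assume "\<not> ?thesis"
    then have "\<forall>\<^sub>F y in at z within T. left z = left y"
      unfolding eventually_at using \<eta>(1) by (intro exI[of _ \<eta>]) (auto simp: dist_commute)
    then show False using z(2) by blast
  qed
  then obtain y where y: "y \<in> T" "y \<in> ball z \<eta>" "left z \<noteq> left y" by blast
  have yU: "y \<in> U \<inter> ball 0 1" "infdist y \<Gamma> < e" using y(1) T(2) by auto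
  have seg: "closed_segment z y \<subseteq> ball z \<eta>"
    using y(2) \<eta>(1) by (intro closed_segment_subset) auto
  have dy: "dist z y < e" using y(2) \<eta>(2) by simp
  define c where "c = ray z ` {0..<1} \<union> closed_segment z y \<union> ray y ` {0..<1}"
  have c': "c = ray y ` {0..<1} \<union> closed_segment y z \<union> ray z ` {0..<1}"
    unfolding c_def closed_segment_commute[of z y] by blast
  have "essential c"
  proof (cases "left z")
    case True
    with y(3) have "\<not> left y" by blast
    show ?thesis
      by (rule essential_crosscut[OF True \<open>\<not> left y\<close> zU(1) yU(1) _ c_def]) (use seg \<eta>(3) in blast)
  next
    case False
    with y(3) have "left y" by blast
    show ?thesis
      by (rule essential_crosscut[OF \<open>left y\<close> False yU(1) zU(1) _ c'])
        (use seg \<eta>(3) closed_segment_commute[of y z] in blast)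
  qed
  moreover have "c \<subseteq> ball z \<epsilon>"
  proof
    fix x assume "x \<in> c"
    then consider t where "t \<in> {0..<1}" "x = ray z t" | "x \<in> closed_segment z y" | t where "t \<in> {0..<1}" "x = ray y t"
      unfolding c_def by blast
    then have "dist z x < 4 * e"
    proof cases
      case 1
      then show ?thesis using dist_ray[of t z] dist_proj[of z] zU(2) e(1) by simp
    next
      case 2
      then have "x \<in> ball z \<eta>" using seg by blast
      then have "dist z x < \<eta>" by simp
      then show ?thesis using \<eta>(2) e(1) by linarith
    next
      case 3
      then have "dist y x < e" using dist_ray[of t y] dist_proj[of y] yU(2) by simp
      then show ?thesis using dist_triangle[of z x y] dy e(1) by linarith
    qed
    then show "x \<in> ball z \<epsilon>" using e(2) by simp
  qed
  moreover have "z \<in> c" unfolding c_def by auto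
  moreover have "proj z \<in> ball z \<epsilon>" using dist_proj[of z] zU(2) e by simp
  ultimately show ?thesis using that \<Gamma>(6) by blast
qed

section \<open>Images of essential crosscuts\<close>

lemma far_nonempty: "essential c \<Longrightarrow> far c \<noteq> {}"
proof -
  assume c: "essential c"
  obtain \<beta> where "xcut \<beta>" using xcut_exists by blast
  then have "\<forall>\<^sub>F m in sequentially. \<forall>\<^sub>F t in at_left 1. (f ^^ m) (\<beta> t) \<in> far c"
    using c by (simp add: essential_def)
  then obtain m where "\<forall>\<^sub>F t in at_left 1. (f ^^ m) (\<beta> t) \<in> far c"
    using eventually_happens by force
  then show ?thesis
    using eventually_happens[of _ "at_left (1::real)"] trivial_limit_at_left_real by blast
qed

lemma essential_meets_xcuts:
  assumes c: "essential c" and \<beta>: "xcut \<beta>"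
  shows "\<forall>\<^sub>F m in sequentially. path_image ((f ^^ m) \<circ> \<beta>) \<inter> c \<noteq> {}"
proof -
  have "\<forall>\<^sub>F m in sequentially. \<forall>\<^sub>F t in at_left 1. (f ^^ m) (\<beta> t) \<in> far c"
    using c \<beta> by (simp add: essential_def)
  then show ?thesis
  proof eventually_elim
    case (elim m)
    define \<delta> where "\<delta> = (f ^^ m) \<circ> \<beta>"
    have "xcut \<delta>" unfolding \<delta>_def by (rule xcut_pow[OF \<beta>])
    note D = xcutD[OF this]
    obtain t where t: "0 < t" "t < 1" "\<delta> t \<in> far c"
      using eventually_happens[OF eventually_conj[OF elim eventually_at_left_1]] trivial_limit_at_left_real
      by (auto simp: \<delta>_def)
    have con: "connected (\<delta> ` {0..t})"
    proof (rule connected_continuous_image)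
      show "continuous_on {0..t} \<delta>"
        by (rule continuous_on_subset[OF D(2)[unfolded path_def]]) (use t in auto)
    qed simp
    have sub: "\<delta> ` {0..t} \<subseteq> U" using D(11) t by auto
    have start: "\<delta> 0 \<in> connected_component_set (U - c) a"
      using boundary_in_component[of c] c D(3) \<sigma> unfolding essential_def by blast
    have "\<delta> ` {0..t} \<inter> c \<noteq> {}"
    proof
      assume "\<delta> ` {0..t} \<inter> c = {}"
      then have "\<delta> ` {0..t} \<subseteq> U - c" using sub by blast
      then have "\<delta> ` {0..t} \<subseteq> connected_component_set (U - c) a"
        by (rule connected_component_overlap[OF con _ _ start]) (use t in simp)
      moreover have "\<delta> t \<in> \<delta> ` {0..t}" using t by simp
      ultimately show False using t(3) unfolding far_def by blast
    qed
    moreover have "\<delta> ` {0..t} \<subseteq> path_image \<delta>" using t by (auto simp: path_image_def)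
    ultimately show ?case unfolding \<delta>_def by blast
  qed
qed

lemma essential_meets_V: "essential c \<Longrightarrow> c \<inter> V \<noteq> {}"
proof -
  assume c: "essential c"
  obtain \<beta> where \<beta>: "xcut \<beta>" using xcut_exists by blast
  obtain m where "path_image ((f ^^ m) \<circ> \<beta>) \<inter> c \<noteq> {}"
    using eventually_happens[OF essential_meets_xcuts[OF c \<beta>]] by auto
  then show ?thesis using xcutD(5)[OF xcut_pow[OF \<beta>, of m]] by blast
qed

lemma essential_closure_disk: "essential c \<Longrightarrow> compact (closure c)" "essential c \<Longrightarrow> closure c \<subseteq> disk"
proof -
  assume "essential c"
  then have "c \<subseteq> disk" using U_V(1) by (auto simp: essential_def)
  then show "closure c \<subseteq> disk" by (simp add: closure_minimal)
  then show "compact (closure c)" by (metis bounded_cball bounded_subset closed_closure compact_eq_bounded_closed)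
qed

text \<open>
  An essential set meets \<open>f\<^sup>m \<circ> \<beta>\<close> for all large \<open>m\<close>. Applying the inverse of \<open>f\<^sup>m\<close> would bring a compact subset
  of \<open>V\<close> arbitrarily close to \<open>r\<close>, away from \<open>\<beta>\<close>. This keeps essential sets from shrinking to \<open>r\<close>.
\<close>

lemma essential_not_in_V:
  assumes c: "essential c"
  shows "\<not> closure c \<subseteq> V"
proof
  assume sub: "closure c \<subseteq> V"
  obtain \<beta> where \<beta>: "xcut \<beta>" using xcut_exists by blast
  note B = xcutD[OF \<beta>]
  have ev: "\<forall>\<^sub>F m in sequentially. (f' ^^ m) ` closure c \<inter> path_image \<beta> = {}"
    by (rule compact_avoids_point_eventually[OF essential_closure_disk(1)[OF c] sub B(8,6)])
  then obtain m where m: "(f' ^^ m) ` closure c \<inter> path_image \<beta> = {}" "path_image ((f ^^ m) \<circ> \<beta>) \<inter> c \<noteq> {}"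
    using eventually_happens[OF eventually_conj[OF ev essential_meets_xcuts[OF c \<beta>]]] by auto
  have "closure c \<inter> (f ^^ m) ` path_image \<beta> = {}"
    using pow_image_inverse[OF essential_closure_disk(2)[OF c] B(7)] m(1) by blast
  then show False using m(2) closure_subset[of c] unfolding path_image_compose by blast
qed

text \<open>
  The component of \<open>a\<close> together with \<open>c\<close> is connected and misses \<open>h ` c\<close>, so it stays on the side of \<open>a\<close> under
  the inverse of \<open>h\<close>.
\<close>

lemma symmetry_moves_to_far_side:
  assumes h: "symmetry h h'" and c: "essential c" and dis: "h ` c \<inter> c = {}"
    and B: "h ` c \<inter> connected_component_set (U - c) a = {}"
  shows "h ` (c \<union> far c) \<subseteq> far c"
proof -
  interpret h: disk_homeo h h' by (rule symmetry_homeo[OF h])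
  let ?B = "connected_component_set (U - c) a"
  have cD: "connected c" "c \<subseteq> U" "c \<subseteq> disk" "closed (c \<union> \<Gamma>)" "a \<notin> c"
    using c U_V(1) on_boundary by (auto simp: essential_def)
  have BU: "?B \<subseteq> U - c" by (rule connected_component_subset)
  have "connected (c \<union> ?B)"
    by (rule connected_Un_component[OF basin_connected(1) cD(1,2) openin_far(3)[OF cD(4,2)]])
  moreover have sub: "c \<union> ?B \<subseteq> disk" using BU cD U_V(1) by blast
  ultimately have con: "connected (h' ` (c \<union> ?B))"
    by (rule disk_homeo.connected_image[OF h.inverse])
  have aB: "a \<in> ?B" using U_V(8) cD(5) by (simp add: connected_component_refl)
  have h'a: "h' a = a" using symmetry_fixes(1)[OF symmetry_inverse[OF h]] .
  have "h' ` (c \<union> ?B) \<subseteq> U - c"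
  proof
    fix y assume "y \<in> h' ` (c \<union> ?B)"
    then obtain x where x: "x \<in> c \<union> ?B" "y = h' x" by blast
    have xd: "x \<in> disk" "x \<in> U" using x(1) sub BU cD(2) by blast+
    have "y \<in> U" using symmetry_basins(1)[OF symmetry_inverse[OF h] xd(1)] xd(2) x(2) by simp
    moreover have "y \<notin> c"
    proof
      assume "y \<in> c"
      then have "h y \<in> h ` c" by blast
      moreover have "h y = x" using h.inv(2)[OF xd(1)] x(2) by simp
      ultimately show False using x(1) dis B by blast
    qed
    ultimately show "y \<in> U - c" by blast
  qed
  moreover have "a \<in> h' ` (c \<union> ?B)" using aB h'a by (metis UnI2 imageI)
  ultimately have in_B: "h' ` (c \<union> ?B) \<subseteq> ?B"
    using connected_component_overlap[OF con] aB by blast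
  show ?thesis
  proof
    fix y assume "y \<in> h ` (c \<union> far c)"
    then obtain x where x: "x \<in> c \<union> far c" "y = h x" by blast
    have xU: "x \<in> U" "x \<in> disk" "x \<notin> ?B" using x(1) cD U_V(1) BU by (auto simp: far_def)
    have "y \<in> U" using symmetry_basins(1)[OF h xU(2)] xU(1) x(2) by simp
    moreover have "y \<notin> c \<union> ?B"
    proof
      assume "y \<in> c \<union> ?B"
      then have "h' y \<in> ?B" using in_B by blast
      then show False using h.inv(1)[OF xU(2)] x(2) xU(3) by simp
    qed
    ultimately show "y \<in> far c" by (simp add: far_def)
  qed
qed

text \<open>
  If neither inclusion held, the far sides of \<open>c\<close> and \<open>h ` c\<close> would be disjoint. But both contain tails of
  crosscuts: \<open>f\<^sup>m \<circ> h \<circ> \<beta> = h \<circ> f\<^sup>m \<circ> \<beta>\<close> ends on the far side of \<open>c\<close> as well as on that of \<open>h ` c\<close> for large \<open>m\<close>.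
\<close>

lemma far_sides_nested:
  assumes h: "symmetry h h'" and c: "essential c" and dis: "h ` c \<inter> c = {}"
  shows "h ` (c \<union> far c) \<subseteq> far c \<or> h' ` (c \<union> far c) \<subseteq> far c"
proof (rule ccontr)
  interpret h: disk_homeo h h' by (rule symmetry_homeo[OF h])
  let ?B = "connected_component_set (U - c) a"
  have cD: "connected c" "c \<subseteq> U" "c \<subseteq> disk" "closed (c \<union> \<Gamma>)"
    using c U_V(1) by (auto simp: essential_def)
  have BU: "?B \<subseteq> U - c" by (rule connected_component_subset)
  have dis': "h' ` c \<inter> c = {}"
  proof (rule ccontr)
    assume "h' ` c \<inter> c \<noteq> {}"
    then obtain x where "x \<in> c" "h' x \<in> c" by blast
    moreover have "h (h' x) = x" using h.inv(2) \<open>x \<in> c\<close> cD(3) by blast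
    ultimately show False using dis by (metis IntI empty_iff imageI)
  qed
  assume "\<not> ?thesis"
  then have meets: "h ` c \<inter> ?B \<noteq> {}" "h' ` c \<inter> ?B \<noteq> {}"
    using symmetry_moves_to_far_side[OF h c dis] symmetry_moves_to_far_side[OF symmetry_inverse[OF h] c dis']
    by blast+
  have "h ` c \<subseteq> U - c"
    using dis symmetry_basins(1)[OF h] cD(2,3) by blast
  then have hcB: "h ` c \<subseteq> ?B"
    using connected_component_overlap[OF h.connected_image[OF cD(1,3)]] meets(1) by blast
  have A': "c \<union> far c = U - ?B" using BU cD(2) by (auto simp: far_def)
  have "connected (c \<union> far c)"
    unfolding A' by (rule connected_complement_component[OF basin_connected(1) cD(1,2)])
  moreover have A'd: "c \<union> far c \<subseteq> disk" unfolding A' using U_V(1) by blast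
  ultimately have con: "connected (h' ` (c \<union> far c))"
    by (rule disk_homeo.connected_image[OF h.inverse])
  have "h' ` (c \<union> far c) \<subseteq> U - c"
  proof
    fix y assume "y \<in> h' ` (c \<union> far c)"
    then obtain x where x: "x \<in> c \<union> far c" "y = h' x" by blast
    have xd: "x \<in> disk" "x \<in> U" "x \<notin> ?B" using x(1) A' A'd by blast+
    have "y \<in> U" using symmetry_basins(1)[OF symmetry_inverse[OF h] xd(1)] xd(2) x(2) by simp
    moreover have "y \<notin> c"
    proof
      assume "y \<in> c"
      then have "h y \<in> ?B" using hcB by blast
      moreover have "h y = x" using h.inv(2)[OF xd(1)] x(2) by simp
      ultimately show False using xd(3) by blast
    qed
    ultimately show "y \<in> U - c" by blast
  qed
  then have in_B: "h' ` (c \<union> far c) \<subseteq> ?B"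
    using connected_component_overlap[OF con] meets(2) by blast
  obtain \<beta> where \<beta>: "xcut \<beta>" using xcut_exists by blast
  have h\<beta>: "xcut (h \<circ> \<beta>)" by (rule xcut_symmetry[OF h \<beta>])
  have ev: "\<forall>\<^sub>F m in sequentially. \<forall>\<^sub>F t in at_left 1. (f ^^ m) (\<gamma> t) \<in> far c" if "xcut \<gamma>" for \<gamma>
    using c that by (simp add: essential_def)
  obtain m where m: "\<forall>\<^sub>F t in at_left 1. (f ^^ m) (\<beta> t) \<in> far c" "\<forall>\<^sub>F t in at_left 1. (f ^^ m) ((h \<circ> \<beta>) t) \<in> far c"
    using eventually_happens[OF eventually_conj[OF ev[OF \<beta>] ev[OF h\<beta>]]] by auto
  obtain t where t: "0 < t" "t < 1" "(f ^^ m) (\<beta> t) \<in> far c" "(f ^^ m) (h (\<beta> t)) \<in> far c"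
    using eventually_happens[OF eventually_conj[OF eventually_conj[OF m] eventually_at_left_1]] trivial_limit_at_left_real
    by auto
  have bd: "\<beta> t \<in> disk" using xcutD(12)[OF \<beta>, of t] t by simp
  define x where "x = (f ^^ m) (\<beta> t)"
  have xd: "x \<in> disk" unfolding x_def by (rule disk_homeo.in_disk(1)[OF pow bd])
  have "h x \<in> far c" using t(4) symmetry_commutes(3)[OF h bd] by (simp add: x_def)
  then have "h' (h x) \<in> ?B" using in_B by blast
  then show False using h.inv(1)[OF xd] t(3) by (simp add: far_def flip: x_def)
qed

lemma not_mapped_into_far_side:
  assumes c: "essential c"
  shows "\<not> f ` far c \<subseteq> far c"
proof
  assume sub: "f ` far c \<subseteq> far c"
  let ?B = "connected_component_set (U - c) a"
  obtain z where z: "z \<in> far c" using far_nonempty[OF c] by blast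
  have it: "(f ^^ n) z \<in> far c" for n
    by (induction n) (use z sub in auto)
  have cD: "c \<subseteq> U" "closed (c \<union> \<Gamma>)" "a \<notin> c"
    using c on_boundary by (auto simp: essential_def)
  have "a \<in> ?B" using U_V(8) cD(3) by (simp add: connected_component_refl)
  then have "\<forall>\<^sub>F n in sequentially. (f ^^ n) ` {z} \<subseteq> ?B"
    using z by (intro compact_uniformly_attracted openin_far(2)[OF cD(2,1)]) (auto simp: far_def)
  then obtain n where "(f ^^ n) z \<in> ?B"
    using eventually_happens by force
  then show False using it[of n] by (simp add: far_def)
qed

text \<open>
  Uniform convergence to \<open>r\<close> on compact subsets of \<open>V\<close>.
\<close>

definition contracting :: "(complex \<Rightarrow> complex) \<Rightarrow> bool" where
  "contracting h \<longleftrightarrow> (\<forall>Z Y. compact Z \<and> Z \<subseteq> V \<and> compact Y \<and> r \<notin> Y \<longrightarrow>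
     (\<forall>\<^sub>F k in sequentially. (h ^^ k) ` Z \<inter> Y = {}))"

text \<open>
  Iterates of a contracting symmetry move a crosscut ending on the far side of \<open>c\<close> to the neighborhood of \<open>r\<close>,
  away from \<open>c\<close>. It then lies on the side of \<open>a\<close>, where it starts.
\<close>

lemma contracting_not_into_far_side:
  assumes h: "symmetry h h'" and con: "contracting h" and c: "essential c" and r: "r \<notin> closure c"
  shows "\<not> h ` far c \<subseteq> far c"
proof
  assume sub: "h ` far c \<subseteq> far c"
  let ?B = "connected_component_set (U - c) a"
  obtain \<beta> where \<beta>: "xcut \<beta>" using xcut_exists by blast
  then obtain m where m: "\<forall>\<^sub>F t in at_left 1. (f ^^ m) (\<beta> t) \<in> far c"
    using c eventually_happens unfolding essential_def by force
  define \<delta> where "\<delta> = (f ^^ m) \<circ> \<beta>"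
  have \<delta>: "xcut \<delta>" unfolding \<delta>_def by (rule xcut_pow[OF \<beta>])
  obtain t where t: "0 < t" "t < 1" "\<delta> t \<in> far c"
    using eventually_happens[OF eventually_conj[OF m eventually_at_left_1]] trivial_limit_at_left_real by (auto simp: \<delta>_def)
  have it: "(h ^^ k) (\<delta> t) \<in> far c" for k
    by (induction k) (use t sub in auto)
  have "\<forall>\<^sub>F k in sequentially. (h ^^ k) ` path_image \<delta> \<inter> closure c = {}"
    using con xcutD(5,8)[OF \<delta>] essential_closure_disk(1)[OF c] r unfolding contracting_def by blast
  then obtain k where k: "(h ^^ k) ` path_image \<delta> \<inter> closure c = {}"
    using eventually_happens by force
  define \<gamma> where "\<gamma> = (h ^^ k) \<circ> \<delta>"
  have "xcut \<gamma>" unfolding \<gamma>_def by (rule xcut_symmetry[OF symmetry_funpow[OF h] \<delta>])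
  note D = xcutD[OF this]
  have dis: "path_image \<gamma> \<inter> c = {}"
    using k closure_subset[of c] unfolding \<gamma>_def path_image_compose by blast
  have con: "connected (\<gamma> ` {0..t})"
  proof (rule connected_continuous_image)
    show "continuous_on {0..t} \<gamma>"
      by (rule continuous_on_subset[OF D(2)[unfolded path_def]]) (use t in auto)
  qed simp
  have "\<gamma> ` {0..t} \<subseteq> path_image \<gamma>" using t by (auto simp: path_image_def)
  moreover have "\<gamma> ` {0..t} \<subseteq> U" using D(11) t by auto
  ultimately have sub: "\<gamma> ` {0..t} \<subseteq> U - c" using dis by blast
  have start: "\<gamma> 0 \<in> ?B"
    using boundary_in_component[of c] c D(3) \<sigma> unfolding essential_def by blast
  have "\<gamma> ` {0..t} \<subseteq> ?B"
    by (rule connected_component_overlap[OF con sub _ start]) (use t in simp)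
  moreover have "\<gamma> t \<in> \<gamma> ` {0..t}" using t by simp
  ultimately have "\<gamma> t \<in> ?B" by blast
  then show False using it[of k] by (simp add: \<gamma>_def far_def)
qed

lemma contracting_inverse: "contracting f'"
  using compact_avoids_point_eventually unfolding contracting_def by blast

text \<open>
  Every symmetry becomes contracting towards \<open>r\<close> after composition with a high power of \<open>f'\<close>: choose the
  power such that the composition maps a neighborhood \<open>W\<close> that is attracted to \<open>r\<close> into \<open>f' ` W\<close>.
\<close>

lemma contracting_compose_power:
  assumes h: "symmetry h h'"
  shows "\<exists>n. contracting (h \<circ> (f' ^^ n))"
proof -
  interpret h: disk_homeo h h' by (rule symmetry_homeo[OF h])
  obtain W T where WT: "compact W" "W \<subseteq> disk" "openin (top_of_set disk) T" "r \<in> T" "T \<subseteq> W"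
    "\<And>N. openin (top_of_set disk) N \<Longrightarrow> r \<in> N \<Longrightarrow> \<forall>\<^sub>F n in sequentially. (f' ^^ n) ` W \<subseteq> N"
    using rep.trapping_nhd by blast
  have "openin (top_of_set disk) (h' ` f' ` T)"
    using disk_homeo.image_openin[OF h.inverse] rep.image_openin WT(3) by blast
  moreover have "h' r = r" using symmetry_fixes(2)[OF symmetry_inverse[OF h]] .
  then have "r \<in> h' ` f' ` T" using WT(4) rep.fixed(2) by (metis imageI)
  ultimately obtain n where n: "(f' ^^ n) ` W \<subseteq> h' ` f' ` T"
    using eventually_happens[OF WT(6)] by force
  define P where "P = h \<circ> (f' ^^ n)"
  have symP: "symmetry P ((f ^^ n) \<circ> h')"
    unfolding P_def by (rule symmetry_compose[OF h symmetry_funpow[OF symmetry_inverse[OF symmetry_self]]])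
  have step: "\<exists>v\<in>W. P w = f' v" if w: "w \<in> W" for w
  proof -
    obtain y where y: "y \<in> T" "(f' ^^ n) w = h' (f' y)" using n w by blast
    then have "y \<in> W" using WT(5) by blast
    then have "f' y \<in> disk" using in_disk(2) WT(2) by blast
    then have "P w = f' y" using y(2) h.inv(2) by (simp add: P_def)
    then show ?thesis using \<open>y \<in> W\<close> by blast
  qed
  have pow_step: "\<exists>v\<in>W. (P ^^ k) w = (f' ^^ k) v" if w: "w \<in> W" for k w
  proof (induction k)
    case 0
    then show ?case using w by auto
  next
    case (Suc k)
    then obtain v where v: "v \<in> W" "(P ^^ k) w = (f' ^^ k) v" by blast
    obtain u where u: "u \<in> W" "P v = f' u" using step[OF v(1)] by blast
    have "(P ^^ Suc k) w = (f' ^^ k) (P v)"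
      using v symmetry_commutes(4)[OF symP, of v] WT(2) by auto
    also have "\<dots> = (f' ^^ Suc k) u" using u(2) by (simp add: funpow_swap1)
    finally show ?case using u(1) by blast
  qed
  have "contracting P"
    unfolding contracting_def
  proof (intro allI impI)
    fix Z Y assume ZY: "compact Z \<and> Z \<subseteq> V \<and> compact Y \<and> r \<notin> Y"
    obtain j where j: "(f' ^^ j) ` Z \<subseteq> T"
      using eventually_happens[OF rep.compact_uniformly_attracted[OF _ _ WT(3,4)]] ZY by force
    have "openin (top_of_set disk) (disk - Y)"
      using openin_disk_Diff compact_imp_closed ZY by blast
    moreover have "r \<in> disk - Y" using rep.fixed(1) ZY by blast
    ultimately obtain K where K: "\<And>k. k \<ge> K \<Longrightarrow> (f' ^^ k) ` W \<subseteq> disk - Y"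
      using WT(6) unfolding eventually_sequentially by blast
    have "(P ^^ k) ` Z \<inter> Y = {}" if k: "k \<ge> K + j" for k
    proof (rule ccontr)
      assume "(P ^^ k) ` Z \<inter> Y \<noteq> {}"
      then obtain x where x: "x \<in> Z" "(P ^^ k) x \<in> Y" by blast
      have xd: "x \<in> disk" using x(1) ZY U_V(2) by blast
      have "(f' ^^ j) x \<in> W" using j x(1) WT(5) by blast
      then obtain v where v: "v \<in> W" "(P ^^ k) ((f' ^^ j) x) = (f' ^^ k) v" using pow_step by blast
      have vd: "v \<in> disk" using v(1) WT(2) by blast
      have "k = j + (k - j)" using k by simp
      then have "(f' ^^ k) v = (f' ^^ j) ((f' ^^ (k - j)) v)" by (metis funpow_add comp_apply)
      moreover have "(P ^^ k) ((f' ^^ j) x) = (f' ^^ j) ((P ^^ k) x)"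
        by (rule symmetry_commutes(4)[OF symmetry_funpow[OF symP] xd])
      ultimately have eq: "(f' ^^ j) ((P ^^ k) x) = (f' ^^ j) ((f' ^^ (k - j)) v)" using v(2) by simp
      interpret j: disk_homeo "f' ^^ j" "f ^^ j" by (rule disk_homeo.inverse[OF pow])
      have "(P ^^ k) x \<in> disk"
        by (rule disk_homeo.in_disk(1)[OF symmetry_homeo[OF symmetry_funpow[OF symP]] xd])
      moreover have "(f' ^^ (k - j)) v \<in> disk" by (rule disk_homeo.in_disk(2)[OF pow vd])
      ultimately have "(P ^^ k) x = (f' ^^ (k - j)) v" using eq j.inj by (meson inj_onD)
      moreover have "(f' ^^ (k - j)) ` W \<subseteq> disk - Y" by (rule K) (use k in simp)
      ultimately have "(P ^^ k) x \<in> disk - Y" using v(1) by (metis image_subset_iff)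
      then show False using x(2) by blast
    qed
    then show "\<forall>\<^sub>F k in sequentially. (P ^^ k) ` Z \<inter> Y = {}"
      unfolding eventually_sequentially by blast
  qed
  then show ?thesis unfolding P_def by blast
qed

lemma essential_meets_image:
  assumes "essential c" "r \<notin> closure c"
  shows "f ` c \<inter> c \<noteq> {}"
proof
  assume "f ` c \<inter> c = {}"
  then have "f ` (c \<union> far c) \<subseteq> far c \<or> f' ` (c \<union> far c) \<subseteq> far c"
    by (rule far_sides_nested[OF symmetry_self assms(1)])
  then show False
    using not_mapped_into_far_side[OF assms(1)]
      contracting_not_into_far_side[OF symmetry_inverse[OF symmetry_self] contracting_inverse assms] by blast
qed

text \<open>
  Choose \<open>n\<close> such that \<open>h \<circ> f'\<^sup>n\<close> is contracting, and \<open>M\<close> such that the inverse of \<open>f\<^sup>M \<circ> h \<circ> f'\<^sup>n\<close> is. If none of the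
  maps \<open>F\<^sub>i = f\<^sup>i \<circ> h \<circ> f'\<^sup>n\<close> moved \<open>c\<close> to a set meeting \<open>c\<close>, then for each \<open>i\<close> either \<open>F\<^sub>i\<close> or its inverse would map
  the far side of \<open>c\<close> into itself: the inverse for \<open>i = 0\<close>, and \<open>F\<^sub>i\<close> for \<open>i = M\<close>. At the first change \<open>f\<close>, the
  composition of \<open>F\<^sub>i\<^sub>+\<^sub>1\<close> with the inverse of \<open>F\<^sub>i\<close>, would map the far side into itself.
\<close>

lemma essential_meets_some_image:
  assumes h: "symmetry h h'"
  shows "\<exists>n M. \<forall>c. essential c \<and> r \<notin> closure c \<longrightarrow> (\<exists>i\<le>M. ((f ^^ i) \<circ> (h \<circ> (f' ^^ n))) ` c \<inter> c \<noteq> {})"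
proof -
  have h': "symmetry h' h" by (rule symmetry_inverse[OF h])
  interpret h: disk_homeo h h' by (rule symmetry_homeo[OF h])
  have f': "symmetry f' f" by (rule symmetry_inverse[OF symmetry_self])
  obtain n where n: "contracting (h \<circ> (f' ^^ n))" using contracting_compose_power[OF h] by blast
  obtain n' where n': "contracting (h' \<circ> (f' ^^ n'))" using contracting_compose_power[OF h'] by blast
  let ?F = "\<lambda>i. (f ^^ i) \<circ> (h \<circ> (f' ^^ n))" and ?F' = "\<lambda>i. ((f ^^ n) \<circ> h') \<circ> (f' ^^ i)"
  have F: "symmetry (?F i) (?F' i)" for i
    by (rule symmetry_compose[OF symmetry_funpow[OF symmetry_self] symmetry_compose[OF h symmetry_funpow[OF f']]])
  have "\<exists>i\<le>n + n'. ?F i ` c \<inter> c \<noteq> {}" if c: "essential c" "r \<notin> closure c" for c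
  proof (rule ccontr)
    assume no: "\<not> ?thesis"
    have nested: "?F i ` (c \<union> far c) \<subseteq> far c \<or> ?F' i ` (c \<union> far c) \<subseteq> far c" if "i \<le> n + n'" for i
    proof -
      have "?F i ` c \<inter> c = {}" using no that by blast
      then show ?thesis by (rule far_sides_nested[OF F c(1)])
    qed
    have fd: "far c \<subseteq> disk" using U_V(1) by (auto simp: far_def)
    have inv_into: "?F' i ` (c \<union> far c) \<subseteq> far c" if "i \<le> n + n'" for i
      using that
    proof (induction i)
      case 0
      have "\<not> (h \<circ> (f' ^^ n)) ` far c \<subseteq> far c"
        by (rule contracting_not_into_far_side[OF symmetry_compose[OF h symmetry_funpow[OF f']] n c])
      moreover have "?F 0 = h \<circ> (f' ^^ n)" by simp
      ultimately have "\<not> ?F 0 ` (c \<union> far c) \<subseteq> far c" unfolding image_Un by (metis Un_subset_iff)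
      then show ?case using nested[of 0] by blast
    next
      case (Suc i)
      then have IH: "?F' i ` (c \<union> far c) \<subseteq> far c" by simp
      have "\<not> ?F (Suc i) ` (c \<union> far c) \<subseteq> far c"
      proof
        assume into: "?F (Suc i) ` (c \<union> far c) \<subseteq> far c"
        have "f ` far c \<subseteq> far c"
        proof
          fix y assume "y \<in> f ` far c"
          then obtain x where x: "x \<in> far c" "y = f x" by blast
          have "?F' i x \<in> far c" using IH x(1) by blast
          then have "?F (Suc i) (?F' i x) \<in> far c" using into by blast
          moreover have "?F (Suc i) (?F' i x) = f (?F i (?F' i x))" by simp
          moreover have "?F i (?F' i x) = x"
            using disk_homeo.inv(2)[OF symmetry_homeo[OF F]] x(1) fd by blast
          ultimately show "y \<in> far c" using x(2) by metis
        qed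
        then show False using not_mapped_into_far_side[OF c(1)] by blast
      qed
      then show ?case using nested[OF Suc.prems] by blast
    qed
    have eq: "?F' (n + n') x = (h' \<circ> (f' ^^ n')) x" if x: "x \<in> disk" for x
    proof -
      define y where "y = (f' ^^ n') x"
      have yd: "y \<in> disk" unfolding y_def by (rule disk_homeo.in_disk(2)[OF pow x])
      have "?F' (n + n') x = (f ^^ n) (h' ((f' ^^ n) y))"
        by (simp add: funpow_add y_def)
      also have "h' ((f' ^^ n) y) = (f' ^^ n) (h' y)"
        by (rule symmetry_commutes(4)[OF h' yd])
      also have "(f ^^ n) \<dots> = h' y"
        by (rule disk_homeo.inv(2)[OF pow h.in_disk(2)[OF yd]])
      finally show ?thesis by (simp add: y_def)
    qed
    have "(h' \<circ> (f' ^^ n')) ` far c \<subseteq> far c"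
    proof
      fix y assume "y \<in> (h' \<circ> (f' ^^ n')) ` far c"
      then obtain x where x: "x \<in> far c" "y = (h' \<circ> (f' ^^ n')) x" by blast
      then have "y = ?F' (n + n') x" using eq fd by auto
      then show "y \<in> far c" using inv_into[OF order_refl] x(1) by blast
    qed
    then show False
      using contracting_not_into_far_side[OF symmetry_compose[OF h' symmetry_funpow[OF f']] n' c] by blast
  qed
  then show ?thesis by blast
qed

text \<open>
  The point is a limit of essential sets of diameters tending to zero. Since the set of exponents in
  \<open>essential_meets_some_image\<close> is finite and independent of \<open>c\<close>, one of the maps has to fix the limit.
\<close>

lemma common_fixed_point:
  obtains x where "x \<in> disk" "x \<notin> U" "x \<notin> V" "\<And>h h'. symmetry h h' \<Longrightarrow> h x = x"
    "\<And>N. openin (top_of_set disk) N \<Longrightarrow> x \<in> N \<Longrightarrow> N \<inter> U \<noteq> {} \<and> N \<inter> V \<noteq> {}"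
proof -
  have "\<exists>c z p. essential c \<and> c \<subseteq> ball z (inverse (real (Suc k))) \<and> z \<in> c \<and> p \<in> \<Gamma> \<and> p \<in> ball z (inverse (real (Suc k)))" for k
    using small_essential_exists[of "inverse (real (Suc k))"] by (metis inverse_positive_iff_positive of_nat_0_less_iff zero_less_Suc)
  then obtain C Z P where CZP: "\<And>k. essential (C k)" "\<And>k. C k \<subseteq> ball (Z k) (inverse (real (Suc k)))"
    "\<And>k. Z k \<in> C k" "\<And>k. P k \<in> \<Gamma>" "\<And>k. P k \<in> ball (Z k) (inverse (real (Suc k)))"
    by metis
  have Cd: "C k \<subseteq> disk" "closure (C k) \<subseteq> disk" "C k \<subseteq> U" for k
    using CZP(1)[of k] U_V(1) essential_closure_disk(2) by (auto simp: essential_def)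
  have "\<forall>k. Z k \<in> disk" using CZP(3) Cd(1) by blast
  then obtain l s where l: "l \<in> disk" "strict_mono (s :: nat \<Rightarrow> nat)" "(Z \<circ> s) \<longlonglongrightarrow> l"
    using compact_cball[of 0 1] unfolding compact_def by blast
  let ?D = "\<lambda>k. C (s k)"
  have small: "\<forall>\<^sub>F k in sequentially. closure (?D k) \<subseteq> S \<and> P (s k) \<in> S" if S: "open S" "l \<in> S" for S
  proof -
    obtain e where e: "e > 0" "ball l e \<subseteq> S" using S open_contains_ball by blast
    have "\<forall>\<^sub>F k in sequentially. dist ((Z \<circ> s) k) l < e / 2"
      by (rule tendstoD[OF l(3)]) (use e(1) in simp)
    moreover have "((\<lambda>k. inverse (real (Suc k))) \<circ> s) \<longlonglongrightarrow> 0"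
      by (rule LIMSEQ_subseq_LIMSEQ[OF LIMSEQ_inverse_real_of_nat l(2)])
    then have "\<forall>\<^sub>F k in sequentially. dist (((\<lambda>k. inverse (real (Suc k))) \<circ> s) k) 0 < e / 2"
      using tendstoD e(1) by (metis half_gt_zero)
    ultimately show ?thesis
    proof eventually_elim
      case (elim k)
      have i: "inverse (real (Suc (s k))) < e / 2" using elim(2) by simp
      have sub: "cball (Z (s k)) (e / 2) \<subseteq> ball l e"
      proof
        fix y assume "y \<in> cball (Z (s k)) (e / 2)"
        then show "y \<in> ball l e"
          using elim(1) dist_triangle[of l y "Z (s k)"] by (simp add: dist_commute)
      qed
      have "?D k \<subseteq> cball (Z (s k)) (e / 2)" "P (s k) \<in> cball (Z (s k)) (e / 2)"
        using CZP(2)[of "s k"] CZP(5)[of "s k"] i by force+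
      then have "closure (?D k) \<subseteq> cball (Z (s k)) (e / 2)" "P (s k) \<in> cball (Z (s k)) (e / 2)"
        by (simp_all add: closure_minimal)
      then show ?case using sub e(2) by blast
    qed
  qed
  have lV: "l \<notin> V"
  proof
    assume "l \<in> V"
    obtain G where G: "open G" "V = disk \<inter> G" using rep.basin_openin openin_open by blast
    then have "l \<in> G" using \<open>l \<in> V\<close> by blast
    from eventually_happens[OF small[OF G(1) this]] obtain k where "closure (?D k) \<subseteq> G" by auto
    then have "closure (?D k) \<subseteq> V" using Cd(2) G(2) by blast
    then show False using essential_not_in_V[OF CZP(1)] by blast
  qed
  have lU: "l \<notin> U"
  proof
    assume "l \<in> U"
    obtain G where G: "open G" "U = disk \<inter> G" using basin_openin openin_open by blast
    then have "l \<in> G" using \<open>l \<in> U\<close> by blast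
    from eventually_happens[OF small[OF G(1) this]] obtain k where "P (s k) \<in> G" by auto
    then have "P (s k) \<in> U" using CZP(4) G(2) by blast
    then show False using CZP(4) by blast
  qed
  have "l \<in> - {r}" using lV U_V(9) by auto
  from small[OF open_Compl[OF closed_singleton] this]
  have ev_r: "\<forall>\<^sub>F k in sequentially. r \<notin> closure (?D k)"
    by (rule eventually_mono) blast
  have moves: "\<forall>\<^sub>F k in sequentially. F ` ?D k \<inter> ?D k = {}"
    if F: "symmetry F F'" and ne: "F l \<noteq> l" for F F'
  proof -
    interpret F: disk_homeo F F' by (rule symmetry_homeo[OF F])
    obtain A B where AB: "open A" "open B" "F l \<in> A" "l \<in> B" "A \<inter> B = {}"
      using hausdorff[OF ne] by blast
    have "openin (top_of_set disk) (disk \<inter> F -` A)"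
      by (rule continuous_openin_preimage_gen[OF F.cont(1) AB(1)])
    then obtain H where H: "open H" "disk \<inter> F -` A = disk \<inter> H" using openin_open by blast
    have "open (B \<inter> H)" "l \<in> B \<inter> H" using AB H l(1) by auto
    from small[OF this] show ?thesis
    proof eventually_elim
      case (elim k)
      then have D: "?D k \<subseteq> B" "?D k \<subseteq> H" using closure_subset by blast+
      have "?D k \<subseteq> disk \<inter> F -` A" unfolding H(2) using D(2) Cd(1) by blast
      then have "F ` ?D k \<subseteq> A" by blast
      then show ?case using D(1) AB(5) by blast
    qed
  qed
  have fl: "f l = l"
  proof (rule ccontr)
    assume "f l \<noteq> l"
    from eventually_happens[OF eventually_conj[OF moves[OF symmetry_self this] ev_r]]
    obtain k where "f ` ?D k \<inter> ?D k = {}" "r \<notin> closure (?D k)" by auto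
    then show False using essential_meets_image[OF CZP(1)] by blast
  qed
  show ?thesis
  proof (rule that[OF l(1) lU lV])
    fix h h' assume h: "symmetry h h'"
    show "h l = l"
    proof (rule ccontr)
      assume ne: "h l \<noteq> l"
      obtain n M where nM: "\<And>c. essential c \<Longrightarrow> r \<notin> closure c \<Longrightarrow> \<exists>i\<le>M. ((f ^^ i) \<circ> (h \<circ> (f' ^^ n))) ` c \<inter> c \<noteq> {}"
        using essential_meets_some_image[OF h] by blast
      have "f' l = l" using inv(1)[OF l(1)] fl by simp
      then have f'l: "(f' ^^ n) l = l" by (induction n) auto
      have fli: "(f ^^ i) l = l" for i by (induction i) (use fl in auto)
      have "((f ^^ i) \<circ> (h \<circ> (f' ^^ n))) l = h l" for i
        using f'l symmetry_commutes(3)[OF h l(1), of i] fli[of i] by simp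
      then have "\<forall>\<^sub>F k in sequentially. ((f ^^ i) \<circ> (h \<circ> (f' ^^ n))) ` ?D k \<inter> ?D k = {}" for i
        using ne
        by (intro moves[OF symmetry_compose[OF symmetry_funpow[OF symmetry_self]
                symmetry_compose[OF h symmetry_funpow[OF symmetry_inverse[OF symmetry_self]]]]]) simp
      then have "\<forall>\<^sub>F k in sequentially. \<forall>i\<in>{..M}. ((f ^^ i) \<circ> (h \<circ> (f' ^^ n))) ` ?D k \<inter> ?D k = {}"
        by (intro eventually_ball_finite) auto
      from eventually_happens[OF eventually_conj[OF this ev_r]]
      obtain k where k: "\<forall>i\<in>{..M}. ((f ^^ i) \<circ> (h \<circ> (f' ^^ n))) ` ?D k \<inter> ?D k = {}" "r \<notin> closure (?D k)"
        by auto
      obtain i where "i \<le> M" "((f ^^ i) \<circ> (h \<circ> (f' ^^ n))) ` ?D k \<inter> ?D k \<noteq> {}"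
        using nM[OF CZP(1) k(2)] by blast
      then show False using k(1) by blast
    qed
  next
    fix N assume N: "openin (top_of_set disk) N" "l \<in> N"
    obtain G where G: "open G" "N = disk \<inter> G" using N(1) openin_open by blast
    then have "l \<in> G" using N(2) by blast
    from eventually_happens[OF small[OF G(1) this]] obtain k where "closure (?D k) \<subseteq> G" by auto
    then have DN: "?D k \<subseteq> N" using closure_subset[of "?D k"] Cd(1)[of "s k"] G(2) by blast
    moreover have "?D k \<inter> V \<noteq> {}" by (rule essential_meets_V[OF CZP(1)])
    ultimately show "N \<inter> U \<noteq> {} \<and> N \<inter> V \<noteq> {}" using CZP(3)[of "s k"] Cd(3)[of "s k"] by blast
  qed
qed

end

section \<open>The fixed point theorem\<close>

lemma attracting_fixed_point_cong:
  assumes "\<And>x. x \<in> disk \<Longrightarrow> g x = h x" "\<And>x. x \<in> disk \<Longrightarrow> h x \<in> disk"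
  shows "attracting_fixed_point disk g a \<longleftrightarrow> attracting_fixed_point disk h a"
proof -
  have "(g ^^ n) x = (h ^^ n) x \<and> (h ^^ n) x \<in> disk" if "x \<in> disk" for x n
    by (induction n) (use assms that in auto)
  then have "(g ^^ n) ` W = (h ^^ n) ` W" if "W \<subseteq> disk" for n W
    using that by (intro image_cong) auto
  moreover have "Fix disk g = Fix disk h" using assms(1) by (auto simp: Fix_def)
  ultimately show ?thesis unfolding attracting_fixed_point_def by (simp cong: conj_cong)
qed

text \<open>
  With \<open>p\<close> as attractor, the neighbors of \<open>p\<close> in \<open>K\<close> on both sides provide the two repellers. They are found
  by listing the angles of the other points of \<open>K\<close> in one turn of the circle starting at \<open>p\<close>.
\<close>

lemma fixed_point_of_symmetries:
  assumes f: "disk_homeo f f'" and K: "K = {x \<in> disk_boundary. f x = x}" "finite K" "card K > 2"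
    and att: "\<And>x. x \<in> K \<Longrightarrow> attracting_fixed_point disk f x \<or> attracting_fixed_point disk f' x"
    and p: "p \<in> K" "attracting_fixed_point disk f p"
  shows "\<exists>x\<in>ball 0 1. \<forall>h h'. disk_homeo h h' \<and> (\<forall>x\<in>disk. h (f x) = f (h x)) \<and> (\<forall>x\<in>K. h x = x) \<longrightarrow> h x = x"
proof -
  interpret f: disk_homeo f f' by (rule f)
  have pb: "p \<in> disk_boundary" using p K by blast
  interpret P: boundary_attractor f f' p
    by unfold_locales (rule p(2), rule pb)
  obtain ta where ta: "p = cis ta"
    using pb sphere_eq_cis_image[of 1 0] by auto
  define T where "T = {t \<in> {ta<..<ta + 2 * pi}. cis t \<in> K}"
  have inj: "inj_on cis T"
    using cis_eq_imp by (intro inj_onI) (auto simp: T_def)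
  have img: "cis ` T = K - {p}"
  proof
    show "cis ` T \<subseteq> K - {p}"
    proof
      fix x assume "x \<in> cis ` T"
      then obtain t where t: "t \<in> T" "x = cis t" by blast
      then have "x \<noteq> p" using cis_eq_imp[of t ta] ta by (auto simp: T_def)
      then show "x \<in> K - {p}" using t by (auto simp: T_def)
    qed
    show "K - {p} \<subseteq> cis ` T"
    proof
      fix x assume x: "x \<in> K - {p}"
      then have "x \<in> disk_boundary" using K(1) by blast
      then obtain t where t: "t \<in> {ta..ta + 2 * pi}" "x = cis t"
        using sphere_eq_cis_image[of 1 ta] by auto
      have "cis (ta + 2 * pi) = p" using cis_mult_periodic[of 1 ta] ta by simp
      then have "t \<noteq> ta" "t \<noteq> ta + 2 * pi" using x t(2) ta by auto
      then have "t \<in> T" using t x by (auto simp: T_def)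
      then show "x \<in> cis ` T" using t(2) by blast
    qed
  qed
  have T: "finite T" "card T \<ge> 2"
    using K(2,3) p(1) inj img finite_imageD[of cis T] card_image[OF inj] by auto
  define t2 where "t2 = Min T"
  define tM where "tM = Max T"
  have "T \<noteq> {}" using T by auto
  then have mem: "t2 \<in> T" "tM \<in> T" using T(1) by (auto simp: t2_def tM_def)
  have bounds: "t2 \<le> t" "t \<le> tM" if "t \<in> T" for t
    using that T(1) by (auto simp: t2_def tM_def)
  have "t2 < tM"
  proof (rule ccontr)
    assume "\<not> t2 < tM"
    then have "T \<subseteq> {t2}" using bounds by force
    then have "card T \<le> 1" using card_mono[of "{t2}" T] by simp
    then show False using T(2) by simp
  qed
  define t1 where "t1 = tM - 2 * pi"
  have cis1: "cis t1 = cis tM" using cis_mult_periodic[of 1 t1] by (simp add: t1_def)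
  have order: "t1 < ta" "ta < t2" "t2 < t1 + 2 * pi"
    using mem \<open>t2 < tM\<close> by (auto simp: t1_def T_def)
  have K12: "cis t1 \<in> K" "cis t2 \<in> K" using mem cis1 by (auto simp: T_def)
  have fix12: "f (cis t1) = cis t1" "f (cis t2) = cis t2" using K12 K(1) by auto
  have "(\<lambda>s. cis (1 * s)) ` {t1<..ta} \<subseteq> basin f p"
  proof (rule P.fixed_point_free_arc_in_basin[OF _ order])
    show "f (cis (1 * s)) \<noteq> cis (1 * s)" if s: "s \<in> {t1<..<ta}" for s
    proof
      assume "f (cis (1 * s)) = cis (1 * s)"
      then have "cis s \<in> K" using K(1) by simp
      moreover have "cis (s + 2 * pi) = cis s" using cis_mult_periodic[of 1 s] by simp
      ultimately have "s + 2 * pi \<in> T"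
        using s mem(2) by (auto simp: T_def t1_def)
      then show False using bounds(2)[of "s + 2 * pi"] s by (simp add: t1_def)
    qed
  qed (use ta fix12 in auto)
  then have arc1: "cis ` {t1<..ta} \<subseteq> basin f p" by simp
  (* The arc on the other side of p is treated with the reversed orientation of the circle. *)
  have "(\<lambda>s. cis (- 1 * s)) ` {- t2<..- ta} \<subseteq> basin f p"
  proof (rule P.fixed_point_free_arc_in_basin[of _ _ _ "- t1"])
    show "f (cis (- 1 * s)) \<noteq> cis (- 1 * s)" if s: "s \<in> {- t2<..<- ta}" for s
    proof
      assume "f (cis (- 1 * s)) = cis (- 1 * s)"
      then have "cis (- s) \<in> K" using K(1) by simp
      then have "- s \<in> T" using s mem(1) by (auto simp: T_def)
      then show False using bounds(1)[of "- s"] s by simp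
    qed
  qed (use ta fix12 order in auto)
  moreover have "cis ` {ta..<t2} = (\<lambda>s. cis (- 1 * s)) ` {- t2<..- ta}"
  proof -
    have "{ta..<t2} = uminus ` {- t2<..- ta}" by simp
    then show ?thesis by (simp only: image_image) simp
  qed
  ultimately have arc2: "cis ` {ta..<t2} \<subseteq> basin f p" by simp
  have not_att: "\<not> attracting_fixed_point disk f (cis t)"
    if "cis t \<in> K" "cis t \<noteq> p" and lim: "\<And>d. d > 0 \<Longrightarrow> \<exists>s. \<bar>s - t\<bar> < d \<and> cis s \<in> basin f p" for t
  proof
    assume "attracting_fixed_point disk f (cis t)"
    then interpret Q: attractor f f' "cis t" by unfold_locales
    obtain G where G: "open G" "basin f (cis t) = disk \<inter> G" using Q.basin_openin openin_open by blast
    then have "cis t \<in> G" using Q.attractor_in_basin by blast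
    then obtain d where d: "d > 0" "ball (cis t) d \<subseteq> G" using G(1) open_contains_ball by blast
    obtain \<eta> where \<eta>: "\<eta> > 0" "\<And>s. \<bar>s - t\<bar> < \<eta> \<Longrightarrow> dist (cis s) (cis t) < d"
      using cis_close[OF d(1)] by blast
    obtain s where s: "\<bar>s - t\<bar> < \<eta>" "cis s \<in> basin f p" using lim[OF \<eta>(1)] by blast
    have "cis s \<in> ball (cis t) d" using \<eta>(2)[OF s(1)] by (simp add: dist_commute)
    then have "cis s \<in> basin f (cis t)" using d(2) G(2) by auto
    then show False using basin_disjoint[OF that(2), of f] s(2) by blast
  qed
  have ne: "cis t1 \<noteq> p" "cis t2 \<noteq> p"
    using cis_eq_imp[of t1 ta] cis_eq_imp[of t2 ta] order ta by auto
  have "\<not> attracting_fixed_point disk f (cis t1)"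
  proof (rule not_att[OF K12(1) ne(1)])
    fix d :: real assume "d > 0"
    define s where "s = t1 + min (d / 2) (ta - t1)"
    have "\<bar>s - t1\<bar> < d" "s \<in> {t1<..ta}" using \<open>d > 0\<close> order by (auto simp: s_def)
    then show "\<exists>s. \<bar>s - t1\<bar> < d \<and> cis s \<in> basin f p" using arc1 by blast
  qed
  then have att1: "attracting_fixed_point disk f' (cis t1)" using att[OF K12(1)] by blast
  have "\<not> attracting_fixed_point disk f (cis t2)"
  proof (rule not_att[OF K12(2) ne(2)])
    fix d :: real assume "d > 0"
    define s where "s = t2 - min (d / 2) (t2 - ta)"
    have "\<bar>s - t2\<bar> < d" "s \<in> {ta..<t2}" using \<open>d > 0\<close> order by (auto simp: s_def)
    then show "\<exists>s. \<bar>s - t2\<bar> < d \<and> cis s \<in> basin f p" using arc2 by blast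
  qed
  then have att2: "attracting_fixed_point disk f' (cis t2)" using att[OF K12(2)] by blast
  interpret f': disk_homeo f' f by (rule f.inverse)
  interpret A: adjacent_fixed_points f f' p "cis t1" "cis t2" t1 ta t2
    by unfold_locales (use att1 att2 order ta arc1 arc2 in auto)
  obtain x where x: "x \<in> disk" "x \<notin> basin f p" "x \<notin> basin f' (cis t1)"
    "\<And>h h'. A.symmetry h h' \<Longrightarrow> h x = x"
    "\<And>N. openin (top_of_set disk) N \<Longrightarrow> x \<in> N \<Longrightarrow> N \<inter> basin f p \<noteq> {} \<and> N \<inter> basin f' (cis t1) \<noteq> {}"
    using A.common_fixed_point by blast
  have "x \<in> ball 0 1"
  proof (rule ccontr)
    assume "x \<notin> ball 0 1"
    then have "x \<in> disk_boundary" using x(1) by auto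
    moreover have "f x = x" by (rule x(4)[OF A.symmetry_self])
    ultimately have "x \<in> K" using K(1) by blast
    from att[OF this] show False
    proof
      assume "attracting_fixed_point disk f x"
      then interpret Q: attractor f f' x by unfold_locales
      have "x \<noteq> p" using x(2) P.attractor_in_basin by auto
      then show False
        using x(5)[OF Q.basin_openin Q.attractor_in_basin] basin_disjoint[of x p f] by blast
    next
      assume "attracting_fixed_point disk f' x"
      then interpret Q: attractor f' f x by unfold_locales
      have "x \<noteq> cis t1" using x(3) A.rep.attractor_in_basin by auto
      then show False
        using x(5)[OF Q.basin_openin Q.attractor_in_basin] basin_disjoint[of x "cis t1" f'] by blast
    qed
  qed
  moreover have "h x = x" if "disk_homeo h h'" "\<forall>x\<in>disk. h (f x) = f (h x)" "\<forall>x\<in>K. h x = x" for h h'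
    using that K12 p(1) by (intro x(4)[of h h']) (simp add: A.symmetry_def)
  ultimately show ?thesis by blast
qed

theorem theorem1p1:
  fixes G :: "(complex \<Rightarrow> complex) set"
    and f :: "complex \<Rightarrow> complex"
    and K :: "complex set"
    and G\<^sub>0 :: "(complex \<Rightarrow> complex) set"
  assumes "subgroup G Homeo_disk"
    and "f \<in> center (Homeo_disk\<lparr>carrier := G\<rparr>)"
    and "K = Fix disk f \<inter> disk_boundary"
    and "finite K"
    and "card K > 2"
    and "\<And>x. x \<in> K \<Longrightarrow> attracting_fixed_point disk f x \<or> repelling_fixed_point disk f x"
    and "G\<^sub>0 = pointwise_stabilizer G K"
  shows "global_Fix disk G\<^sub>0 \<inter> (disk - disk_boundary) \<noteq> {}"
proof -
  have fG: "f \<in> G" using assms(2) by (simp add: center_def)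
  have mem: "g \<in> carrier Homeo_disk" if "g \<in> G" for g
    by (rule subgroup.mem_carrier[OF assms(1) that])
  obtain f' where f: "disk_homeo f f'"
    using mem[OF fG] unfolding Homeo_disk_carrier_iff disk_homeo_def by blast
  interpret f: disk_homeo f f' by (rule f)
  have commute: "g (f x) = f (g x)" if "g \<in> G" "x \<in> disk" for g x
  proof -
    have "f \<otimes>\<^bsub>Homeo_disk\<^esub> g = g \<otimes>\<^bsub>Homeo_disk\<^esub> f"
      using assms(2) that(1) by (simp add: center_def)
    then have "compose disk f g = compose disk g f"
      using Homeo_disk_mult mem fG that(1) by metis
    then show ?thesis using that(2) by (metis compose_eq)
  qed
  have K: "K = {x \<in> disk_boundary. f x = x}"
    unfolding assms(3) by (auto simp: Fix_def)
  have inv_eq: "inv_into disk f y = f' y" if "y \<in> disk" for y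
    by (rule inv_into_f_eq[OF f.inj]) (use f.in_disk f.inv that in auto)
  have "repelling_fixed_point disk f x \<longleftrightarrow> attracting_fixed_point disk f' x" for x
    unfolding repelling_fixed_point_def
    by (rule attracting_fixed_point_cong) (use inv_eq f.in_disk in auto)
  then have att: "attracting_fixed_point disk f x \<or> attracting_fixed_point disk f' x" if "x \<in> K" for x
    using assms(6)[OF that] by blast
  have K': "K = {x \<in> disk_boundary. f' x = x}"
    unfolding K using f.inv by (metis (no_types, lifting) mem_sphere_0 mem_cball_0 order_refl)
  have "K \<noteq> {}" using assms(5) by auto
  then obtain p where p: "p \<in> K" by blast
  have "\<exists>x\<in>ball 0 1. \<forall>g\<in>G\<^sub>0. g x = x"
    using att[OF p]
  proof
    assume "attracting_fixed_point disk f p"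
    from fixed_point_of_symmetries[OF f K assms(4,5) att p this] obtain x where x: "x \<in> ball 0 1"
      "\<And>h h'. disk_homeo h h' \<Longrightarrow> \<forall>x\<in>disk. h (f x) = f (h x) \<Longrightarrow> \<forall>x\<in>K. h x = x \<Longrightarrow> h x = x"
      by blast
    have "g x = x" if "g \<in> G\<^sub>0" for g
    proof -
      have g: "g \<in> G" "\<forall>x\<in>K. g x = x" using that by (simp_all add: assms(7) pointwise_stabilizer_def)
      obtain g' where "disk_homeo g g'"
        using mem[OF g(1)] unfolding Homeo_disk_carrier_iff disk_homeo_def by blast
      then show ?thesis using x(2)[of g g'] commute[OF g(1)] g(2) by blast
    qed
    then show ?thesis using x(1) by blast
  next
    assume a: "attracting_fixed_point disk f' p"
    have att': "attracting_fixed_point disk f' x \<or> attracting_fixed_point disk f x" if "x \<in> K" for x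
      using att[OF that] by blast
    from fixed_point_of_symmetries[OF f.inverse K' assms(4,5) att' p a] obtain x where x: "x \<in> ball 0 1"
      "\<And>h h'. disk_homeo h h' \<Longrightarrow> \<forall>x\<in>disk. h (f' x) = f' (h x) \<Longrightarrow> \<forall>x\<in>K. h x = x \<Longrightarrow> h x = x"
      by blast
    have "g x = x" if "g \<in> G\<^sub>0" for g
    proof -
      have g: "g \<in> G" "\<forall>x\<in>K. g x = x" using that by (simp_all add: assms(7) pointwise_stabilizer_def)
      obtain g' where g': "disk_homeo g g'"
        using mem[OF g(1)] unfolding Homeo_disk_carrier_iff disk_homeo_def by blast
      have "g (f' y) = f' (g y)" if y: "y \<in> disk" for y
      proof -
        have "g y = f (g (f' y))"
          using commute[OF g(1) f.in_disk(2)[OF y]] f.inv(2)[OF y] by simp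
        then show ?thesis
          using f.inv(1) disk_homeo.in_disk(1)[OF g' f.in_disk(2)[OF y]] by metis
      qed
      then show ?thesis using x(2)[OF g'] g(2) by blast
    qed
    then show ?thesis using x(1) by blast
  qed
  then show ?thesis by (force simp: global_Fix_def)
qed

end
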